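(* Let $a,b\in\mathbb{R}$ and let $f,g:\mathbb{R}\to\mathbb{R}$ be Lipschitz functions with Lipschitz constants $\kappa_f,\kappa_g$ respectively. Assume that the two switching rates coincide, $\lambda=\lambda^*>0$, that $v_0+v_0^*\neq0$, and set $v:=\frac{v_0+v_0^*}{2}$. Then there exists a positive absolute constant $C$ such that for any $L>0$, $T>0$, $\lambda>0$, $v\neq0$ the following holds. Let $X$ be the telegraph process with velocities $v_0$ and $-v_0^*$ and common rate $\lambda$, let $\widetilde B$ be a Brownian motion with drift $\mathsf{d}:=\frac{v_0-v_0^*}{2L}$ and diffusivity constant $\sigma^2:=L^{-2}\frac{v_0^2}{\lambda}$, and let $\mathbb{E}_\mu$ and $\mathbb{E}_\nu$ denote expectations with respect to the laws of $L^{-1}X$ and $\widetilde B$ respectively. Then $$\big|\mathbb{E}_\mu[F_{a,b}(L^{-1}X)]-\mathbb{E}_\nu[F_{a,b}(\widetilde B)]\big|\le\sqrt2\,|a|\kappa_f\kappa_g\,\mathcal{W}_2(L^{-1}X,\widetilde B)\Big(\big(\mathbb{E}_\mu[(W_{a,b}(L^{-1}X))^2]\big)^{1/2}+\big(\mathbb{E}_\nu[(W_{a,b}(\widetilde B))^2]\big)^{1/2}\Big).$$ Moreover, with $\widetilde T_*:=\lambda T$ and $\widetilde L_*:=|v|^{-1}\lambda L$, $$\mathcal{W}_2(L^{-1}X,\widetilde B)\le C\sqrt{\widetilde T_*\widetilde L_*^{-2}}\;\widetilde T_*^{-1/4}\Big(\sqrt{\ln(\widetilde T_*+3)}+\widetilde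 T_*^{-3/4}\Big)+C\widetilde L_*^{-1}.$$ In addition, $$\mathbb{E}_\nu[(W_{a,b}(\widetilde B))^2]=\mathbb{E}[(W_{a,b+\mathsf{d}}(B))^2],\qquad \mathbb{E}_\mu[(W_{a,b}(L^{-1}X))^2]=\mathbb{E}[(W_{a,b+\mathsf{d}}(L^{-1}X^{\mathsf{sym},v}))^2],$$ where $B$ is a Brownian motion (without drift) with diffusivity constant $\sigma^2$ and $X^{\mathsf{sym},v}$ is the symmetric telegraph process with velocity parameter $v$ and rate $\lambda$; and the right-hand sides can be estimated by $$\mathbb{E}[(W_{a,b+\mathsf{d}}(B))^2]=\frac{1}{2a^2\sigma^2T+2(b+\mathsf{d})T}\Big(e^{2a^2\sigma^2T+2(b+\mathsf{d})T}-1\Big),$$ $$\mathbb{E}[(W_{a,b+\mathsf{d}}(L^{-1}X^{\mathsf{sym},v}))^2]\le\Big(1+\frac{1}{\sqrt{1+4a^2\widetilde L_*^{-2}}}\Big)\max\Big\{1,\exp\Big(2\widetilde T_*(b+\mathsf{d})/\lambda+\frac{4a^2\widetilde T_*\widetilde L_*^{-2}}{1+\sqrt{1+4a^2\widetilde L_*^{-2}}}\Big)\Big\}.$$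
   Context: Telegraph process with velocities $v_0,-v_0^*$ and common rate $\lambda$: $X(t)=\int_0^tV(s)\,ds$, where $V$ is the càdlàg process with values in $\{v_0,-v_0^*\}$, with $V(0)$ uniform on $\{v_0,-v_0^*\}$, which stays in each state for an exponential time of parameter $\lambda$ (all holding times independent of each other and of $V(0)$) and then switches to the other state. The symmetric telegraph process $X^{\mathsf{sym},v}$ with velocity parameter $v$ and rate $\lambda$ is the same construction with the velocity set $\{v,-v\}$. A Brownian motion with diffusivity constant $\sigma^2$ is a centred real Brownian motion $B$ started at $0$ with $\mathrm{Var}(B(t))=\sigma^2t$; a Brownian motion with drift $\mathsf{d}$ and diffusivity constant $\sigma^2$ is a process with the law of $(\mathsf{d}t+B(t))_{t\ge0}$. For $c\in\mathbb{R}$ and $X\in L^2([0,T],\mathbb{R})$ with $e^{aX}\in L^2([0,T],\mathbb{R})$, $$F_{a,c}(X):=g\Big(\frac1T\int_0^Tf\big(e^{aX(s)+cs}\big)ds\Big),\qquad W_{a,c}(X):=\sqrt{\frac1T\int_0^Te^{2aX(s)+2cs}\,ds}.$$ Let $\|X\|_{\mathsf{Ave}}:=\big(\frac1T\int_0^T|X(s)|^2ds\big)^{1/2}$ and let $L^2_{\mathsf{Ave}}$ be the space of complex-valued functions on $[0,T]$ for which this is finite, with its Borel $\sigma$-algebra. For probability measures $\mu,\nu$ on $L^2_{\mathsf{Ave}}$, $\mathcal{W}_2(\mu,\nu):=\inf_{\Pi}\big(\int\|X-Y\|_{\mathsf{Ave}}^2\,\Pi(dX,dY)\big)^{1/2}$,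 the infimum over all couplings of $\mu$ and $\nu$. For random paths $X,Y$ on $[0,T]$, $\mathcal{W}_2(X,Y)$ means $\mathcal{W}_2$ of their laws. Convention: $\frac{e^x-1}{x}$ is read as $1$ when $x=0$.
   Formalization: Two formulas are corrected: the diffusivity constant is σ²=L^{-2}v²/λ with v=(v_0+v_0^* )/2, not v_0² (else the W_2 bound fails for large T), and b+d is replaced by b+a·d everywhere in the last part (else the W identities fail when d≠0, a≠1). *)

theory Defs
  imports "HOL-Probability.Probability"
begin

text \<open>
  Processes are functions \<open>X :: real \<Rightarrow> 'a \<Rightarrow> real\<close> (time first) on a sample space
  \<open>M :: 'a measure\<close>; only times \<open>t \<ge> 0\<close> matter. Path properties are required for every
  sample point of \<open>M\<close>, not merely almost every one.
\<close>

text \<open>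
  The velocity takes the values \<open>v0\<close> and \<open>- w0\<close>, so \<open>v0 - w0 - V 0 \<omega>\<close> is the state other
  than \<open>V 0 \<omega>\<close>. The \<open>\<tau> n\<close> are the successive holding times; \<open>V\<close> is described on the
  half-open intervals between switching times, which exhaust \<open>[0, \<infinity>)\<close>, hence its paths are
  right-continuous with left limits.
\<close>

definition telegraph_velocity ::
  "'a measure \<Rightarrow> real \<Rightarrow> real \<Rightarrow> real \<Rightarrow> (real \<Rightarrow> 'a \<Rightarrow> real) \<Rightarrow> bool" where
  "telegraph_velocity M v0 w0 lam V \<longleftrightarrow>
    (\<forall>\<omega>\<in>space M. V 0 \<omega> \<in> {v0, - w0}) \<and>
    (\<forall>x\<in>{v0, - w0}. measure M {\<omega> \<in> space M. V 0 \<omega> = x} = 1 / real (card {v0, - w0})) \<and>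
    (\<exists>\<tau> :: nat \<Rightarrow> 'a \<Rightarrow> real.
      (\<forall>n. distributed M lborel (\<tau> n) (exponential_density lam)) \<and>
      prob_space.indep_vars M (\<lambda>_. borel) (case_nat (V 0) \<tau>) UNIV \<and>
      (\<forall>\<omega>\<in>space M.
        (\<forall>n. 0 < \<tau> n \<omega>) \<and>
        filterlim (\<lambda>n. \<Sum>i<n. \<tau> i \<omega>) at_top sequentially \<and>
        (\<forall>n t. (\<Sum>i<n. \<tau> i \<omega>) \<le> t \<and> t < (\<Sum>i<Suc n. \<tau> i \<omega>) \<longrightarrow>
          V t \<omega> = (if even n then V 0 \<omega> else v0 - w0 - V 0 \<omega>))))"

definition telegraph_process ::
  "'a measure \<Rightarrow> real \<Rightarrow> real \<Rightarrow> real \<Rightarrow> (real \<Rightarrow> 'a \<Rightarrow> real) \<Rightarrow> bool" where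
  "telegraph_process M v0 w0 lam X \<longleftrightarrow> prob_space M \<and>
    (\<exists>V. telegraph_velocity M v0 w0 lam V \<and>
      (\<forall>\<omega>\<in>space M. \<forall>t\<ge>0. X t \<omega> = (\<integral>s. V s \<omega> \<partial>lebesgue_on {0..t})))"

definition symmetric_telegraph_process ::
  "'a measure \<Rightarrow> real \<Rightarrow> real \<Rightarrow> (real \<Rightarrow> 'a \<Rightarrow> real) \<Rightarrow> bool" where
  "symmetric_telegraph_process M v lam X \<longleftrightarrow> telegraph_process M v v lam X"

text \<open>
  The parameter \<open>\<sigma>2\<close> is the diffusivity constant (the variance per unit time), whereas
  \<open>normal_density\<close> expects a standard deviation; \<open>\<sigma>2 > 0\<close> is intended.
\<close>

definition brownian_motion ::
  "'a measure \<Rightarrow> real \<Rightarrow> (real \<Rightarrow> 'a \<Rightarrow> real) \<Rightarrow> bool" where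
  "brownian_motion M \<sigma>2 B \<longleftrightarrow> prob_space M \<and>
    (\<forall>\<omega>\<in>space M. B 0 \<omega> = 0 \<and> continuous_on {0..} (\<lambda>t. B t \<omega>)) \<and>
    (\<forall>s t. 0 \<le> s \<and> s < t \<longrightarrow>
      distributed M lborel (\<lambda>\<omega>. B t \<omega> - B s \<omega>) (normal_density 0 (sqrt (\<sigma>2 * (t - s))))) \<and>
    (\<forall>u :: nat \<Rightarrow> real. 0 \<le> u 0 \<and> incseq u \<longrightarrow>
      prob_space.indep_vars M (\<lambda>_. borel) (\<lambda>i \<omega>. B (u (Suc i)) \<omega> - B (u i) \<omega>) UNIV)"

definition drifted_brownian_motion ::
  "'a measure \<Rightarrow> real \<Rightarrow> real \<Rightarrow> (real \<Rightarrow> 'a \<Rightarrow> real) \<Rightarrow> bool" where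
  "drifted_brownian_motion M d \<sigma>2 Y \<longleftrightarrow> brownian_motion M \<sigma>2 (\<lambda>t \<omega>. Y t \<omega> - d * t)"

definition F_fun ::
  "real \<Rightarrow> (real \<Rightarrow> real) \<Rightarrow> (real \<Rightarrow> real) \<Rightarrow> real \<Rightarrow> real \<Rightarrow> (real \<Rightarrow> real) \<Rightarrow> real" where
  "F_fun T f g a c x = g (1 / T * (\<integral>s. f (exp (a * x s + c * s)) \<partial>lebesgue_on {0..T}))"

text \<open>
  Note that replacing the path \<open>x\<close> by \<open>x s + d * s\<close> turns \<open>W_fun T a c\<close> into
  \<open>W_fun T a (c + a * d)\<close>: the drift is multiplied by \<open>a\<close>.
\<close>

definition W_fun :: "real \<Rightarrow> real \<Rightarrow> real \<Rightarrow> (real \<Rightarrow> real) \<Rightarrow> real" where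
  "W_fun T a c x = sqrt (1 / T * (\<integral>s. exp (2 * a * x s + 2 * c * s) \<partial>lebesgue_on {0..T}))"

definition exp_quot :: "real \<Rightarrow> real" where
  "exp_quot x = (if x = 0 then 1 else (exp x - 1) / x)"

text \<open>
  The space \<open>L\<^sup>2\<close> of paths on \<open>[0, T]\<close> is represented by functions rather than by classes of
  almost everywhere equal functions. Its Borel sets are generated by the sets that are open for
  the seminorm; these are unions of classes, so they correspond exactly to the Borel sets of the
  quotient, and so do probability measures and couplings.
\<close>

definition ave_norm :: "real \<Rightarrow> (real \<Rightarrow> complex) \<Rightarrow> real" where
  "ave_norm T x = sqrt (1 / T * (\<integral>s. (cmod (x s))\<^sup>2 \<partial>lebesgue_on {0..T}))"

definition L2_ave_carrier :: "real \<Rightarrow> (real \<Rightarrow> complex) set" where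
  "L2_ave_carrier T = {x. x \<in> borel_measurable (lebesgue_on {0..T}) \<and>
     integrable (lebesgue_on {0..T}) (\<lambda>s. (cmod (x s))\<^sup>2)}"

definition L2_ave :: "real \<Rightarrow> (real \<Rightarrow> complex) measure" where
  "L2_ave T = sigma (L2_ave_carrier T)
     {U. U \<subseteq> L2_ave_carrier T \<and>
       (\<forall>x\<in>U. \<exists>e>0. \<forall>y\<in>L2_ave_carrier T. ave_norm T (\<lambda>s. y s - x s) < e \<longrightarrow> y \<in> U)}"

definition path_law ::
  "real \<Rightarrow> 'a measure \<Rightarrow> (real \<Rightarrow> 'a \<Rightarrow> real) \<Rightarrow> (real \<Rightarrow> complex) measure" where
  "path_law T M X = distr M (L2_ave T) (\<lambda>\<omega> s. complex_of_real (X s \<omega>))"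

definition couplings :: "'a measure \<Rightarrow> 'b measure \<Rightarrow> ('a \<times> 'b) measure set" where
  "couplings \<mu> \<nu> = {\<gamma>. prob_space \<gamma> \<and> sets \<gamma> = sets (\<mu> \<Otimes>\<^sub>M \<nu>) \<and>
     distr \<gamma> \<mu> fst = \<mu> \<and> distr \<gamma> \<nu> snd = \<nu>}"

definition ennreal_sqrt :: "ennreal \<Rightarrow> ennreal" where
  "ennreal_sqrt x = (if x = top then top else ennreal (sqrt (enn2real x)))"

definition wasserstein2 ::
  "real \<Rightarrow> (real \<Rightarrow> complex) measure \<Rightarrow> (real \<Rightarrow> complex) measure \<Rightarrow> ennreal" where
  "wasserstein2 T \<mu> \<nu> = (INF \<gamma>\<in>couplings \<mu> \<nu>.
     ennreal_sqrt (\<integral>\<^sup>+ p. ennreal ((ave_norm T (\<lambda>s. fst p s - snd p s))\<^sup>2) \<partial>\<gamma>))"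

end

theory Submission
  imports Defs "HOL-Real_Asymp.Real_Asymp"
begin

text \<open>
  Both estimates are transport estimates. For any coupling, \<open>|e\<^sup>p - e\<^sup>q| \<le> |p - q| (e\<^sup>2\<^sup>p + e\<^sup>2\<^sup>q)\<^sup>1\<^sup>/\<^sup>2\<close>
  and the Cauchy-Schwarz inequality, first on \<open>[0, T]\<close> and then under the coupling, bound the
  difference of the expectations.

  The coupling rests on the fact that a Brownian motion sampled at independent exponential
  times is a random walk with Laplace distributed steps, and that a Laplace variable together with
  an independent exponential variable is the same as a pair of independent exponential holding
  times, namely their difference and their minimum. Sampling the given Brownian motion \<open>B\<close> along an
  independent Poisson process with arrival times \<open>\<sigma>\<^sub>k\<close> therefore produces the holding times of a
  telegraph process whose position after \<open>2 k\<close> switches is \<open>B \<sigma>\<^sub>k\<close>. At a fixed time \<open>t\<close>, with \<open>k\<close> the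
  integer part of \<open>l t / 2\<close>, both \<open>\<sigma>\<^sub>k - t\<close> and the deviation of the \<open>2 k\<close>-th switching time from \<open>t\<close> are of
  order \<open>t\<^sup>1\<^sup>/\<^sup>2\<close>, and the two positions differ from their values at these times by the square root of
  that order. No supremum over \<open>t\<close> is needed, so this even saves the logarithm.

  The exponential moments of the telegraph path come from its renewal equation.
\<close>

section \<open>Random paths in the averaged L2 space\<close>

text \<open>The rates are forced by matching one cycle. Two holding times p, q of rate l move the
  unit-speed path by p - q: mean 0, variance 2/l^2, mean duration 2/l. This gives diffusivity 1/l at
  unit speed and v^2/l at speed v. The Poisson clock that samples the Brownian motion must therefore
  have rate l/2, and the minimum of p and q has rate 2l. The given processes live on unrelated
  sample spaces, so only laws can be used. A telegraph process is reduced to its initial velocity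
  and its sequence of holding times, whose joint law is a fixed product; the coupling space is the
  given Brownian sample space times independent noise. Two clocks have to be compared with t: the
  renewal time for the Brownian motion and the \<open>2 k\<close>-th switching time for the
  telegraph path. For the first, E (B s - B t)^2 is exactly \<sigma>2 times the time difference. The
  telegraph analogue holds up to a bounded error: after centring each step conditionally on the
  past, the steps are orthogonal, their second moments are at most 2/l times the mean time spent,
  and the removed conditional means form alternating sums that do not accumulate.\<close>

lemma finite_measure_lebesgue_on_Icc: "finite_measure (lebesgue_on {0..T::real})"
  by (rule finite_measureI) (auto simp: emeasure_restrict_space emeasure_lborel_Icc_eq)

lemma measure_lebesgue_on_Icc: "0 \<le> T \<Longrightarrow> measure (lebesgue_on {0..T}) {0..T} = (T::real)"
  by (simp add: measure_restrict_space)

lemma borel_measurable_lebesgue_on: "f \<in> borel_measurable borel \<Longrightarrow> f \<in> borel_measurable (lebesgue_on S)"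
  by (intro measurable_restrict_space1 measurable_completion) simp

lemma integrable_lebesgue_on_bounded:
  fixes f :: "real \<Rightarrow> 'b::{banach, second_countable_topology}"
  assumes "f \<in> borel_measurable (lebesgue_on {0..T})" "\<And>s. s \<in> {0..T} \<Longrightarrow> norm (f s) \<le> K"
  shows "integrable (lebesgue_on {0..T}) f"
proof -
  interpret finite_measure "lebesgue_on {0..T}" by (rule finite_measure_lebesgue_on_Icc)
  show ?thesis
    using assms by (intro integrable_const_bound[of _ K]) auto
qed

lemma L2_ave_carrierD:
  assumes "x \<in> L2_ave_carrier T"
  shows "x \<in> borel_measurable (lebesgue_on {0..T})" "integrable (lebesgue_on {0..T}) (\<lambda>s. (cmod (x s))\<^sup>2)"
  using assms by (auto simp: L2_ave_carrier_def)

lemma cmod_diff_square_le: "(cmod (a - c))\<^sup>2 \<le> 2 * (cmod (a - b))\<^sup>2 + 2 * (cmod (b - c))\<^sup>2"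
proof -
  have "cmod (a - c) \<le> cmod (a - b) + cmod (b - c)"
    using norm_triangle_ineq[of "a - b" "b - c"] by simp
  then have "(cmod (a - c))\<^sup>2 \<le> (cmod (a - b) + cmod (b - c))\<^sup>2"
    by (intro power_mono) auto
  also have "\<dots> \<le> 2 * (cmod (a - b))\<^sup>2 + 2 * (cmod (b - c))\<^sup>2"
    using sum_squares_bound[of "cmod (a - b)" "cmod (b - c)"] by (simp add: power2_sum)
  finally show ?thesis .
qed

lemma L2_ave_carrier_diff:
  assumes "x \<in> L2_ave_carrier T" "y \<in> L2_ave_carrier T"
  shows "(\<lambda>s. x s - y s) \<in> L2_ave_carrier T"
proof -
  note [measurable] = assms[THEN L2_ave_carrierD(1)]
  have "(cmod (x s - y s))\<^sup>2 \<le> 2 * (cmod (x s))\<^sup>2 + 2 * (cmod (y s))\<^sup>2" for s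
    using cmod_diff_square_le[of "x s" "y s" 0] by simp
  then have "integrable (lebesgue_on {0..T}) (\<lambda>s. (cmod (x s - y s))\<^sup>2)"
    by (intro Bochner_Integration.integrable_bound[OF Bochner_Integration.integrable_add[OF
          integrable_mult_right[OF L2_ave_carrierD(2)[OF assms(1)], of 2] integrable_mult_right[OF L2_ave_carrierD(2)[OF assms(2)], of 2]]])
       simp_all
  then show ?thesis by (simp add: L2_ave_carrier_def)
qed

lemma ave_norm_nonneg: "0 < T \<Longrightarrow> 0 \<le> ave_norm T x"
  by (simp add: ave_norm_def)

lemma ave_norm_square: "0 < T \<Longrightarrow> (ave_norm T x)\<^sup>2 = 1 / T * (\<integral>s. (cmod (x s))\<^sup>2 \<partial>lebesgue_on {0..T})"
  by (simp add: ave_norm_def)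

lemma ave_norm_minus_commute: "ave_norm T (\<lambda>s. x s - y s) = ave_norm T (\<lambda>s. y s - x s)"
  by (simp add: ave_norm_def norm_minus_commute)

text \<open>Stands in for the triangle inequality. Working with squares needs only a pointwise
  inequality and linearity of the integral, and the factor 2 is harmless for the topology: two
  distances below \<open>e / 2\<close> give a squared distance below
  \<open>2 * (e / 2)\<^sup>2 + 2 * (e / 2)\<^sup>2\<close>, which is
  \<open>e\<^sup>2\<close>.\<close>

lemma ave_norm_diff_square_le:
  assumes T: "0 < T" and c: "x \<in> L2_ave_carrier T" "y \<in> L2_ave_carrier T" "z \<in> L2_ave_carrier T"
  shows "(ave_norm T (\<lambda>s. x s - z s))\<^sup>2 \<le> 2 * (ave_norm T (\<lambda>s. x s - y s))\<^sup>2 + 2 * (ave_norm T (\<lambda>s. y s - z s))\<^sup>2"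
proof -
  note i = L2_ave_carrierD(2)[OF L2_ave_carrier_diff]
  have "(\<integral>s. (cmod (x s - z s))\<^sup>2 \<partial>lebesgue_on {0..T}) \<le>
      (\<integral>s. 2 * (cmod (x s - y s))\<^sup>2 + 2 * (cmod (y s - z s))\<^sup>2 \<partial>lebesgue_on {0..T})"
    using c by (intro integral_mono cmod_diff_square_le Bochner_Integration.integrable_add integrable_mult_right i)
  also have "\<dots> = 2 * (\<integral>s. (cmod (x s - y s))\<^sup>2 \<partial>lebesgue_on {0..T}) + 2 * (\<integral>s. (cmod (y s - z s))\<^sup>2 \<partial>lebesgue_on {0..T})"
    using c by (simp add: i)
  finally show ?thesis
    unfolding ave_norm_square[OF T] using T by (simp add: field_simps divide_simps)
qed

lemma ave_norm_le_sup:
  assumes T: "0 < T" and x: "x \<in> L2_ave_carrier T" and e: "0 \<le> e" "\<And>s. s \<in> {0..T} \<Longrightarrow> cmod (x s) \<le> e"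
  shows "ave_norm T x \<le> e"
proof -
  interpret finite_measure "lebesgue_on {0..T}" by (rule finite_measure_lebesgue_on_Icc)
  have "(\<integral>s. (cmod (x s))\<^sup>2 \<partial>lebesgue_on {0..T}) \<le> (\<integral>s. e\<^sup>2 \<partial>lebesgue_on {0..T})"
    using x e by (intro integral_mono L2_ave_carrierD(2)) (auto intro!: power_mono)
  also have "\<dots> = e\<^sup>2 * T"
    using T by (simp add: measure_lebesgue_on_Icc)
  finally have "(ave_norm T x)\<^sup>2 \<le> e\<^sup>2"
    unfolding ave_norm_square[OF T] using T by (simp add: field_simps)
  then show ?thesis using e(1) by (simp add: power2_le_iff_abs_le)
qed

lemma L2_ave_carrier_bounded:
  assumes "x \<in> borel_measurable (lebesgue_on {0..T})" "\<And>s. s \<in> {0..T} \<Longrightarrow> cmod (x s) \<le> K"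
  shows "x \<in> L2_ave_carrier T"
proof -
  have "integrable (lebesgue_on {0..T}) (\<lambda>s. (cmod (x s))\<^sup>2)"
    by (rule integrable_lebesgue_on_bounded[where K="K\<^sup>2"]) (use assms in \<open>auto intro!: power_mono\<close>)
  with assms show ?thesis by (simp add: L2_ave_carrier_def)
qed

lemma continuous_in_L2_ave_carrier:
  assumes "continuous_on {0..T} h"
  shows "(\<lambda>s. complex_of_real (h s)) \<in> L2_ave_carrier T"
proof -
  obtain K where K: "\<And>s. s \<in> {0..T} \<Longrightarrow> norm (h s) \<le> K"
    using compact_imp_bounded[OF compact_continuous_image[OF assms compact_Icc]] unfolding bounded_iff by blast
  have [measurable]: "h \<in> borel_measurable (lebesgue_on {0..T})"
    by (rule continuous_imp_measurable_on_sets_lebesgue[OF assms]) auto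
  show ?thesis
    by (rule L2_ave_carrier_bounded[where K=K]) (use K in auto)
qed

section \<open>A countable dense family and Borel measurability of random paths\<close>

definition rat_step :: "real \<Rightarrow> rat list \<Rightarrow> real \<Rightarrow> complex" where
  "rat_step T qs s = complex_of_real (of_rat (qs ! nat \<lfloor>real (length qs - 1) * s / T\<rfloor>))"

text \<open>With n + 1 list entries the steps have width \<open>T / n\<close>, and the index reaches
  n only at the right endpoint \<open>s = T\<close>. This is why the list is one entry longer than
  the number of steps.\<close>

lemma rat_step_in_L2_ave_carrier: 
  assumes "0 < T" "qs \<noteq> []"
  shows "rat_step T qs \<in> L2_ave_carrier T"
proof (rule L2_ave_carrier_bounded)
  have "(\<lambda>s::real. nat \<lfloor>real (length qs - 1) * s / T\<rfloor>) \<in> borel \<rightarrow>\<^sub>M count_space UNIV"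
    by measurable
  then have "(\<lambda>s. complex_of_real (of_rat (qs ! nat \<lfloor>real (length qs - 1) * s / T\<rfloor>))) \<in> borel_measurable borel"
    by (rule measurable_compose) simp
  then show "rat_step T qs \<in> borel_measurable (lebesgue_on {0..T})"
    unfolding rat_step_def[abs_def] by (rule borel_measurable_lebesgue_on)
next
  fix s assume s: "s \<in> {0..T}"
  have "real (length qs - 1) * s / T \<le> real (length qs - 1)"
    using s assms by (simp add: divide_le_eq mult_left_mono)
  then have "nat \<lfloor>real (length qs - 1) * s / T\<rfloor> \<le> length qs - 1"
    by (simp add: nat_le_iff floor_le_iff del: of_nat_diff)
  then have "nat \<lfloor>real (length qs - 1) * s / T\<rfloor> < length qs"
    using assms(2) by (cases qs) auto
  then have "qs ! nat \<lfloor>real (length qs - 1) * s / T\<rfloor> \<in> set qs" by (rule nth_mem)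
  then show "cmod (rat_step T qs s) \<le> Max ((\<lambda>q. \<bar>real_of_rat q\<bar>) ` set qs)"
    unfolding rat_step_def by (auto intro!: Max_ge)
qed

text \<open>Uniform continuity makes the path vary by less than \<open>e / 4\<close> on a step, and
  rounding the grid values to rationals costs another \<open>e / 4\<close>; the resulting supremum
  bound \<open>e / 2\<close> controls the averaged norm.\<close>

lemma rat_step_dense:
  assumes T: "0 < T" and h: "continuous_on {0..T} h" and e: "0 < e"
  shows "\<exists>qs. qs \<noteq> [] \<and> ave_norm T (\<lambda>s. complex_of_real (h s) - rat_step T qs s) < e"
proof -
  have "uniformly_continuous_on {0..T} h"
    using h by (intro compact_uniformly_continuous) auto
  then obtain \<delta> where \<delta>: "\<delta> > 0" "\<And>s t. s \<in> {0..T} \<Longrightarrow> t \<in> {0..T} \<Longrightarrow> dist s t < \<delta> \<Longrightarrow> dist (h s) (h t) < e / 4"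
    unfolding uniformly_continuous_on_def using e by (metis zero_less_divide_iff zero_less_numeral)
  obtain n :: nat where n: "T / \<delta> < real n" using reals_Archimedean2 by blast
  have n0: "0 < real n" using n T \<delta>(1) by (meson divide_pos_pos less_trans)
  have "\<exists>q. \<bar>h (real k * T / real n) - real_of_rat q\<bar> < e / 4" for k
  proof -
    obtain q where "h (real k * T / real n) < real_of_rat q" "real_of_rat q < h (real k * T / real n) + e/4"
      using of_rat_dense[of "h (real k * T / real n)" "h (real k * T / real n) + e/4"] e by auto
    then show ?thesis by (intro exI[of _ q]) auto
  qed
  then obtain r where r: "\<And>k. \<bar>h (real k * T / real n) - real_of_rat (r k)\<bar> < e / 4"
    by metis
  define qs where "qs = map r [0..<Suc n]"
  have len: "length qs = Suc n" by (simp add: qs_def)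
  have ne: "qs \<noteq> []" by (simp add: qs_def)
  have close: "cmod (complex_of_real (h s) - rat_step T qs s) \<le> e / 2" if s: "s \<in> {0..T}" for s
  proof -
    define k where "k = nat \<lfloor>real n * s / T\<rfloor>"
    have k0: "0 \<le> real n * s / T" using s T by auto
    have kr: "real k = of_int \<lfloor>real n * s / T\<rfloor>"
      unfolding k_def using k0 by simp
    have k1: "real k \<le> real n * s / T" "real n * s / T < real k + 1"
      unfolding kr by linarith+
    have "real n * s / T \<le> real n" using s T by (simp add: divide_le_eq mult_left_mono)
    then have kn: "real k \<le> real n" using k1 by linarith
    then have kn': "k < Suc n" by simp
    have a: "real k * T / real n \<le> s" using k1(1) T n0 by (simp add: field_simps)
    have "real n * s < (real k + 1) * T" using k1(2) T by (simp add: divide_less_eq)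
    then have "s < (real k + 1) * T / real n" using n0 by (simp add: less_divide_eq mult.commute)
    also have "\<dots> = real k * T / real n + T / real n" by (simp add: distrib_right add_divide_distrib)
    also have "T / real n < \<delta>" using n n0 \<delta>(1) by (simp add: field_simps)
    finally have b: "s < real k * T / real n + \<delta>" by simp
    have m: "real k * T / real n \<in> {0..T}" using kn n0 T by (auto simp: field_simps)
    have "dist (h s) (h (real k * T / real n)) < e / 4"
      using a b by (intro \<delta>(2) s m) (auto simp: dist_real_def)
    moreover have "rat_step T qs s = complex_of_real (of_rat (r k))"
      unfolding rat_step_def len using kn' by (simp add: k_def[symmetric] qs_def del: upt_Suc)
    ultimately show ?thesis
      using r[of k] unfolding dist_real_def
      by (simp only: norm_of_real flip: of_real_diff)
  qed
  have "ave_norm T (\<lambda>s. complex_of_real (h s) - rat_step T qs s) \<le> e / 2"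
    using T e ne by (intro ave_norm_le_sup L2_ave_carrier_diff continuous_in_L2_ave_carrier h rat_step_in_L2_ave_carrier close) auto
  then show ?thesis using e ne by (intro exI[of _ qs]) auto
qed

lemma space_L2_ave: "space (L2_ave T) = L2_ave_carrier T"
  unfolding L2_ave_def by (intro space_measure_of) auto

lemma L2_ave_openI:
  assumes "U \<subseteq> L2_ave_carrier T"
    "\<And>x. x \<in> U \<Longrightarrow> \<exists>e>0. \<forall>y\<in>L2_ave_carrier T. ave_norm T (\<lambda>s. y s - x s) < e \<longrightarrow> y \<in> U"
  shows "U \<in> sets (L2_ave T)"
  unfolding L2_ave_def using assms by (subst sets_measure_of) auto

text \<open>The generators of the path space are arbitrary open sets, so their preimages have to be
  rewritten as countable unions. Continuous paths are limits of the countably many rational step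
  functions, hence the part of an open set that the random path can hit is covered by countably many
  balls around them. For a fixed centre the distance is measurable in the sample point by Fubini,
  which uses joint measurability of \<open>X\<close>.\<close>

lemma measurable_path:
  assumes T: "0 < T"
    and X: "case_prod X \<in> borel_measurable (lebesgue_on {0..T} \<Otimes>\<^sub>M M)"
    and cont: "\<And>\<omega>. \<omega> \<in> space M \<Longrightarrow> continuous_on {0..T} (\<lambda>t. X t \<omega>)"
  shows "(\<lambda>\<omega> s. complex_of_real (X s \<omega>)) \<in> M \<rightarrow>\<^sub>M L2_ave T"
  unfolding L2_ave_def
proof (rule measurable_measure_of)
  show "(\<lambda>\<omega> s. complex_of_real (X s \<omega>)) \<in> space M \<rightarrow> L2_ave_carrier T"
    using cont by (auto intro!: continuous_in_L2_ave_carrier)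
next
  fix U assume "U \<in> {U. U \<subseteq> L2_ave_carrier T \<and>
       (\<forall>x\<in>U. \<exists>e>0. \<forall>y\<in>L2_ave_carrier T. ave_norm T (\<lambda>s. y s - x s) < e \<longrightarrow> y \<in> U)}"
  then have U: "U \<subseteq> L2_ave_carrier T"
    "\<And>x. x\<in>U \<Longrightarrow> \<exists>e>0. \<forall>y\<in>L2_ave_carrier T. ave_norm T (\<lambda>s. y s - x s) < e \<longrightarrow> y \<in> U" by auto
  \<comment> \<open>For \<open>n = 0\<close> the radius \<open>1 / real n\<close> is 0 and the ball
    is empty, so no case distinction is needed.\<close>
  define B where "B qs (n::nat) = {y\<in>L2_ave_carrier T. ave_norm T (\<lambda>s. y s - rat_step T qs s) < 1 / real n}" for qs n
  define P where "P = {(qs, n). qs \<noteq> [] \<and> B qs n \<subseteq> U}"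
  interpret finite_measure "lebesgue_on {0..T}" by (rule finite_measure_lebesgue_on_Icc)
  have meas: "{\<omega>\<in>space M. ave_norm T (\<lambda>s. complex_of_real (X s \<omega>) - rat_step T qs s) < 1 / real n} \<in> sets M"
    if "qs \<noteq> []" for qs n
  proof -
    note [measurable] = L2_ave_carrierD(1)[OF rat_step_in_L2_ave_carrier[OF T that]] X
    have [measurable]: "(\<lambda>p. X (snd p) (fst p)) \<in> borel_measurable (M \<Otimes>\<^sub>M lebesgue_on {0..T})"
      using measurable_compose[OF measurable_pair_swap' X] by (simp add: split_beta')
    show ?thesis unfolding ave_norm_def by measurable
  qed
  have cover: "\<exists>p\<in>P. x \<in> B (fst p) (snd p)" if x: "x \<in> U" "x = (\<lambda>s. complex_of_real (h s))" "continuous_on {0..T} h" for x h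
  proof -
    obtain e where e: "e > 0" "\<And>y. y\<in>L2_ave_carrier T \<Longrightarrow> ave_norm T (\<lambda>s. y s - x s) < e \<Longrightarrow> y \<in> U"
      using U(2)[OF x(1)] by blast
    obtain n :: nat where n: "2 / e < real n" using reals_Archimedean2 by blast
    have n0: "0 < real n" using n e(1) by (meson divide_pos_pos less_trans zero_less_numeral)
    have n1: "1 / real n < e / 2" using n n0 e(1) by (simp add: field_simps)
    obtain qs where qs: "qs \<noteq> []" "ave_norm T (\<lambda>s. x s - rat_step T qs s) < 1 / real n"
      using rat_step_dense[OF T x(3), of "1 / real n"] n0 by (auto simp: x(2))
    have xc: "x \<in> L2_ave_carrier T" using x U by auto
    have "B qs n \<subseteq> U"
    proof
      fix y assume "y \<in> B qs n"
      then have y: "y \<in> L2_ave_carrier T" "ave_norm T (\<lambda>s. y s - rat_step T qs s) < e / 2" 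
        using n1 by (auto simp: B_def)
      have q: "ave_norm T (\<lambda>s. rat_step T qs s - x s) < e / 2"
        using qs n1 by (simp add: ave_norm_minus_commute)
      have "(ave_norm T (\<lambda>s. y s - x s))\<^sup>2 \<le> 2 * (ave_norm T (\<lambda>s. y s - rat_step T qs s))\<^sup>2 + 2 * (ave_norm T (\<lambda>s. rat_step T qs s - x s))\<^sup>2"
        by (intro ave_norm_diff_square_le T y xc rat_step_in_L2_ave_carrier qs)
      also have "\<dots> < 2 * (e / 2)\<^sup>2 + 2 * (e / 2)\<^sup>2"
        using y q T by (intro add_strict_mono mult_strict_left_mono power_strict_mono) (auto simp: ave_norm_nonneg)
      also have "\<dots> = e\<^sup>2" by (simp add: power2_eq_square)
      finally have "ave_norm T (\<lambda>s. y s - x s) < e"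
        using e(1) by (simp add: power_less_imp_less_base)
      then show "y \<in> U" using e y by blast
    qed
    then show ?thesis using qs xc by (intro bexI[of _ "(qs, n)"]) (auto simp: P_def B_def)
  qed
  have "(\<lambda>\<omega> s. complex_of_real (X s \<omega>)) -` U \<inter> space M =
     (\<Union>p\<in>P. {\<omega>\<in>space M. ave_norm T (\<lambda>s. complex_of_real (X s \<omega>) - rat_step T (fst p) s) < 1 / real (snd p)})"
  proof (intro set_eqI iffI)
    fix \<omega> assume a: "\<omega> \<in> (\<lambda>\<omega> s. complex_of_real (X s \<omega>)) -` U \<inter> space M"
    then obtain p where "p \<in> P" "(\<lambda>s. complex_of_real (X s \<omega>)) \<in> B (fst p) (snd p)"
      using cover[of "\<lambda>s. complex_of_real (X s \<omega>)" "\<lambda>s. X s \<omega>"] cont by auto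
    then show "\<omega> \<in> (\<Union>p\<in>P. {\<omega>\<in>space M. ave_norm T (\<lambda>s. complex_of_real (X s \<omega>) - rat_step T (fst p) s) < 1 / real (snd p)})"
      using a by (auto simp: B_def)
  next
    fix \<omega> assume "\<omega> \<in> (\<Union>p\<in>P. {\<omega>\<in>space M. ave_norm T (\<lambda>s. complex_of_real (X s \<omega>) - rat_step T (fst p) s) < 1 / real (snd p)})"
    then obtain p where p: "p \<in> P" "\<omega> \<in> space M" "ave_norm T (\<lambda>s. complex_of_real (X s \<omega>) - rat_step T (fst p) s) < 1 / real (snd p)"
      by auto
    then have "(\<lambda>s. complex_of_real (X s \<omega>)) \<in> B (fst p) (snd p)"
      using cont by (auto simp: B_def continuous_in_L2_ave_carrier)
    with p show "\<omega> \<in> (\<lambda>\<omega> s. complex_of_real (X s \<omega>)) -` U \<inter> space M"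
      by (auto simp: P_def)
  qed
  also have "\<dots> \<in> sets M"
    by (intro sets.countable_UN') (auto simp: P_def intro!: meas)
  finally show "(\<lambda>\<omega> s. complex_of_real (X s \<omega>)) -` U \<inter> space M \<in> sets M" .
qed auto

text \<open>Functions that agree on \<open>[0, T]\<close> have distance 0, so no open set separates
  them, and this passes to the generated \<sigma>-algebra by induction. It lets a path be replaced
  by a formula that is valid only for times in \<open>[0, T]\<close>.\<close>

lemma sets_L2_ave_saturated:
  assumes U: "U \<in> sets (L2_ave T)" and x: "x \<in> L2_ave_carrier T" "y \<in> L2_ave_carrier T"
    and eq: "\<And>t. t \<in> {0..T} \<Longrightarrow> x t = y t"
  shows "x \<in> U \<longleftrightarrow> y \<in> U"
proof -
  have z: "ave_norm T (\<lambda>s. y s - x s) = 0" "ave_norm T (\<lambda>s. x s - y s) = 0"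
    using eq by (auto simp: ave_norm_def intro!: integral_eq_zero_AE)
  have "U \<in> sigma_sets (L2_ave_carrier T) {U. U \<subseteq> L2_ave_carrier T \<and>
       (\<forall>x\<in>U. \<exists>e>0. \<forall>y\<in>L2_ave_carrier T. ave_norm T (\<lambda>s. y s - x s) < e \<longrightarrow> y \<in> U)}"
    using U unfolding L2_ave_def by (subst (asm) sets_measure_of) auto
  then show ?thesis
  proof induction
    case (Basic a)
    then show ?case using x z by fastforce
  qed (use x in auto)
qed

lemma path_law_cong:
  assumes X: "(\<lambda>\<omega> s. complex_of_real (X s \<omega>)) \<in> M \<rightarrow>\<^sub>M L2_ave T" and Y: "(\<lambda>\<omega> s. complex_of_real (Y s \<omega>)) \<in> M \<rightarrow>\<^sub>M L2_ave T"
    and eq: "\<And>\<omega> t. \<omega> \<in> space M \<Longrightarrow> t \<in> {0..T} \<Longrightarrow> X t \<omega> = Y t \<omega>"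
  shows "path_law T M X = path_law T M Y"
  unfolding path_law_def
proof (rule measure_eqI)
  fix U assume "U \<in> sets (distr M (L2_ave T) (\<lambda>\<omega> s. complex_of_real (X s \<omega>)))"
  then have U: "U \<in> sets (L2_ave T)" by simp
  have "(\<lambda>s. complex_of_real (X s \<omega>)) \<in> U \<longleftrightarrow> (\<lambda>s. complex_of_real (Y s \<omega>)) \<in> U" if "\<omega> \<in> space M" for \<omega>
    using measurable_space[OF X that] measurable_space[OF Y that] eq[OF that]
    by (intro sets_L2_ave_saturated[OF U]) (auto simp: space_L2_ave)
  then have "(\<lambda>\<omega> s. complex_of_real (X s \<omega>)) -` U \<inter> space M = (\<lambda>\<omega> s. complex_of_real (Y s \<omega>)) -` U \<inter> space M"
    by auto
  then show "emeasure (distr M (L2_ave T) (\<lambda>\<omega> s. complex_of_real (X s \<omega>))) U = emeasure (distr M (L2_ave T) (\<lambda>\<omega> s. complex_of_real (Y s \<omega>))) U"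
    using U X Y by (simp add: emeasure_distr)
qed simp

lemma borel_measurable_L2_ave_lipschitz:
  fixes G :: "(real \<Rightarrow> complex) \<Rightarrow> real"
  assumes T: "0 < T" and G: "\<And>x y. x \<in> L2_ave_carrier T \<Longrightarrow> y \<in> L2_ave_carrier T \<Longrightarrow> \<bar>G x - G y\<bar> \<le> K * ave_norm T (\<lambda>s. x s - y s)"
  shows "G \<in> borel_measurable (L2_ave T)"
proof (rule borel_measurableI)
  fix S :: "real set" assume S: "open S"
  show "G -` S \<inter> space (L2_ave T) \<in> sets (L2_ave T)"
    unfolding space_L2_ave
  proof (rule L2_ave_openI)
    fix x assume x: "x \<in> G -` S \<inter> L2_ave_carrier T"
    then obtain e where e: "e > 0" "\<And>z. dist z (G x) < e \<Longrightarrow> z \<in> S"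
      using S by (auto simp: open_dist)
    show "\<exists>e>0. \<forall>y\<in>L2_ave_carrier T. ave_norm T (\<lambda>s. y s - x s) < e \<longrightarrow> y \<in> G -` S \<inter> L2_ave_carrier T"
    \<comment> \<open>Dividing by \<open>\<bar>K\<bar> + 1\<close> covers the cases in which
      \<open>K\<close> is zero or negative.\<close>
    proof (intro exI[of _ "e / (\<bar>K\<bar> + 1)"] conjI ballI impI)
      show "0 < e / (\<bar>K\<bar> + 1)" using e by (simp add: add_nonneg_pos)
      fix y assume y: "y \<in> L2_ave_carrier T" "ave_norm T (\<lambda>s. y s - x s) < e / (\<bar>K\<bar> + 1)"
      have "\<bar>G y - G x\<bar> \<le> K * ave_norm T (\<lambda>s. y s - x s)" using x y by (intro G) auto
      also have "\<dots> \<le> (\<bar>K\<bar> + 1) * ave_norm T (\<lambda>s. y s - x s)"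
        using T by (intro mult_right_mono) (auto simp: ave_norm_nonneg)
      also have "\<dots> < e" using y by (simp add: field_simps add_nonneg_pos pos_less_divide_eq)
      finally show "y \<in> G -` S \<inter> L2_ave_carrier T" using y e by (auto simp: dist_real_def)
    qed
  qed auto
qed

section \<open>Truncated functionals and the Wasserstein bound\<close>

lemma exp_diff_le:
  fixes p q :: real
  shows "\<bar>exp p - exp q\<bar> \<le> \<bar>p - q\<bar> * sqrt (exp (2 * p) + exp (2 * q))"
proof -
  have *: "exp u - exp w \<le> \<bar>u - w\<bar> * sqrt (exp (2 * u) + exp (2 * w))" if "w \<le> u" for u w :: real
  proof -
    have "1 + (w - u) \<le> exp (w - u)" by (rule exp_ge_add_one_self)
    then have "exp u * (1 + (w - u)) \<le> exp u * exp (w - u)" by (intro mult_left_mono) auto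
    then have "exp u - exp w \<le> (u - w) * exp u" by (simp add: mult_exp_exp algebra_simps)
    also have "\<dots> \<le> \<bar>u - w\<bar> * sqrt (exp (2 * u) + exp (2 * w))"
      using that by (intro mult_mono real_le_rsqrt) (auto simp: exp_double)
    finally show ?thesis .
  qed
  show ?thesis
    using *[of q p] *[of p q] by (cases "q \<le> p") (auto simp: abs_minus_commute add.commute)
qed

lemma abs_min_diff_le: "\<bar>min u n - min w n\<bar> \<le> \<bar>u - w\<bar>" for u w n :: real
  by (simp add: min_def)

lemma exp_min_lipschitz:
  fixes u w n c :: real
  shows "\<bar>exp (min u n + c) - exp (min w n + c)\<bar> \<le> sqrt 2 * exp (n + c) * \<bar>u - w\<bar>"
proof -
  have "sqrt (exp (2 * (min u n + c)) + exp (2 * (min w n + c))) \<le> sqrt (2 * (exp (n + c))\<^sup>2)"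
  proof (intro real_sqrt_le_mono)
    have "exp (2 * (min u n + c)) \<le> (exp (n + c))\<^sup>2" "exp (2 * (min w n + c)) \<le> (exp (n + c))\<^sup>2"
      by (simp_all flip: exp_double)
    then show "exp (2 * (min u n + c)) + exp (2 * (min w n + c)) \<le> 2 * (exp (n + c))\<^sup>2" by simp
  qed
  also have "\<dots> = sqrt 2 * exp (n + c)" by (simp add: real_sqrt_mult)
  finally have s: "sqrt (exp (2 * (min u n + c)) + exp (2 * (min w n + c))) \<le> sqrt 2 * exp (n + c)" .
  have "\<bar>exp (min u n + c) - exp (min w n + c)\<bar> \<le> \<bar>(min u n + c) - (min w n + c)\<bar> * sqrt (exp (2 * (min u n + c)) + exp (2 * (min w n + c)))"
    by (rule exp_diff_le)
  also have "\<dots> \<le> \<bar>u - w\<bar> * (sqrt 2 * exp (n + c))"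
    using abs_min_diff_le[of u n w] by (intro mult_mono s) auto
  finally show ?thesis by (simp add: mult_ac)
qed

lemma Cauchy_Schwarz_integral:
  fixes f g :: "'a \<Rightarrow> real"
  assumes [measurable]: "f \<in> borel_measurable M" "g \<in> borel_measurable M"
    and i: "integrable M (\<lambda>x. (f x)\<^sup>2)" "integrable M (\<lambda>x. (g x)\<^sup>2)"
  shows "integrable M (\<lambda>x. f x * g x)"
    "(\<integral>x. \<bar>f x * g x\<bar> \<partial>M) \<le> sqrt (\<integral>x. (f x)\<^sup>2 \<partial>M) * sqrt (\<integral>x. (g x)\<^sup>2 \<partial>M)"
proof -
  show int: "integrable M (\<lambda>x. f x * g x)"
  proof (rule Bochner_Integration.integrable_bound[OF Bochner_Integration.integrable_add[OF i]])
    show "AE x in M. norm (f x * g x) \<le> norm ((f x)\<^sup>2 + (g x)\<^sup>2)"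
    proof (intro always_eventually allI)
      fix x show "norm (f x * g x) \<le> norm ((f x)\<^sup>2 + (g x)\<^sup>2)"
      proof -
        have "0 \<le> \<bar>f x\<bar> * \<bar>g x\<bar>" by simp
        moreover have "2 * (\<bar>f x\<bar> * \<bar>g x\<bar>) \<le> (f x)\<^sup>2 + (g x)\<^sup>2"
          using sum_squares_bound[of "\<bar>f x\<bar>" "\<bar>g x\<bar>"] by simp
        ultimately have "\<bar>f x\<bar> * \<bar>g x\<bar> \<le> (f x)\<^sup>2 + (g x)\<^sup>2" by linarith
        then show ?thesis by (simp add: abs_mult)
      qed
    qed
  qed simp
  have "(\<integral>\<^sup>+x. ennreal \<bar>f x\<bar> * ennreal \<bar>g x\<bar> \<partial>M)\<^sup>2 \<le> (\<integral>\<^sup>+x. (ennreal \<bar>f x\<bar>)\<^sup>2 \<partial>M) * (\<integral>\<^sup>+x. (ennreal \<bar>g x\<bar>)\<^sup>2 \<partial>M)"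
    by (rule Cauchy_Schwarz_nn_integral) measurable
  also have "(\<integral>\<^sup>+x. ennreal \<bar>f x\<bar> * ennreal \<bar>g x\<bar> \<partial>M) = ennreal (\<integral>x. \<bar>f x * g x\<bar> \<partial>M)"
    using integrable_abs[OF int] by (subst nn_integral_eq_integral[symmetric]) (auto simp: ennreal_mult abs_mult)
  also have "(\<integral>\<^sup>+x. (ennreal \<bar>f x\<bar>)\<^sup>2 \<partial>M) = ennreal (\<integral>x. (f x)\<^sup>2 \<partial>M)"
    using i by (subst nn_integral_eq_integral[symmetric]) (auto simp: ennreal_power)
  also have "(\<integral>\<^sup>+x. (ennreal \<bar>g x\<bar>)\<^sup>2 \<partial>M) = ennreal (\<integral>x. (g x)\<^sup>2 \<partial>M)"
    using i by (subst nn_integral_eq_integral[symmetric]) (auto simp: ennreal_power)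
  finally have "(\<integral>x. \<bar>f x * g x\<bar> \<partial>M)\<^sup>2 \<le> (\<integral>x. (f x)\<^sup>2 \<partial>M) * (\<integral>x. (g x)\<^sup>2 \<partial>M)"
    by (simp add: ennreal_power flip: ennreal_mult)
  then show "(\<integral>x. \<bar>f x * g x\<bar> \<partial>M) \<le> sqrt (\<integral>x. (f x)\<^sup>2 \<partial>M) * sqrt (\<integral>x. (g x)\<^sup>2 \<partial>M)"
    by (simp add: real_le_rsqrt flip: real_sqrt_mult)
qed

text \<open>The Cauchy-Schwarz inequality on \<open>[0, T]\<close> with a free weight. The weight is
  a sum of two exponentials when it is applied to \<open>F_trunc\<close>, and the constant 1 when it
  yields the Lipschitz bound for \<open>V_trunc\<close>.\<close>

lemma ave_diff_weighted_le:
  fixes \<phi> \<psi> w :: "real \<Rightarrow> real"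
  assumes T: "0 < T" and xy: "x \<in> L2_ave_carrier T" "y \<in> L2_ave_carrier T"
    and i: "integrable (lebesgue_on {0..T}) \<phi>" "integrable (lebesgue_on {0..T}) \<psi>" "integrable (lebesgue_on {0..T}) w"
    and w: "\<And>s. 0 \<le> w s" and K: "0 \<le> K"
    and le: "\<And>s. s \<in> {0..T} \<Longrightarrow> \<bar>\<phi> s - \<psi> s\<bar> \<le> K * (cmod (x s - y s) * sqrt (w s))"
  shows "\<bar>1 / T * (\<integral>s. \<phi> s \<partial>lebesgue_on {0..T}) - 1 / T * (\<integral>s. \<psi> s \<partial>lebesgue_on {0..T})\<bar> \<le>
    K * (ave_norm T (\<lambda>s. x s - y s) * sqrt (1 / T * (\<integral>s. w s \<partial>lebesgue_on {0..T})))"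
proof -
  let ?L = "lebesgue_on {0..T}"
  note d = L2_ave_carrierD[OF L2_ave_carrier_diff[OF xy]]
  note [measurable] = d(1) borel_measurable_integrable[OF i(3)]
  have w2: "(sqrt (w s))\<^sup>2 = w s" for s using w by simp
  note cs = Cauchy_Schwarz_integral[of "\<lambda>s. cmod (x s - y s)" ?L "\<lambda>s. sqrt (w s)", unfolded w2, OF _ _ d(2) i(3), simplified]
  have nn: "\<bar>cmod (x s - y s) * sqrt (w s)\<bar> = cmod (x s - y s) * sqrt (w s)" for s using w by simp
  have "\<bar>(\<integral>s. \<phi> s \<partial>?L) - (\<integral>s. \<psi> s \<partial>?L)\<bar> = \<bar>\<integral>s. \<phi> s - \<psi> s \<partial>?L\<bar>" using i by simp
  also have "\<dots> \<le> (\<integral>s. \<bar>\<phi> s - \<psi> s\<bar> \<partial>?L)" by (rule integral_abs_bound)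
  also have "\<dots> \<le> (\<integral>s. K * (cmod (x s - y s) * sqrt (w s)) \<partial>?L)"
    using i by (intro integral_mono le integrable_mult_right cs(1)) auto
  also have "\<dots> = K * (\<integral>s. \<bar>cmod (x s - y s) * sqrt (w s)\<bar> \<partial>?L)" unfolding nn by simp
  also have "\<dots> \<le> K * (sqrt (\<integral>s. (cmod (x s - y s))\<^sup>2 \<partial>?L) * sqrt (\<integral>s. w s \<partial>?L))"
    using K Cauchy_Schwarz_integral(2)[of "\<lambda>s. cmod (x s - y s)" ?L "\<lambda>s. sqrt (w s)", unfolded w2, OF _ _ d(2) i(3)]
    by (intro mult_left_mono) auto
  finally have "1 / T * \<bar>(\<integral>s. \<phi> s \<partial>?L) - (\<integral>s. \<psi> s \<partial>?L)\<bar> \<le> 1 / T * (K * (sqrt (\<integral>s. (cmod (x s - y s))\<^sup>2 \<partial>?L) * sqrt (\<integral>s. w s \<partial>?L)))"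
    using T by (intro mult_left_mono) auto
  also have "\<dots> = K * (ave_norm T (\<lambda>s. x s - y s) * sqrt (1 / T * (\<integral>s. w s \<partial>?L)))"
    unfolding ave_norm_def real_sqrt_mult using T by (simp add: real_sqrt_divide field_simps)
  finally show ?thesis
    using T by (simp add: abs_mult flip: right_diff_distrib diff_divide_distrib)
qed

text \<open>
  The functionals are not continuous on the path space. Truncating the exponent from above makes
  them Lipschitz, hence Borel measurable, and along a continuous path the truncation is eventually
  inactive.
\<close>

definition F_trunc :: "real \<Rightarrow> (real \<Rightarrow> real) \<Rightarrow> (real \<Rightarrow> real) \<Rightarrow> real \<Rightarrow> real \<Rightarrow> real \<Rightarrow> (real \<Rightarrow> complex) \<Rightarrow> real" where
  "F_trunc T f g a c n x = g (1 / T * (\<integral>s. f (exp (min (a * Re (x s)) n + c * s)) \<partial>lebesgue_on {0..T}))"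

definition V_trunc :: "real \<Rightarrow> real \<Rightarrow> real \<Rightarrow> real \<Rightarrow> (real \<Rightarrow> complex) \<Rightarrow> real" where
  "V_trunc T a c n x = 1 / T * (\<integral>s. exp (2 * (min (a * Re (x s)) n + c * s)) \<partial>lebesgue_on {0..T})"

lemma lipschitz_on_UNIV_real:
  assumes "\<kappa>-lipschitz_on UNIV (f :: real \<Rightarrow> real)"
  shows "0 \<le> \<kappa>" "\<bar>f u - f w\<bar> \<le> \<kappa> * \<bar>u - w\<bar>" "f \<in> borel_measurable borel"
  using lipschitz_onD[OF assms, of u w] lipschitz_on_nonneg[OF assms] lipschitz_on_continuous_on[OF assms]
  by (auto simp: dist_real_def intro: borel_measurable_continuous_onI)

lemma min_plus_le: "s \<in> {0..T} \<Longrightarrow> min (u::real) n + c * s \<le> n + \<bar>c\<bar> * T"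
proof -
  assume "s \<in> {0..T}"
  then have "c * s \<le> \<bar>c\<bar> * T" by (intro mult_mono) auto
  then show ?thesis by linarith
qed

lemma borel_measurable_min_plus:
  assumes "x \<in> L2_ave_carrier T"
  shows "(\<lambda>s. min (a * Re (x s)) n + c * s) \<in> borel_measurable (lebesgue_on {0..T})"
proof -
  note [measurable] = L2_ave_carrierD(1)[OF assms]
  have [measurable]: "(\<lambda>s. c * s) \<in> borel_measurable (lebesgue_on {0..T})" by (rule borel_measurable_lebesgue_on) simp
  show ?thesis by measurable
qed

lemma integrable_exp_trunc:
  assumes "x \<in> L2_ave_carrier T"
  shows "integrable (lebesgue_on {0..T}) (\<lambda>s. exp (2 * (min (a * Re (x s)) n + c * s)))"
proof (rule integrable_lebesgue_on_bounded)
  show "(\<lambda>s. exp (2 * (min (a * Re (x s)) n + c * s))) \<in> borel_measurable (lebesgue_on {0..T})"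
    using borel_measurable_min_plus[OF assms] by measurable
  show "norm (exp (2 * (min (a * Re (x s)) n + c * s))) \<le> exp (2 * (n + \<bar>c\<bar> * T))" if "s \<in> {0..T}" for s
    using min_plus_le[OF that, of "a * Re (x s)" n c] by simp
qed

lemma integrable_f_exp_trunc:
  fixes f :: "real \<Rightarrow> real"
  assumes "x \<in> L2_ave_carrier T" and f: "\<kappa>-lipschitz_on UNIV f"
  shows "integrable (lebesgue_on {0..T}) (\<lambda>s. f (exp (min (a * Re (x s)) n + c * s)))"
proof -
  note [measurable] = lipschitz_on_UNIV_real(3)[OF f]
  show ?thesis
  proof (rule integrable_lebesgue_on_bounded)
  show "(\<lambda>s. f (exp (min (a * Re (x s)) n + c * s))) \<in> borel_measurable (lebesgue_on {0..T})"
    using borel_measurable_min_plus[OF assms(1)] by measurable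
  show "norm (f (exp (min (a * Re (x s)) n + c * s))) \<le> \<bar>f 0\<bar> + \<kappa> * exp (n + \<bar>c\<bar> * T)" if "s \<in> {0..T}" for s
  proof -
    have "\<bar>f (exp (min (a * Re (x s)) n + c * s)) - f 0\<bar> \<le> \<kappa> * \<bar>exp (min (a * Re (x s)) n + c * s) - 0\<bar>"
      by (rule lipschitz_on_UNIV_real(2)[OF f])
    also have "\<dots> \<le> \<kappa> * exp (n + \<bar>c\<bar> * T)"
      using min_plus_le[OF that] lipschitz_on_UNIV_real(1)[OF f] by (intro mult_left_mono) auto
    finally show ?thesis by simp
  qed
  qed
qed

text \<open>Strict positivity allows division by the square root of \<open>V_trunc\<close> in the
  coupling estimate.\<close>

lemma V_trunc_pos: 
  assumes "0 < T" "x \<in> L2_ave_carrier T"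
  shows "0 < V_trunc T a c n x"
proof -
  interpret finite_measure "lebesgue_on {0..T}" by (rule finite_measure_lebesgue_on_Icc)
  have "(\<integral>s. 0 \<partial>lebesgue_on {0..T}) < (\<integral>s. exp (2 * (min (a * Re (x s)) n + c * s)) \<partial>lebesgue_on {0..T})"
    using assms by (intro integral_less_AE_space integrable_exp_trunc) (auto simp: emeasure_restrict_space)
  then show ?thesis using assms by (simp add: V_trunc_def)
qed

text \<open>Here the right-hand side keeps the random weight instead of a constant: the weight is
  bounded by the untruncated \<open>W_fun\<close>, uniformly in \<open>n\<close>, so the estimate
  survives the removal of the truncation.\<close>

lemma F_trunc_diff_le:
  assumes T: "0 < T" and f: "\<kappa>f-lipschitz_on UNIV f" and g: "\<kappa>g-lipschitz_on UNIV g"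
    and xy: "x \<in> L2_ave_carrier T" "y \<in> L2_ave_carrier T"
  shows "\<bar>F_trunc T f g a c n x - F_trunc T f g a c n y\<bar> \<le>
    \<bar>a\<bar> * \<kappa>f * \<kappa>g * ave_norm T (\<lambda>s. x s - y s) * sqrt (V_trunc T a c n x + V_trunc T a c n y)"
proof -
  let ?e = "\<lambda>x s. min (a * Re (x s)) n + c * s"
  let ?L = "lebesgue_on {0..T}"
  note f0 = lipschitz_on_UNIV_real(1)[OF f]
  note g0 = lipschitz_on_UNIV_real(1)[OF g]
  have le: "\<bar>f (exp (?e x s)) - f (exp (?e y s))\<bar> \<le> (\<bar>a\<bar> * \<kappa>f) * (cmod (x s - y s) * sqrt (exp (2 * ?e x s) + exp (2 * ?e y s)))" for s
  proof -
    have "\<bar>f (exp (?e x s)) - f (exp (?e y s))\<bar> \<le> \<kappa>f * \<bar>exp (?e x s) - exp (?e y s)\<bar>"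
      by (rule lipschitz_on_UNIV_real(2)[OF f])
    also have "\<dots> \<le> \<kappa>f * (\<bar>?e x s - ?e y s\<bar> * sqrt (exp (2 * ?e x s) + exp (2 * ?e y s)))"
      using f0 by (intro mult_left_mono exp_diff_le)
    also have "\<dots> \<le> \<kappa>f * ((\<bar>a\<bar> * cmod (x s - y s)) * sqrt (exp (2 * ?e x s) + exp (2 * ?e y s)))"
    proof (intro mult_left_mono[OF _ f0] mult_right_mono)
      have "\<bar>?e x s - ?e y s\<bar> \<le> \<bar>a * Re (x s) - a * Re (y s)\<bar>" using abs_min_diff_le[of "a * Re (x s)" n "a * Re (y s)"] by simp
      also have "\<dots> = \<bar>a\<bar> * \<bar>Re (x s - y s)\<bar>" by (simp add: abs_mult flip: right_diff_distrib)
      also have "\<dots> \<le> \<bar>a\<bar> * cmod (x s - y s)" by (intro mult_left_mono abs_Re_le_cmod) auto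
      finally show "\<bar>?e x s - ?e y s\<bar> \<le> \<bar>a\<bar> * cmod (x s - y s)" .
    qed auto
    finally show ?thesis by (simp add: mult_ac)
  qed
  have "\<bar>F_trunc T f g a c n x - F_trunc T f g a c n y\<bar> \<le>
    \<kappa>g * \<bar>1 / T * (\<integral>s. f (exp (?e x s)) \<partial>?L) - 1 / T * (\<integral>s. f (exp (?e y s)) \<partial>?L)\<bar>"
    unfolding F_trunc_def by (rule lipschitz_on_UNIV_real(2)[OF g])
  also have "\<dots> \<le> \<kappa>g * ((\<bar>a\<bar> * \<kappa>f) * (ave_norm T (\<lambda>s. x s - y s) * sqrt (1 / T * (\<integral>s. exp (2 * ?e x s) + exp (2 * ?e y s) \<partial>?L))))"
    using xy f0 by (intro mult_left_mono[OF _ g0] ave_diff_weighted_le[OF T xy] le integrable_f_exp_trunc[OF _ f]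
        Bochner_Integration.integrable_add integrable_exp_trunc) auto
  also have "1 / T * (\<integral>s. exp (2 * ?e x s) + exp (2 * ?e y s) \<partial>?L) = V_trunc T a c n x + V_trunc T a c n y"
    unfolding V_trunc_def using Bochner_Integration.integral_add[OF integrable_exp_trunc[OF xy(1)] integrable_exp_trunc[OF xy(2)], of a n c a n c]
    by (simp only: distrib_left)
  finally show ?thesis by (simp add: mult_ac)
qed

text \<open>Truncation bounds the weight by a constant that grows with \<open>n\<close>. The
  resulting Lipschitz constant is used for measurability only, so its growth does no harm.\<close>

lemma borel_measurable_F_trunc:
  assumes T: "0 < T" and f: "\<kappa>f-lipschitz_on UNIV f" and g: "\<kappa>g-lipschitz_on UNIV g"
  shows "F_trunc T f g a c n \<in> borel_measurable (L2_ave T)"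
proof (rule borel_measurable_L2_ave_lipschitz[OF T])
  fix x y assume xy: "x \<in> L2_ave_carrier T" "y \<in> L2_ave_carrier T"
  note f0 = lipschitz_on_UNIV_real(1)[OF f]
  note g0 = lipschitz_on_UNIV_real(1)[OF g]
  have V: "V_trunc T a c n z \<le> exp (2 * (n + \<bar>c\<bar> * T))" if z: "z \<in> L2_ave_carrier T" for z
  proof -
    interpret finite_measure "lebesgue_on {0..T}" by (rule finite_measure_lebesgue_on_Icc)
    have "(\<integral>s. exp (2 * (min (a * Re (z s)) n + c * s)) \<partial>lebesgue_on {0..T}) \<le> (\<integral>s. exp (2 * (n + \<bar>c\<bar> * T)) \<partial>lebesgue_on {0..T})"
    proof (intro integral_mono integrable_exp_trunc z)
      show "exp (2 * (min (a * Re (z s)) n + c * s)) \<le> exp (2 * (n + \<bar>c\<bar> * T))" if "s \<in> space (lebesgue_on {0..T})" for s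
        using min_plus_le[of s T "a * Re (z s)" n c] that by simp
    qed simp
    also have "\<dots> = T * exp (2 * (n + \<bar>c\<bar> * T))" using T by (simp add: measure_lebesgue_on_Icc)
    finally show ?thesis using T by (simp add: V_trunc_def field_simps)
  qed
  have "\<bar>F_trunc T f g a c n x - F_trunc T f g a c n y\<bar> \<le>
    \<bar>a\<bar> * \<kappa>f * \<kappa>g * ave_norm T (\<lambda>s. x s - y s) * sqrt (V_trunc T a c n x + V_trunc T a c n y)"
    by (rule F_trunc_diff_le[OF T f g xy])
  also have "\<dots> \<le> \<bar>a\<bar> * \<kappa>f * \<kappa>g * ave_norm T (\<lambda>s. x s - y s) * sqrt (2 * exp (2 * (n + \<bar>c\<bar> * T)))"
    using V[OF xy(1)] V[OF xy(2)] f0 g0 T by (intro mult_left_mono real_sqrt_le_mono mult_nonneg_nonneg ave_norm_nonneg) auto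
  finally show "\<bar>F_trunc T f g a c n x - F_trunc T f g a c n y\<bar> \<le> (\<bar>a\<bar> * \<kappa>f * \<kappa>g * sqrt (2 * exp (2 * (n + \<bar>c\<bar> * T)))) * ave_norm T (\<lambda>s. x s - y s)"
    by (simp add: mult_ac)
qed

lemma borel_measurable_V_trunc:
  assumes T: "0 < T"
  shows "V_trunc T a c n \<in> borel_measurable (L2_ave T)"
proof (rule borel_measurable_L2_ave_lipschitz[OF T])
  fix x y assume xy: "x \<in> L2_ave_carrier T" "y \<in> L2_ave_carrier T"
  define K where "K = sqrt 2 * exp (2 * n + 2 * \<bar>c\<bar> * T) * (2 * \<bar>a\<bar>)"
  interpret finite_measure "lebesgue_on {0..T}" by (rule finite_measure_lebesgue_on_Icc)
  have le: "\<bar>exp (2 * (min (a * Re (x s)) n + c * s)) - exp (2 * (min (a * Re (y s)) n + c * s))\<bar> \<le> K * (cmod (x s - y s) * sqrt 1)"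
    if s: "s \<in> {0..T}" for s
  proof -
    have m: "2 * (min (a * Re (z s)) n + c * s) = min (2 * a * Re (z s)) (2 * n) + 2 * c * s" for z :: "real \<Rightarrow> complex"
      by (simp add: min_def)
    have "c * s \<le> \<bar>c\<bar> * T" using s by (intro mult_mono) auto
    then have cs: "2 * c * s \<le> 2 * \<bar>c\<bar> * T" by simp
    have "\<bar>exp (2 * (min (a * Re (x s)) n + c * s)) - exp (2 * (min (a * Re (y s)) n + c * s))\<bar>
      \<le> sqrt 2 * exp (2 * n + 2 * c * s) * \<bar>2 * a * Re (x s) - 2 * a * Re (y s)\<bar>"
      unfolding m by (rule exp_min_lipschitz)
    also have "\<dots> \<le> sqrt 2 * exp (2 * n + 2 * \<bar>c\<bar> * T) * (2 * \<bar>a\<bar> * cmod (x s - y s))"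
    proof (intro mult_mono mult_left_mono)
      have "\<bar>2 * a * Re (x s) - 2 * a * Re (y s)\<bar> = 2 * \<bar>a\<bar> * \<bar>Re (x s - y s)\<bar>" by (simp add: abs_mult flip: right_diff_distrib)
      also have "\<dots> \<le> 2 * \<bar>a\<bar> * cmod (x s - y s)" by (intro mult_left_mono abs_Re_le_cmod) auto
      finally show "\<bar>2 * a * Re (x s) - 2 * a * Re (y s)\<bar> \<le> 2 * \<bar>a\<bar> * cmod (x s - y s)" .
    qed (use cs in auto)
    finally show ?thesis by (simp add: K_def mult_ac)
  qed
  have "\<bar>V_trunc T a c n x - V_trunc T a c n y\<bar> \<le> K * (ave_norm T (\<lambda>s. x s - y s) * sqrt (1 / T * (\<integral>s. 1 \<partial>lebesgue_on {0..T})))"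
    unfolding V_trunc_def using xy
    by (intro ave_diff_weighted_le T integrable_exp_trunc le) (auto simp: K_def)
  also have "1 / T * (\<integral>s. 1 \<partial>lebesgue_on {0..T}) = 1" using T by (simp add: measure_lebesgue_on_Icc)
  finally show "\<bar>V_trunc T a c n x - V_trunc T a c n y\<bar> \<le> K * ave_norm T (\<lambda>s. x s - y s)" by simp
qed

section \<open>Expectations under a coupling and the transport inequality\<close>

lemma nn_integral_coupling_marginals:
  assumes \<gamma>: "\<gamma> \<in> couplings (distr M S x) (distr N S' y)"
    and [measurable]: "x \<in> M \<rightarrow>\<^sub>M S" "y \<in> N \<rightarrow>\<^sub>M S'" "h \<in> borel_measurable S" "h' \<in> borel_measurable S'"
  shows "(\<integral>\<^sup>+p. h (fst p) \<partial>\<gamma>) = (\<integral>\<^sup>+\<omega>. h (x \<omega>) \<partial>M)" "(\<integral>\<^sup>+p. h' (snd p) \<partial>\<gamma>) = (\<integral>\<^sup>+\<omega>. h' (y \<omega>) \<partial>N)"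
proof -
  have s [measurable_cong]: "sets \<gamma> = sets (S \<Otimes>\<^sub>M S')" and d: "distr \<gamma> (distr M S x) fst = distr M S x" "distr \<gamma> (distr N S' y) snd = distr N S' y"
    using \<gamma> by (auto simp: couplings_def cong: sets_pair_measure_cong)
  have "(\<integral>\<^sup>+\<omega>. h (x \<omega>) \<partial>M) = (\<integral>\<^sup>+z. h z \<partial>distr \<gamma> (distr M S x) fst)"
    unfolding d by (simp add: nn_integral_distr)
  also have "\<dots> = (\<integral>\<^sup>+p. h (fst p) \<partial>\<gamma>)" by (simp add: nn_integral_distr)
  finally show "(\<integral>\<^sup>+p. h (fst p) \<partial>\<gamma>) = (\<integral>\<^sup>+\<omega>. h (x \<omega>) \<partial>M)" by simp
  have "(\<integral>\<^sup>+\<omega>. h' (y \<omega>) \<partial>N) = (\<integral>\<^sup>+z. h' z \<partial>distr \<gamma> (distr N S' y) snd)"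
    unfolding d by (simp add: nn_integral_distr)
  also have "\<dots> = (\<integral>\<^sup>+p. h' (snd p) \<partial>\<gamma>)" by (simp add: nn_integral_distr)
  finally show "(\<integral>\<^sup>+p. h' (snd p) \<partial>\<gamma>) = (\<integral>\<^sup>+\<omega>. h' (y \<omega>) \<partial>N)" by simp
qed

lemma integral_coupling_marginals:
  fixes h :: "_ \<Rightarrow> real" and h' :: "_ \<Rightarrow> real"
  assumes \<gamma>: "\<gamma> \<in> couplings (distr M S x) (distr N S' y)"
    and [measurable]: "x \<in> M \<rightarrow>\<^sub>M S" "y \<in> N \<rightarrow>\<^sub>M S'" "h \<in> borel_measurable S" "h' \<in> borel_measurable S'"
    and i: "integrable M (\<lambda>\<omega>. h (x \<omega>))" "integrable N (\<lambda>\<omega>. h' (y \<omega>))"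
  shows "integrable \<gamma> (\<lambda>p. h (fst p) - h' (snd p))"
    "(\<integral>p. h (fst p) - h' (snd p) \<partial>\<gamma>) = (\<integral>\<omega>. h (x \<omega>) \<partial>M) - (\<integral>\<omega>. h' (y \<omega>) \<partial>N)"
proof -
  have s [measurable_cong]: "sets \<gamma> = sets (S \<Otimes>\<^sub>M S')" and d: "distr \<gamma> (distr M S x) fst = distr M S x" "distr \<gamma> (distr N S' y) snd = distr N S' y"
    using \<gamma> by (auto simp: couplings_def cong: sets_pair_measure_cong)
  have "integrable (distr \<gamma> (distr M S x) fst) h" "integrable (distr \<gamma> (distr N S' y) snd) h'"
    unfolding d using i by (simp_all add: integrable_distr_eq)
  then have i': "integrable \<gamma> (\<lambda>p. h (fst p))" "integrable \<gamma> (\<lambda>p. h' (snd p))"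
    by (simp_all add: integrable_distr_eq)
  then show "integrable \<gamma> (\<lambda>p. h (fst p) - h' (snd p))" by simp
  have "(\<integral>\<omega>. h (x \<omega>) \<partial>M) = (\<integral>z. h z \<partial>distr \<gamma> (distr M S x) fst)"
    unfolding d by (simp add: integral_distr)
  also have "\<dots> = (\<integral>p. h (fst p) \<partial>\<gamma>)" by (simp add: integral_distr)
  finally have 1: "(\<integral>\<omega>. h (x \<omega>) \<partial>M) = (\<integral>p. h (fst p) \<partial>\<gamma>)" .
  have "(\<integral>\<omega>. h' (y \<omega>) \<partial>N) = (\<integral>z. h' z \<partial>distr \<gamma> (distr N S' y) snd)"
    unfolding d by (simp add: integral_distr)
  also have "\<dots> = (\<integral>p. h' (snd p) \<partial>\<gamma>)" by (simp add: integral_distr)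
  finally show "(\<integral>p. h (fst p) - h' (snd p) \<partial>\<gamma>) = (\<integral>\<omega>. h (x \<omega>) \<partial>M) - (\<integral>\<omega>. h' (y \<omega>) \<partial>N)"
    using i' 1 by simp
qed

lemma W_fun_square:
  assumes "0 < T"
  shows "(W_fun T a c x)\<^sup>2 = 1 / T * (\<integral>s. exp (2 * a * x s + 2 * c * s) \<partial>lebesgue_on {0..T})"
  using assms by (simp add: W_fun_def)

text \<open>A continuous path is bounded on \<open>[0, T]\<close>, so the truncated functional
  equals the original one from some \<open>n\<close> on. The other two bounds do not depend on
  \<open>n\<close>; the last one is the dominating function for passing to the limit under the
  expectation.\<close>

lemma trunc_path_limits:
  assumes T: "0 < T" and f: "\<kappa>f-lipschitz_on UNIV f" and g: "\<kappa>g-lipschitz_on UNIV g"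
    and x: "continuous_on {0..T} x"
  shows "(\<lambda>n. F_trunc T f g a c (real n) (\<lambda>s. complex_of_real (x s))) \<longlonglongrightarrow> F_fun T f g a c x"
    "V_trunc T a c n (\<lambda>s. complex_of_real (x s)) \<le> (W_fun T a c x)\<^sup>2"
    "\<bar>F_trunc T f g a c n (\<lambda>s. complex_of_real (x s))\<bar> \<le> \<bar>g 0\<bar> + \<kappa>g * (\<bar>f 0\<bar> + \<kappa>f * (1 + (W_fun T a c x)\<^sup>2))"
proof -
  let ?L = "lebesgue_on {0..T}"
  interpret finite_measure ?L by (rule finite_measure_lebesgue_on_Icc)
  note f0 = lipschitz_on_UNIV_real[OF f]
  note g0 = lipschitz_on_UNIV_real[OF g]
  note c = continuous_in_L2_ave_carrier[OF x]
  note [measurable] = continuous_imp_measurable_on_sets_lebesgue[OF x, simplified]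
  obtain K where K: "\<And>s. s \<in> {0..T} \<Longrightarrow> norm (a * x s) \<le> K"
    using compact_imp_bounded[OF compact_continuous_image[OF continuous_on_mult_left[OF x, of a] compact_Icc]]
    unfolding bounded_iff by blast
  obtain n0 :: nat where n0: "K \<le> real n0" using real_arch_simple by blast
  have "F_trunc T f g a c (real n) (\<lambda>s. complex_of_real (x s)) = F_fun T f g a c x" if "n \<ge> n0" for n
  proof -
    have "(\<integral>s. f (exp (min (a * x s) (real n) + c * s)) \<partial>?L) = (\<integral>s. f (exp (a * x s + c * s)) \<partial>?L)"
    proof (intro Bochner_Integration.integral_cong refl)
      fix s assume "s \<in> space ?L"
      then have "norm (a * x s) \<le> K" by (intro K) simp
      then have "a * x s \<le> real n" using n0 that by (simp add: abs_le_iff)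
      then show "f (exp (min (a * x s) (real n) + c * s)) = f (exp (a * x s + c * s))" by simp
    qed
    then show ?thesis by (simp add: F_trunc_def F_fun_def)
  qed
  then show "(\<lambda>n. F_trunc T f g a c (real n) (\<lambda>s. complex_of_real (x s))) \<longlonglongrightarrow> F_fun T f g a c x"
    by (intro tendsto_eventually) (auto simp: eventually_sequentially)
  have iW: "integrable ?L (\<lambda>s. exp (2 * a * x s + 2 * c * s))"
  proof (rule integrable_lebesgue_on_bounded)
    have [measurable]: "(\<lambda>s. 2 * c * s) \<in> borel_measurable ?L" by (rule borel_measurable_lebesgue_on) simp
    show "(\<lambda>s. exp (2 * a * x s + 2 * c * s)) \<in> borel_measurable ?L" by measurable
    fix s assume s: "s \<in> {0..T}"
    have "c * s \<le> \<bar>c\<bar> * T" using s by (intro mult_mono) auto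
    then show "norm (exp (2 * a * x s + 2 * c * s)) \<le> exp (2 * K + 2 * (\<bar>c\<bar> * T))"
      using K[OF s] by (simp add: abs_le_iff)
  qed
  have "(\<integral>s. exp (2 * (min (a * Re (complex_of_real (x s))) n + c * s)) \<partial>?L) \<le> (\<integral>s. exp (2 * a * x s + 2 * c * s) \<partial>?L)"
    by (intro integral_mono integrable_exp_trunc c iW) auto
  then show V: "V_trunc T a c n (\<lambda>s. complex_of_real (x s)) \<le> (W_fun T a c x)\<^sup>2"
    unfolding W_fun_square[OF T] V_trunc_def using T by (intro mult_left_mono) auto
  let ?e = "\<lambda>s. min (a * Re (complex_of_real (x s))) n + c * s"
  have "\<bar>\<integral>s. f (exp (?e s)) \<partial>?L\<bar> \<le> (\<integral>s. \<bar>f (exp (?e s))\<bar> \<partial>?L)" by (rule integral_abs_bound)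
  also have "\<dots> \<le> (\<integral>s. \<bar>f 0\<bar> + \<kappa>f * (1 + exp (2 * ?e s)) \<partial>?L)"
  proof (intro integral_mono integrable_abs integrable_f_exp_trunc[OF c f] Bochner_Integration.integrable_add integrable_mult_right integrable_exp_trunc[OF c] )
    fix s
    have "\<bar>f (exp (?e s))\<bar> \<le> \<bar>f 0\<bar> + \<kappa>f * exp (?e s)" using f0(2)[of "exp (?e s)" 0] by simp
    \<comment> \<open>With y the positive number \<open>exp (?e s)\<close>, this is 2 y \<le> 1 +
      y^2.\<close>
    also have "exp (?e s) \<le> 1 + exp (2 * ?e s)"
      using sum_squares_bound[of 1 "exp (?e s)"] exp_gt_zero[of "?e s"] unfolding exp_double power_one mult_1_right by linarith
    finally show "\<bar>f (exp (?e s))\<bar> \<le> \<bar>f 0\<bar> + \<kappa>f * (1 + exp (2 * ?e s))" using f0(1) by (simp add: mult_left_mono)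
  qed auto
  also have "\<dots> = T * \<bar>f 0\<bar> + \<kappa>f * (T + (\<integral>s. exp (2 * ?e s) \<partial>?L))"
    using T by (simp add: measure_lebesgue_on_Icc integrable_exp_trunc[OF c, simplified] distrib_left)
  also have "\<dots> = T * (\<bar>f 0\<bar> + \<kappa>f * (1 + V_trunc T a c n (\<lambda>s. complex_of_real (x s))))"
    using T by (simp add: V_trunc_def field_simps)
  finally have "\<bar>1 / T * (\<integral>s. f (exp (?e s)) \<partial>?L)\<bar> \<le> \<bar>f 0\<bar> + \<kappa>f * (1 + V_trunc T a c n (\<lambda>s. complex_of_real (x s)))"
    using T by (simp add: abs_mult field_simps)
  also have "\<dots> \<le> \<bar>f 0\<bar> + \<kappa>f * (1 + (W_fun T a c x)\<^sup>2)" using f0(1) V by (intro add_left_mono mult_left_mono) auto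
  finally have b: "\<bar>1 / T * (\<integral>s. f (exp (?e s)) \<partial>?L)\<bar> \<le> \<bar>f 0\<bar> + \<kappa>f * (1 + (W_fun T a c x)\<^sup>2)" .
  have "\<bar>F_trunc T f g a c n (\<lambda>s. complex_of_real (x s))\<bar> \<le> \<bar>g 0\<bar> + \<kappa>g * \<bar>1 / T * (\<integral>s. f (exp (?e s)) \<partial>?L)\<bar>"
    using g0(2)[of "1 / T * (\<integral>s. f (exp (?e s)) \<partial>?L)" 0] by (simp add: F_trunc_def)
  also have "\<dots> \<le> \<bar>g 0\<bar> + \<kappa>g * (\<bar>f 0\<bar> + \<kappa>f * (1 + (W_fun T a c x)\<^sup>2))"
    using b g0(1) by (intro add_left_mono mult_left_mono)
  finally show "\<bar>F_trunc T f g a c n (\<lambda>s. complex_of_real (x s))\<bar> \<le> \<bar>g 0\<bar> + \<kappa>g * (\<bar>f 0\<bar> + \<kappa>f * (1 + (W_fun T a c x)\<^sup>2))" .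
qed

text \<open>Measurability of \<open>F_fun\<close> along the random path is itself obtained from the
  limit of the truncated functionals; dominated convergence then gives integrability and the limit
  of the means.\<close>

lemma F_fun_integrable_limit:
  assumes T: "0 < T" and f: "\<kappa>f-lipschitz_on UNIV f" and g: "\<kappa>g-lipschitz_on UNIV g"
    and M: "prob_space M"
    and X: "(\<lambda>\<omega> s. complex_of_real (X s \<omega>)) \<in> M \<rightarrow>\<^sub>M L2_ave T"
    and cont: "\<forall>\<omega>\<in>space M. continuous_on {0..T} (\<lambda>t. X t \<omega>)"
    and iW: "integrable M (\<lambda>\<omega>. (W_fun T a c (\<lambda>s. X s \<omega>))\<^sup>2)"
  shows "integrable M (\<lambda>\<omega>. F_fun T f g a c (\<lambda>s. X s \<omega>))"
    "integrable M (\<lambda>\<omega>. F_trunc T f g a c n (\<lambda>s. complex_of_real (X s \<omega>)))"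
    "(\<lambda>n. \<integral>\<omega>. F_trunc T f g a c (real n) (\<lambda>s. complex_of_real (X s \<omega>)) \<partial>M) \<longlonglongrightarrow> (\<integral>\<omega>. F_fun T f g a c (\<lambda>s. X s \<omega>) \<partial>M)"
proof -
  interpret prob_space M by fact
  let ?F = "\<lambda>n \<omega>. F_trunc T f g a c n (\<lambda>s. complex_of_real (X s \<omega>))"
  let ?b = "\<lambda>\<omega>. \<bar>g 0\<bar> + \<kappa>g * (\<bar>f 0\<bar> + \<kappa>f * (1 + (W_fun T a c (\<lambda>s. X s \<omega>))\<^sup>2))"
  note lim = trunc_path_limits[OF T f g bspec[OF cont]]
  have m: "?F n \<in> borel_measurable M" for n
    by (rule measurable_compose[OF X borel_measurable_F_trunc[OF T f g]])
  have ib: "integrable M ?b" using iW by simp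
  have l: "AE \<omega> in M. (\<lambda>n. ?F (real n) \<omega>) \<longlonglongrightarrow> F_fun T f g a c (\<lambda>s. X s \<omega>)"
    by (intro AE_I2 lim(1))
  have b: "AE \<omega> in M. norm (?F n \<omega>) \<le> ?b \<omega>" for n
    using lim(3) by (intro AE_I2) simp
  have mF: "(\<lambda>\<omega>. F_fun T f g a c (\<lambda>s. X s \<omega>)) \<in> borel_measurable M"
    by (rule borel_measurable_LIMSEQ_real[OF lim(1) m])
  show "integrable M (?F n)"
    using b[of n] m by (intro Bochner_Integration.integrable_bound[OF ib]) (auto elim!: eventually_mono)
  show "integrable M (\<lambda>\<omega>. F_fun T f g a c (\<lambda>s. X s \<omega>))"
    by (rule integrable_dominated_convergence[OF mF m ib l b])
  show "(\<lambda>n. \<integral>\<omega>. ?F (real n) \<omega> \<partial>M) \<longlonglongrightarrow> (\<integral>\<omega>. F_fun T f g a c (\<lambda>s. X s \<omega>) \<partial>M)"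
    by (rule integral_dominated_convergence[OF mF m ib l b])
qed

text \<open>
  The distance of two paths need not be measurable for the product \<open>\<sigma>\<close>-algebra on which
  couplings live, so the inequalities for its integral are stated without measurability of the
  integrand.
\<close>

lemma nn_integral_cmult_le:
  "(\<integral>\<^sup>+x. ennreal c * f x \<partial>M) \<le> ennreal c * (\<integral>\<^sup>+x. f x \<partial>M)"
proof (cases "0 < c")
  case False
  then show ?thesis by (simp add: ennreal_neg)
next
  case True
  have inv: "ennreal (1 / c) * ennreal c = 1" using True by (simp flip: ennreal_mult)
  show ?thesis
    unfolding nn_integral_def[of M "\<lambda>x. ennreal c * f x"]
  proof (rule SUP_least, clarsimp)
    fix u assume u: "simple_function M u" "u \<le> (\<lambda>x. ennreal c * f x)"
    have [measurable]: "u \<in> borel_measurable M" using u(1) by (rule borel_measurable_simple_function)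
    have "integral\<^sup>S M u = (\<integral>\<^sup>+x. ennreal c * (ennreal (1 / c) * u x) \<partial>M)"
      using u inv by (simp add: nn_integral_eq_simple_integral flip: mult.assoc) (simp add: mult.commute)
    also have "\<dots> = ennreal c * (\<integral>\<^sup>+x. ennreal (1 / c) * u x \<partial>M)" by (rule nn_integral_cmult) measurable
    also have "\<dots> \<le> ennreal c * (\<integral>\<^sup>+x. f x \<partial>M)"
    proof (intro mult_left_mono nn_integral_mono)
      fix x
      have "ennreal (1 / c) * u x \<le> ennreal (1 / c) * (ennreal c * f x)"
        using u(2) by (intro mult_left_mono) (auto simp: le_fun_def)
      also have "\<dots> = f x" using inv by (simp flip: mult.assoc)
      finally show "ennreal (1 / c) * u x \<le> f x" .
    qed simp
    finally show "integral\<^sup>S M u \<le> ennreal c * (\<integral>\<^sup>+x. f x \<partial>M)" .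
  qed
qed

lemma F_fun_coupling_bound:
  assumes T: "0 < T" and f: "\<kappa>f-lipschitz_on UNIV f" and g: "\<kappa>g-lipschitz_on UNIV g"
    and M: "prob_space M"
    and X: "(\<lambda>\<omega> s. complex_of_real (X s \<omega>)) \<in> M \<rightarrow>\<^sub>M L2_ave T"
    and cX: "\<forall>\<omega>\<in>space M. continuous_on {0..T} (\<lambda>t. X t \<omega>)"
    and iX: "integrable M (\<lambda>\<omega>. (W_fun T a c (\<lambda>s. X s \<omega>))\<^sup>2)"
    and N: "prob_space N"
    and Y: "(\<lambda>\<omega> s. complex_of_real (Y s \<omega>)) \<in> N \<rightarrow>\<^sub>M L2_ave T"
    and cY: "\<forall>\<omega>\<in>space N. continuous_on {0..T} (\<lambda>t. Y t \<omega>)"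
    and iY: "integrable N (\<lambda>\<omega>. (W_fun T a c (\<lambda>s. Y s \<omega>))\<^sup>2)"
    and \<gamma>: "\<gamma> \<in> couplings (path_law T M X) (path_law T N Y)"
    and I: "(\<integral>\<^sup>+ p. ennreal ((ave_norm T (\<lambda>s. fst p s - snd p s))\<^sup>2) \<partial>\<gamma>) \<le> ennreal I" "0 \<le> I"
  shows "\<bar>(\<integral>\<omega>. F_fun T f g a c (\<lambda>s. X s \<omega>) \<partial>M) - (\<integral>\<omega>. F_fun T f g a c (\<lambda>s. Y s \<omega>) \<partial>N)\<bar>
    \<le> \<bar>a\<bar> * \<kappa>f * \<kappa>g * sqrt I * (sqrt (\<integral>\<omega>. (W_fun T a c (\<lambda>s. X s \<omega>))\<^sup>2 \<partial>M) + sqrt (\<integral>\<omega>. (W_fun T a c (\<lambda>s. Y s \<omega>))\<^sup>2 \<partial>N))"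
proof -
  define K where "K = \<bar>a\<bar> * \<kappa>f * \<kappa>g"
  define A where "A = (\<integral>\<omega>. (W_fun T a c (\<lambda>s. X s \<omega>))\<^sup>2 \<partial>M)"
  define B where "B = (\<integral>\<omega>. (W_fun T a c (\<lambda>s. Y s \<omega>))\<^sup>2 \<partial>N)"
  let ?x = "\<lambda>\<omega> s. complex_of_real (X s \<omega>)" and ?y = "\<lambda>\<omega> s. complex_of_real (Y s \<omega>)"
  have K0: "0 \<le> K" using lipschitz_on_UNIV_real(1)[OF f] lipschitz_on_UNIV_real(1)[OF g] by (simp add: K_def)
  have A0: "0 \<le> A" "0 \<le> B" by (auto simp: A_def B_def)
  note \<gamma>' = \<gamma>[unfolded path_law_def]
  have s [measurable_cong]: "sets \<gamma> = sets (L2_ave T \<Otimes>\<^sub>M L2_ave T)"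
    using \<gamma>' by (auto simp: couplings_def cong: sets_pair_measure_cong)
  have sp: "fst p \<in> L2_ave_carrier T" "snd p \<in> L2_ave_carrier T" if "p \<in> space \<gamma>" for p
    using that unfolding sets_eq_imp_space_eq[OF s] by (auto simp: space_pair_measure space_L2_ave)
  note limX = F_fun_integrable_limit[OF T f g M X cX iX]
  note limY = F_fun_integrable_limit[OF T f g N Y cY iY]
  have n: "\<bar>(\<integral>\<omega>. F_trunc T f g a c n (?x \<omega>) \<partial>M) - (\<integral>\<omega>. F_trunc T f g a c n (?y \<omega>) \<partial>N)\<bar> \<le> K * sqrt I * (sqrt A + sqrt B)" for n
  proof -
    let ?F = "F_trunc T f g a c n" and ?V = "V_trunc T a c n"
    note [measurable] = borel_measurable_F_trunc[OF T f g, of a c n] borel_measurable_V_trunc[OF T, of a c n]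
    let ?D = "\<lambda>p. \<bar>?F (fst p) - ?F (snd p)\<bar>" and ?S = "\<lambda>p. ?V (fst p) + ?V (snd p)"
    have S0: "0 < ?S p" if "p \<in> space \<gamma>" for p using V_trunc_pos[OF T] sp[OF that] by (simp add: add_pos_pos)
    note mF = borel_measurable_F_trunc[OF T f g, of a c n]
    note ic = integral_coupling_marginals[where h="?F" and h'="?F", OF \<gamma>' X Y mF mF limX(2)[of n] limY(2)[of n]]
    have "\<bar>(\<integral>\<omega>. ?F (?x \<omega>) \<partial>M) - (\<integral>\<omega>. ?F (?y \<omega>) \<partial>N)\<bar> = \<bar>\<integral>p. ?F (fst p) - ?F (snd p) \<partial>\<gamma>\<bar>"
      by (subst ic(2)) auto
    also have "\<dots> \<le> (\<integral>p. ?D p \<partial>\<gamma>)" by (rule integral_abs_bound)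
    finally have le: "\<bar>(\<integral>\<omega>. ?F (?x \<omega>) \<partial>M) - (\<integral>\<omega>. ?F (?y \<omega>) \<partial>N)\<bar> \<le> (\<integral>p. ?D p \<partial>\<gamma>)" .
    have iD: "integrable \<gamma> ?D" by (rule integrable_abs[OF ic(1)])
    have "(ennreal (\<integral>p. ?D p \<partial>\<gamma>))\<^sup>2 = (\<integral>\<^sup>+p. ennreal (?D p / sqrt (?S p)) * ennreal (sqrt (?S p)) \<partial>\<gamma>)\<^sup>2"
    proof (subst nn_integral_eq_integral[OF iD, symmetric])
      show "(\<integral>\<^sup>+p. ennreal (?D p) \<partial>\<gamma>)\<^sup>2 = (\<integral>\<^sup>+p. ennreal (?D p / sqrt (?S p)) * ennreal (sqrt (?S p)) \<partial>\<gamma>)\<^sup>2"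
        using S0 by (intro arg_cong[where f="\<lambda>z. z\<^sup>2"] nn_integral_cong) (simp add: less_imp_le less_imp_neq[THEN not_sym] flip: ennreal_mult)
    qed auto
    also have "\<dots> \<le> (\<integral>\<^sup>+p. (ennreal (?D p / sqrt (?S p)))\<^sup>2 \<partial>\<gamma>) * (\<integral>\<^sup>+p. (ennreal (sqrt (?S p)))\<^sup>2 \<partial>\<gamma>)"
      by (rule Cauchy_Schwarz_nn_integral) measurable
    also have "\<dots> \<le> ennreal (K\<^sup>2 * I) * ennreal (A + B)"
    proof (rule mult_mono)
      have "(\<integral>\<^sup>+p. (ennreal (?D p / sqrt (?S p)))\<^sup>2 \<partial>\<gamma>) \<le> (\<integral>\<^sup>+ p. ennreal (K\<^sup>2) * ennreal ((ave_norm T (\<lambda>s. fst p s - snd p s))\<^sup>2) \<partial>\<gamma>)"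
      proof (rule nn_integral_mono)
        fix p assume p: "p \<in> space \<gamma>"
        have "?D p \<le> K * ave_norm T (\<lambda>s. fst p s - snd p s) * sqrt (?S p)"
          unfolding K_def by (rule F_trunc_diff_le[OF T f g sp[OF p]])
        then have "?D p / sqrt (?S p) \<le> K * ave_norm T (\<lambda>s. fst p s - snd p s)"
          using S0[OF p] by (simp add: pos_divide_le_eq)
        then have "(?D p / sqrt (?S p))\<^sup>2 \<le> (K * ave_norm T (\<lambda>s. fst p s - snd p s))\<^sup>2"
          using S0[OF p] by (intro power_mono) (auto intro!: divide_nonneg_nonneg)
        then show "(ennreal (?D p / sqrt (?S p)))\<^sup>2 \<le> ennreal (K\<^sup>2) * ennreal ((ave_norm T (\<lambda>s. fst p s - snd p s))\<^sup>2)"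
          using S0[OF p] by (subst ennreal_power) (auto simp: power_mult_distrib simp flip: ennreal_mult intro!: ennreal_leI divide_nonneg_nonneg)
      qed
      also have "\<dots> \<le> ennreal (K\<^sup>2) * (\<integral>\<^sup>+ p. ennreal ((ave_norm T (\<lambda>s. fst p s - snd p s))\<^sup>2) \<partial>\<gamma>)"
        by (rule nn_integral_cmult_le)
      also have "\<dots> \<le> ennreal (K\<^sup>2) * ennreal I" by (intro mult_left_mono I) auto
      finally show "(\<integral>\<^sup>+p. (ennreal (?D p / sqrt (?S p)))\<^sup>2 \<partial>\<gamma>) \<le> ennreal (K\<^sup>2 * I)" by (simp add: ennreal_mult I)
      have "(\<integral>\<^sup>+p. (ennreal (sqrt (?S p)))\<^sup>2 \<partial>\<gamma>) = (\<integral>\<^sup>+p. ennreal (?V (fst p)) + ennreal (?V (snd p)) \<partial>\<gamma>)"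
        using V_trunc_pos[OF T] sp S0 by (intro nn_integral_cong) (auto simp: ennreal_power less_imp_le simp flip: ennreal_plus)
      also have "\<dots> = (\<integral>\<^sup>+p. ennreal (?V (fst p)) \<partial>\<gamma>) + (\<integral>\<^sup>+p. ennreal (?V (snd p)) \<partial>\<gamma>)"
        by (rule nn_integral_add) measurable
      also have "(\<integral>\<^sup>+p. ennreal (?V (fst p)) \<partial>\<gamma>) = (\<integral>\<^sup>+\<omega>. ennreal (?V (?x \<omega>)) \<partial>M)"
        by (rule nn_integral_coupling_marginals(1)[OF \<gamma>' X Y, where h="\<lambda>z. ennreal (?V z)"]) measurable
      also have "(\<integral>\<^sup>+p. ennreal (?V (snd p)) \<partial>\<gamma>) = (\<integral>\<^sup>+\<omega>. ennreal (?V (?y \<omega>)) \<partial>N)"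
        by (rule nn_integral_coupling_marginals(2)[OF \<gamma>' X Y, where h'="\<lambda>z. ennreal (?V z)"]) measurable
      also have "(\<integral>\<^sup>+\<omega>. ennreal (?V (?x \<omega>)) \<partial>M) \<le> (\<integral>\<^sup>+\<omega>. ennreal ((W_fun T a c (\<lambda>s. X s \<omega>))\<^sup>2) \<partial>M)"
        using trunc_path_limits(2)[OF T f g bspec[OF cX]] by (intro nn_integral_mono ennreal_leI)
      also have "\<dots> = ennreal A" unfolding A_def by (rule nn_integral_eq_integral[OF iX]) auto
      also have "(\<integral>\<^sup>+\<omega>. ennreal (?V (?y \<omega>)) \<partial>N) \<le> (\<integral>\<^sup>+\<omega>. ennreal ((W_fun T a c (\<lambda>s. Y s \<omega>))\<^sup>2) \<partial>N)"
        using trunc_path_limits(2)[OF T f g bspec[OF cY]] by (intro nn_integral_mono ennreal_leI)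
      also have "\<dots> = ennreal B" unfolding B_def by (rule nn_integral_eq_integral[OF iY]) auto
      finally show "(\<integral>\<^sup>+p. (ennreal (sqrt (?S p)))\<^sup>2 \<partial>\<gamma>) \<le> ennreal (A + B)" using A0 by (simp add: add_mono)
    qed auto
    also have "\<dots> = ennreal (K\<^sup>2 * I * (A + B))" using I A0 by (simp add: ennreal_mult)
    finally have "(\<integral>p. ?D p \<partial>\<gamma>)\<^sup>2 \<le> K\<^sup>2 * I * (A + B)"
      using I A0 by (simp add: ennreal_power ennreal_le_iff)
    then have "(\<integral>p. ?D p \<partial>\<gamma>) \<le> sqrt (K\<^sup>2 * I * (A + B))" by (rule real_le_rsqrt)
    also have "\<dots> = K * sqrt I * sqrt (A + B)" using K0 by (simp add: real_sqrt_mult)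
    also have "\<dots> \<le> K * sqrt I * (sqrt A + sqrt B)"
      using K0 I A0 by (intro mult_left_mono sqrt_add_le_add_sqrt) auto
    finally show ?thesis using le by simp
  qed
  have "(\<lambda>n. \<bar>(\<integral>\<omega>. F_trunc T f g a c (real n) (?x \<omega>) \<partial>M) - (\<integral>\<omega>. F_trunc T f g a c (real n) (?y \<omega>) \<partial>N)\<bar>) \<longlonglongrightarrow>
    \<bar>(\<integral>\<omega>. F_fun T f g a c (\<lambda>s. X s \<omega>) \<partial>M) - (\<integral>\<omega>. F_fun T f g a c (\<lambda>s. Y s \<omega>) \<partial>N)\<bar>"
    by (intro tendsto_intros limX limY)
  from LIMSEQ_le_const2[OF this] n show ?thesis
    unfolding K_def A_def B_def by blast
qed

text \<open>The infimum over couplings need not be attained. A coupling of cost below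
  \<open>w + e\<close> is used instead, and \<open>e\<close> tends to 0 at the end.\<close>

lemma F_fun_wasserstein_bound:
  assumes T: "0 < T" and f: "\<kappa>f-lipschitz_on UNIV f" and g: "\<kappa>g-lipschitz_on UNIV g"
    and M: "prob_space M"
    and X: "(\<lambda>\<omega> s. complex_of_real (X s \<omega>)) \<in> M \<rightarrow>\<^sub>M L2_ave T"
    and cX: "\<forall>\<omega>\<in>space M. continuous_on {0..T} (\<lambda>t. X t \<omega>)"
    and iX: "integrable M (\<lambda>\<omega>. (W_fun T a c (\<lambda>s. X s \<omega>))\<^sup>2)"
    and N: "prob_space N"
    and Y: "(\<lambda>\<omega> s. complex_of_real (Y s \<omega>)) \<in> N \<rightarrow>\<^sub>M L2_ave T"
    and cY: "\<forall>\<omega>\<in>space N. continuous_on {0..T} (\<lambda>t. Y t \<omega>)"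
    and iY: "integrable N (\<lambda>\<omega>. (W_fun T a c (\<lambda>s. Y s \<omega>))\<^sup>2)"
    and fin: "wasserstein2 T (path_law T M X) (path_law T N Y) < top"
  shows "ennreal \<bar>(\<integral>\<omega>. F_fun T f g a c (\<lambda>s. X s \<omega>) \<partial>M) - (\<integral>\<omega>. F_fun T f g a c (\<lambda>s. Y s \<omega>) \<partial>N)\<bar>
    \<le> ennreal (sqrt 2 * \<bar>a\<bar> * \<kappa>f * \<kappa>g) * wasserstein2 T (path_law T M X) (path_law T N Y)
      * ennreal (sqrt (\<integral>\<omega>. (W_fun T a c (\<lambda>s. X s \<omega>))\<^sup>2 \<partial>M) + sqrt (\<integral>\<omega>. (W_fun T a c (\<lambda>s. Y s \<omega>))\<^sup>2 \<partial>N))"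
proof -
  define K where "K = \<bar>a\<bar> * \<kappa>f * \<kappa>g"
  define S where "S = (sqrt (\<integral>\<omega>. (W_fun T a c (\<lambda>s. X s \<omega>))\<^sup>2 \<partial>M) + sqrt (\<integral>\<omega>. (W_fun T a c (\<lambda>s. Y s \<omega>))\<^sup>2 \<partial>N))"
  define D where "D = \<bar>(\<integral>\<omega>. F_fun T f g a c (\<lambda>s. X s \<omega>) \<partial>M) - (\<integral>\<omega>. F_fun T f g a c (\<lambda>s. Y s \<omega>) \<partial>N)\<bar>"
  have K0: "0 \<le> K" using lipschitz_on_UNIV_real(1)[OF f] lipschitz_on_UNIV_real(1)[OF g] by (simp add: K_def)
  have S0: "0 \<le> S" by (auto simp: S_def)
  obtain w where w: "wasserstein2 T (path_law T M X) (path_law T N Y) = ennreal w" "0 \<le> w"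
    using fin by (cases "wasserstein2 T (path_law T M X) (path_law T N Y)") auto
  have "D \<le> K * (w + e) * S" if e: "0 < e" for e
  proof -
    have "wasserstein2 T (path_law T M X) (path_law T N Y) < ennreal (w + e)"
      using w e by (simp add: ennreal_less_iff)
    then obtain \<gamma> where \<gamma>: "\<gamma> \<in> couplings (path_law T M X) (path_law T N Y)"
      "ennreal_sqrt (\<integral>\<^sup>+ p. ennreal ((ave_norm T (\<lambda>s. fst p s - snd p s))\<^sup>2) \<partial>\<gamma>) < ennreal (w + e)"
      unfolding wasserstein2_def INF_less_iff by blast
    define I where "I = enn2real (\<integral>\<^sup>+ p. ennreal ((ave_norm T (\<lambda>s. fst p s - snd p s))\<^sup>2) \<partial>\<gamma>)"
    have nt: "(\<integral>\<^sup>+ p. ennreal ((ave_norm T (\<lambda>s. fst p s - snd p s))\<^sup>2) \<partial>\<gamma>) \<noteq> top"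
      using \<gamma>(2) by (auto simp: ennreal_sqrt_def split: if_splits)
    then have "ennreal (sqrt I) < ennreal (w + e)" using \<gamma>(2) by (simp add: ennreal_sqrt_def I_def)
    then have I: "sqrt I \<le> w + e" using w e ennreal_less_iff[of "sqrt I" "w + e"] by (auto simp: I_def simp del: ennreal_plus)
    have "D \<le> K * sqrt I * S" unfolding D_def K_def S_def
      by (rule F_fun_coupling_bound[OF T f g M X cX iX N Y cY iY \<gamma>(1)]) (use nt in \<open>auto simp: I_def less_top[symmetric]\<close>)
    also have "\<dots> \<le> K * (w + e) * S" using I K0 S0 by (intro mult_right_mono mult_left_mono)
    finally show ?thesis .
  qed
  then have "D \<le> K * w * S + e" if "0 < e" for e
  proof -
    have KS: "0 \<le> K * S" using K0 S0 by simp
    \<comment> \<open>The perturbation is scaled by \<open>K * S + 1\<close>, which is positive even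
      when \<open>K * S\<close> vanishes, so that the error after multiplication by
      \<open>K * S\<close> is at most \<open>e\<close>.\<close>
    have "D \<le> K * (w + e / (K * S + 1)) * S" using that K0 S0 by (intro \<open>\<And>e. 0 < e \<Longrightarrow> D \<le> K * (w + e) * S\<close>) (simp add: add_nonneg_pos)
    also have "\<dots> = K * w * S + e * (K * S / (K * S + 1))" using KS by (simp add: field_simps add_eq_0_iff_both_eq_0)
    also have "\<dots> \<le> K * w * S + e * 1" using that KS by (intro add_left_mono mult_left_mono) (auto simp: divide_le_eq)
    finally show ?thesis by simp
  qed
  then have "D \<le> K * w * S" by (rule field_le_epsilon)
  \<comment> \<open>The argument gives constant 1, since the weight in \<open>exp_diff_le\<close> is
    the square root of a sum and never twice a maximum. The stated factor \<open>sqrt 2\<close> is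
    reached by enlarging.\<close>
  also have "\<dots> \<le> sqrt 2 * (K * w * S)" using mult_right_mono[of 1 "sqrt 2" "K * w * S"] K0 S0 w by simp
  finally have "ennreal D \<le> ennreal (sqrt 2 * K * w * S)" by (intro ennreal_leI) (simp add: mult_ac)
  also have "\<dots> = ennreal (sqrt 2 * K) * ennreal w * ennreal S"
    using K0 S0 w by (simp add: ennreal_mult)
  also have "sqrt 2 * K = sqrt 2 * \<bar>a\<bar> * \<kappa>f * \<kappa>g" by (simp add: K_def)
  finally show ?thesis unfolding D_def w(1) S_def .
qed

section \<open>The telegraph path as a function of its holding times\<close>

definition switch_time :: "(nat \<Rightarrow> real) \<Rightarrow> nat \<Rightarrow> real" where
  "switch_time \<tau> n = (\<Sum>i<n. \<tau> i)"

text \<open>The length of the part of the \<open>i\<close>-th holding interval that lies before time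
  \<open>t\<close>.\<close>

definition elapsed :: "(nat \<Rightarrow> real) \<Rightarrow> real \<Rightarrow> nat \<Rightarrow> real" where
  "elapsed \<tau> t i = max 0 (min (\<tau> i) (t - switch_time \<tau> i))"

text \<open>Divergence of the switching times is tested against natural numbers only, so that the
  set is built from countably many measurable conditions.\<close>

definition admissible :: "(nat \<Rightarrow> real) \<Rightarrow> bool" where
  "admissible \<tau> \<longleftrightarrow> (\<forall>n. 0 < \<tau> n) \<and> (\<forall>k::nat. \<exists>n. real k < switch_time \<tau> n)"

text \<open>Position at time \<open>t\<close> of the path that starts at 0 with velocity 1 and
  alternates between the velocities 1 and -1. The value 0 for exceptional sequences makes every path
  continuous, not merely almost every one.\<close>

definition tele :: "(nat \<Rightarrow> real) \<Rightarrow> real \<Rightarrow> real" where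
  "tele \<tau> t = (if admissible \<tau> then \<Sum>i. (-1) ^ i * elapsed \<tau> t i else 0)"

lemma switch_time_0 [simp]: "switch_time \<tau> 0 = 0"
  and switch_time_Suc: "switch_time \<tau> (Suc n) = switch_time \<tau> n + \<tau> n"
  by (simp_all add: switch_time_def)

lemma switch_time_mono: "(\<And>n. 0 < \<tau> n) \<Longrightarrow> m \<le> n \<Longrightarrow> switch_time \<tau> m \<le> switch_time \<tau> n"
  unfolding switch_time_def by (intro sum_mono2) (auto simp: less_imp_le)

lemma switch_time_nonneg: "(\<And>n. 0 < \<tau> n) \<Longrightarrow> 0 \<le> switch_time \<tau> n"
  using switch_time_mono[of \<tau> 0 n] by simp

lemma switch_time_case_nat: "switch_time (case_nat s \<tau>) (Suc n) = s + switch_time \<tau> n"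
  unfolding switch_time_def by (subst sum.lessThan_Suc_shift) simp

lemma elapsed_nonneg: "0 \<le> elapsed \<tau> t i"
  by (simp add: elapsed_def)

lemma elapsed_case_nat: "elapsed (case_nat s \<tau>) t 0 = max 0 (min s t)"
  "elapsed (case_nat s \<tau>) t (Suc i) = elapsed \<tau> (t - s) i"
  by (simp_all add: elapsed_def switch_time_case_nat algebra_simps)

lemma elapsed_eq_0: "(\<And>n. 0 < \<tau> n) \<Longrightarrow> t \<le> switch_time \<tau> n \<Longrightarrow> n \<le> i \<Longrightarrow> elapsed \<tau> t i = 0"
  using switch_time_mono[of \<tau> n i] by (force simp: elapsed_def)

lemma sum_elapsed: "(\<And>n. 0 < \<tau> n) \<Longrightarrow> 0 \<le> t \<Longrightarrow> (\<Sum>i<n. elapsed \<tau> t i) = min t (switch_time \<tau> n)"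
proof (induction n)
  case (Suc n)
  have "0 < \<tau> n" by (rule Suc)
  moreover have "(\<Sum>i<n. elapsed \<tau> t i) = min t (switch_time \<tau> n)" using Suc.IH Suc.prems by blast
  moreover have "0 \<le> switch_time \<tau> n" using Suc.prems by (intro switch_time_nonneg) auto
  ultimately show ?case by (simp add: switch_time_Suc elapsed_def[of \<tau> t n])
qed simp

lemma admissible_pos: "admissible \<tau> \<Longrightarrow> 0 < \<tau> n"
  by (simp add: admissible_def)

lemma admissible_exceeds: "admissible \<tau> \<Longrightarrow> \<exists>n. t < switch_time \<tau> n"
proof -
  assume a: "admissible \<tau>"
  obtain k :: nat where "t \<le> real k" using real_arch_simple by blast
  with a show ?thesis by (meson admissible_def le_less_trans)
qed

lemma tele_eq_sum:
  assumes a: "admissible \<tau>" and t: "t \<le> switch_time \<tau> n"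
  shows "tele \<tau> t = (\<Sum>i<n. (-1) ^ i * elapsed \<tau> t i)"
proof -
  have "(\<Sum>i. (-1) ^ i * elapsed \<tau> t i) = (\<Sum>i<n. (-1) ^ i * elapsed \<tau> t i)"
    using elapsed_eq_0[OF admissible_pos[OF a] t] by (intro suminf_finite) auto
  with a show ?thesis by (simp add: tele_def)
qed

lemma continuous_on_tele: "continuous_on {0..T} (tele \<tau>)"
proof (cases "admissible \<tau>")
  case True
  then obtain n where n: "T < switch_time \<tau> n" using admissible_exceeds by blast
  have "continuous_on {0..T} (\<lambda>t. \<Sum>i<n. (-1) ^ i * elapsed \<tau> t i)"
    unfolding elapsed_def by (intro continuous_intros)
  then show ?thesis
    using n by (subst continuous_on_cong[OF refl tele_eq_sum[OF True, of _ n]]) auto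
next
  case False
  then show ?thesis by (simp add: tele_def[abs_def])
qed

abbreviation seq_borel :: "(nat \<Rightarrow> real) measure" where
  "seq_borel \<equiv> PiM UNIV (\<lambda>_. borel)"

lemma measurable_switch_time [measurable]: "(\<lambda>\<tau>. switch_time \<tau> n) \<in> borel_measurable seq_borel"
  unfolding switch_time_def by measurable

lemma measurable_tele: "(\<lambda>p. tele (snd p) (fst p)) \<in> borel_measurable (borel \<Otimes>\<^sub>M seq_borel)"
  unfolding tele_def admissible_def elapsed_def by measurable

lemma measurable_tele' [measurable (raw)]:
  assumes "f \<in> borel_measurable M" "g \<in> M \<rightarrow>\<^sub>M seq_borel"
  shows "(\<lambda>x. tele (g x) (f x)) \<in> borel_measurable M"
  using measurable_compose[OF measurable_Pair[OF assms] measurable_tele] by simp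

text \<open>The two velocities \<open>u\<close> and \<open>2 * c - u\<close> are symmetric about
  \<open>c\<close>. The position is thus a deterministic drift \<open>c * t\<close> plus the
  unit-speed path scaled by \<open>u - c\<close>; this separates the asymmetry of the process from
  its randomness.\<close>

lemma integral_alternating_velocity:
  fixes V :: "real \<Rightarrow> real"
  assumes a: "admissible \<tau>" and t: "0 \<le> t"
    and V: "\<And>n s. switch_time \<tau> n \<le> s \<Longrightarrow> s < switch_time \<tau> (Suc n) \<Longrightarrow> V s = (if even n then u else 2 * c - u)"
  shows "(\<integral>s. V s \<partial>lebesgue_on {0..t}) = c * t + (u - c) * tele \<tau> t"
proof -
  note pos = admissible_pos[OF a]
  obtain n where n: "t < switch_time \<tau> n" using admissible_exceeds[OF a] by blast
  let ?L = "lebesgue_on {0..t}"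
  interpret finite_measure ?L by (rule finite_measure_lebesgue_on_Icc)
  let ?I = "\<lambda>i. {switch_time \<tau> i..<switch_time \<tau> (Suc i)} \<inter> {0..t}"
  have V_eq: "V s = c + (u - c) * (\<Sum>i<n. (-1) ^ i * indicator (?I i) s)" if s: "s \<in> {0..t}" for s
  proof -
    \<comment> \<open>The holding interval containing \<open>s\<close> is the one just before the
      first switching time beyond \<open>s\<close>.\<close>
    define m where "m = (LEAST m. s < switch_time \<tau> m)"
    have m1: "s < switch_time \<tau> m" unfolding m_def by (rule LeastI[of _ n]) (use s n in auto)
    have "m \<le> n" unfolding m_def by (rule Least_le) (use s n in auto)
    have "m \<noteq> 0" using m1 s by (cases m) auto
    then obtain k where k: "m = Suc k" by (cases m) auto
    have m2: "switch_time \<tau> k \<le> s" using not_less_Least[of k "\<lambda>m. s < switch_time \<tau> m"] k by (auto simp: m_def)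
    have uniq: "s \<in> ?I i \<longleftrightarrow> i = k" for i
    proof
      assume i: "s \<in> ?I i"
      have "switch_time \<tau> (Suc i) \<le> switch_time \<tau> k" if "i < k" using that by (intro switch_time_mono pos) auto
      then have "\<not> i < k" using i m2 by fastforce
      moreover have "switch_time \<tau> (Suc k) \<le> switch_time \<tau> i" if "k < i" using that by (intro switch_time_mono pos) auto
      then have "\<not> k < i" using i m1 k by fastforce
      ultimately show "i = k" by simp
    qed (use m1 m2 k s in auto)
    have "(\<Sum>i<n. (-1) ^ i * indicator (?I i) s) = (\<Sum>i<n. if i = k then (-1) ^ i else (0::real))"
      using uniq by (intro sum.cong) (auto simp: indicator_def)
    also have "\<dots> = (-1) ^ k" using \<open>m \<le> n\<close> k by simp
    finally have e: "(\<Sum>i<n. (-1) ^ i * indicator (?I i) s) = (-1::real) ^ k" .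
    have "V s = (if even k then u else 2 * c - u)" by (rule V) (use m1 m2 k in auto)
    then show ?thesis unfolding e by (auto simp: algebra_simps)
  qed
  have meas: "measure ?L (?I i) = elapsed \<tau> t i" for i
  proof -
    have "0 \<le> switch_time \<tau> i" by (rule switch_time_nonneg[OF pos])
    then have "?I i = (if t < switch_time \<tau> (Suc i) then {switch_time \<tau> i..t} else {switch_time \<tau> i..<switch_time \<tau> (Suc i)})"
      by auto
    moreover have "measure ?L (?I i) = measure lebesgue (?I i)"
      by (intro measure_restrict_space) auto
    ultimately show ?thesis using pos[of i]
      by (auto simp: elapsed_def switch_time_Suc min_def max_def)
  qed
  have sets: "?I i \<in> sets ?L" for i by (auto simp: sets_restrict_space)
  have int: "integrable ?L (\<lambda>s. (-1) ^ i * indicator (?I i) s :: real)" for i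
    using sets[of i] by (intro integrable_mult_right integrable_real_indicator) (auto simp: less_top[symmetric])
  define G where "G s = (\<Sum>i<n. (-1) ^ i * indicator (?I i) s :: real)" for s
  have iG: "integrable ?L G" unfolding G_def[abs_def] by (intro Bochner_Integration.integrable_sum int)
  have "(\<integral>s. G s \<partial>?L) = (\<Sum>i<n. \<integral>s. (-1) ^ i * indicator (?I i) s \<partial>?L)"
    unfolding G_def[abs_def] by (intro Bochner_Integration.integral_sum int)
  also have "\<dots> = (\<Sum>i<n. (-1) ^ i * elapsed \<tau> t i)"
  proof (intro sum.cong refl)
    fix i
    have "(\<integral>s. (-1) ^ i * indicator (?I i) s \<partial>?L) = (-1::real) ^ i * (\<integral>s. indicator (?I i) s \<partial>?L)"
      by (rule integral_mult_right_zero)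
    also have "(\<integral>s. indicator (?I i) s \<partial>?L) = elapsed \<tau> t i"
      using Bochner_Integration.integral_indicator[of ?L "?I i"] meas[of i] by simp
    finally show "(\<integral>s. (-1) ^ i * indicator (?I i) s \<partial>?L) = (-1) ^ i * elapsed \<tau> t i" .
  qed
  finally have G: "(\<integral>s. G s \<partial>?L) = (\<Sum>i<n. (-1) ^ i * elapsed \<tau> t i)" .
  have "(\<integral>s. V s \<partial>?L) = (\<integral>s. c + (u - c) * G s \<partial>?L)"
    using V_eq by (intro Bochner_Integration.integral_cong) (auto simp: G_def)
  also have "\<dots> = (\<integral>s. c \<partial>?L) + (u - c) * (\<integral>s. G s \<partial>?L)"
    using iG by simp
  also have "\<dots> = c * t + (u - c) * (\<Sum>i<n. (-1) ^ i * elapsed \<tau> t i)"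
    using t by (simp add: measure_lebesgue_on_Icc G)
  also have "(\<Sum>i<n. (-1) ^ i * elapsed \<tau> t i) = tele \<tau> t"
    using n by (intro tele_eq_sum[OF a, symmetric]) auto
  finally show ?thesis .
qed

text \<open>Finite-dimensional boxes determine the law. For a fixed set of first coordinates, the
  two candidates become finite measures on sequence space that agree on cylinders; the comparison of
  product measures on an infinite index set applies to these. It is used for the given telegraph
  process and again for the one rebuilt from the Brownian path.\<close>

lemma distr_pair_sequence_eqI:
  fixes U :: "'a \<Rightarrow> real" and \<tau> :: "'a \<Rightarrow> nat \<Rightarrow> real"
  assumes M: "prob_space M" and D: "prob_space D" and D_sets: "sets D = sets borel"
    and E: "prob_space E" and E_sets: "sets E = sets borel"
    and U[measurable]: "U \<in> borel_measurable M" and \<tau>[measurable]: "\<tau> \<in> M \<rightarrow>\<^sub>M seq_borel"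
    and eq: "\<And>A C n. A \<in> sets borel \<Longrightarrow> (\<And>i. C i \<in> sets borel) \<Longrightarrow>
      emeasure M {\<omega>\<in>space M. U \<omega> \<in> A \<and> (\<forall>i<n. \<tau> \<omega> i \<in> C i)} = emeasure D A * (\<Prod>i<n. emeasure E (C i))"
  shows "distr M (borel \<Otimes>\<^sub>M seq_borel) (\<lambda>\<omega>. (U \<omega>, \<tau> \<omega>)) = D \<Otimes>\<^sub>M PiM UNIV (\<lambda>_. E)"
proof -
  interpret M: prob_space M by fact
  interpret D: prob_space D by fact
  interpret E: prob_space E by fact
  interpret S: product_prob_space "\<lambda>_. E" "UNIV :: nat set" ..
  let ?S = "PiM UNIV (\<lambda>_::nat. E)"
  have S_sets [measurable_cong]: "sets ?S = sets seq_borel" by (intro sets_PiM_cong E_sets) simp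
  have E_space: "space E = UNIV" using sets_eq_imp_space_eq[OF E_sets] by simp
  show ?thesis
  proof (rule pair_measure_eqI[symmetric])
    show "sigma_finite_measure D" "sigma_finite_measure ?S" by unfold_locales
    show "sets (D \<Otimes>\<^sub>M ?S) = sets (distr M (borel \<Otimes>\<^sub>M seq_borel) (\<lambda>\<omega>. (U \<omega>, \<tau> \<omega>)))"
      by (simp add: sets_pair_measure_cong[OF D_sets S_sets])
    fix A B assume "A \<in> sets D" and B: "B \<in> sets ?S"
    then have A[measurable]: "A \<in> sets borel" by (simp add: D_sets)
    let ?Q = "distr (density M (\<lambda>\<omega>. indicator A (U \<omega>))) seq_borel \<tau>"
    have Q: "emeasure ?Q F = emeasure M {\<omega>\<in>space M. U \<omega> \<in> A \<and> \<tau> \<omega> \<in> F}" if F[measurable]: "F \<in> sets seq_borel" for F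
    proof -
      have "emeasure ?Q F = emeasure (density M (\<lambda>\<omega>. indicator A (U \<omega>))) (\<tau> -` F \<inter> space M)"
        by (subst emeasure_distr) auto
      also have "\<dots> = (\<integral>\<^sup>+\<omega>. indicator A (U \<omega>) * indicator (\<tau> -` F \<inter> space M) \<omega> \<partial>M)"
        by (subst emeasure_density) (auto intro: measurable_sets)
      also have "\<dots> = (\<integral>\<^sup>+\<omega>. indicator {\<omega>\<in>space M. U \<omega> \<in> A \<and> \<tau> \<omega> \<in> F} \<omega> \<partial>M)"
        by (intro nn_integral_cong) (auto split: split_indicator)
      also have "\<dots> = emeasure M {\<omega>\<in>space M. U \<omega> \<in> A \<and> \<tau> \<omega> \<in> F}"
        by (intro nn_integral_indicator) measurable
      finally show ?thesis .
    qed
    have "scale_measure (emeasure D A) ?S = ?Q"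
    proof (rule measure_eqI_PiM_infinite[where I=UNIV and M="\<lambda>_. E"])
      show "sets (scale_measure (emeasure D A) ?S) = sets ?S" by simp
      show "sets ?Q = sets ?S" by (simp add: S_sets)
      show "finite_measure (scale_measure (emeasure D A) ?S)"
        by (intro finite_measureI) (simp add: S.P.emeasure_space_1 ennreal_mult_eq_top_iff)
      fix F and J :: "nat set" assume J: "finite J" "J \<subseteq> UNIV" and F: "\<And>i. i \<in> J \<Longrightarrow> F i \<in> sets E"
      obtain n where n: "J \<subseteq> {..<n}" using J(1) finite_nat_iff_bounded by blast
      define C where "C i = (if i \<in> J then F i else UNIV)" for i
      have C: "C i \<in> sets borel" for i using F E_sets by (auto simp: C_def)
      have pe: "prod_emb UNIV (\<lambda>_. E) J (Pi\<^sub>E J F) = {\<tau>. \<forall>i<n. \<tau> i \<in> C i}"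
        using n E_space by (fastforce simp: prod_emb_def C_def PiE_iff)
      have "emeasure (scale_measure (emeasure D A) ?S) (prod_emb UNIV (\<lambda>_. E) J (Pi\<^sub>E J F)) = emeasure D A * (\<Prod>i\<in>J. emeasure E (F i))"
        using J F by (simp add: S.emeasure_PiM_emb)
      also have "(\<Prod>i\<in>J. emeasure E (F i)) = (\<Prod>i<n. emeasure E (C i))"
        using n E.emeasure_space_1 E_space by (intro prod.mono_neutral_cong_left) (auto simp: C_def)
      also have "emeasure D A * (\<Prod>i<n. emeasure E (C i)) = emeasure ?Q (prod_emb UNIV (\<lambda>_. E) J (Pi\<^sub>E J F))"
      proof (subst Q)
        show "prod_emb UNIV (\<lambda>_. E) J (Pi\<^sub>E J F) \<in> sets seq_borel"
          using J F by (subst S_sets[symmetric]) (intro sets_PiM_I, auto)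
        show "emeasure D A * (\<Prod>i<n. emeasure E (C i)) = emeasure M {\<omega> \<in> space M. U \<omega> \<in> A \<and> \<tau> \<omega> \<in> prod_emb UNIV (\<lambda>_. E) J (Pi\<^sub>E J F)}"
          unfolding pe using eq[OF A C] by simp
      qed
      finally show "emeasure (scale_measure (emeasure D A) ?S) (prod_emb UNIV (\<lambda>_. E) J (Pi\<^sub>E J F)) = emeasure ?Q (prod_emb UNIV (\<lambda>_. E) J (Pi\<^sub>E J F))" .
    qed
    then have "emeasure D A * emeasure ?S B = emeasure ?Q B" by (metis emeasure_scale_measure)
    also have "\<dots> = emeasure M {\<omega>\<in>space M. U \<omega> \<in> A \<and> \<tau> \<omega> \<in> B}" using B by (intro Q) (simp add: S_sets)
    also have "\<dots> = emeasure (distr M (borel \<Otimes>\<^sub>M seq_borel) (\<lambda>\<omega>. (U \<omega>, \<tau> \<omega>))) (A \<times> B)"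
      using B by (subst emeasure_distr) (auto simp: S_sets intro!: arg_cong[where f="emeasure M"])
    finally show "emeasure D A * emeasure ?S B = emeasure (distr M (borel \<Otimes>\<^sub>M seq_borel) (\<lambda>\<omega>. (U \<omega>, \<tau> \<omega>))) (A \<times> B)" .
  qed
qed

section \<open>Uniform initial velocity and independent exponential holding times\<close>

definition expo :: "real \<Rightarrow> real measure" where
  "expo l = density lborel (exponential_density l)"

definition two_point :: "real \<Rightarrow> real \<Rightarrow> real measure" where
  "two_point x y = distr (measure_pmf (pmf_of_set {x, y})) borel (\<lambda>z. z)"

lemma sets_expo [simp, measurable_cong]: "sets (expo l) = sets borel"
  by (simp add: expo_def)

lemma space_expo [simp]: "space (expo l) = UNIV"
  by (simp add: expo_def)

lemma prob_space_expo: "0 < l \<Longrightarrow> prob_space (expo l)"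
  unfolding expo_def by (rule prob_space_exponential_density)

lemma sets_two_point [simp, measurable_cong]: "sets (two_point x y) = sets borel"
  by (simp add: two_point_def)

lemma prob_space_two_point: "prob_space (two_point x y)"
  unfolding two_point_def by (intro measure_pmf.prob_space_distr) auto

lemma nn_integral_two_point:
  assumes "x \<noteq> y" and [measurable]: "f \<in> borel_measurable borel"
  shows "(\<integral>\<^sup>+z. f z \<partial>two_point x y) = (f x + f y) / 2"
proof -
  have "(\<integral>\<^sup>+z. f z \<partial>two_point x y) = (\<integral>\<^sup>+z. f z \<partial>measure_pmf (pmf_of_set {x, y}))"
    unfolding two_point_def by (simp add: nn_integral_distr)
  also have "\<dots> = (\<Sum>z\<in>{x, y}. f z) / 2"
    using assms(1) by (subst nn_integral_pmf_of_set) auto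
  finally show ?thesis using assms(1) by simp
qed

lemma emeasure_two_point:
  assumes "x \<noteq> y" and [measurable]: "A \<in> sets borel"
  shows "emeasure (two_point x y) A = (indicator A x + indicator A y) / 2"
  using nn_integral_two_point[OF assms(1), of "indicator A"] by (simp add: nn_integral_indicator)

lemma AE_two_point: "x \<noteq> y \<Longrightarrow> AE z in two_point x y. z \<in> {x, y}"
  by (rule AE_I'[of "UNIV - {x, y}"]) (auto simp: null_sets_def emeasure_two_point)

text \<open>All that is used later about a telegraph process: the path is a fixed function of an
  initial velocity and a sequence of holding times, and the joint law of these is an explicit
  product. In particular its path law does not depend on the sample space.\<close>

lemma telegraph_process_law:
  assumes X: "telegraph_process M v0 w0 lam X" and v: "v0 + w0 \<noteq> 0" and lam: "0 < lam"
  obtains U \<tau> where "U \<in> borel_measurable M" "\<tau> \<in> M \<rightarrow>\<^sub>M seq_borel" "\<And>\<omega>. \<omega> \<in> space M \<Longrightarrow> admissible (\<tau> \<omega>)"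
    "\<And>\<omega>. \<omega> \<in> space M \<Longrightarrow> U \<omega> \<in> {v0, - w0}"
    "\<And>\<omega> t. \<omega> \<in> space M \<Longrightarrow> 0 \<le> t \<Longrightarrow> X t \<omega> = (v0 - w0) / 2 * t + (U \<omega> - (v0 - w0) / 2) * tele (\<tau> \<omega>) t"
    "distr M (borel \<Otimes>\<^sub>M seq_borel) (\<lambda>\<omega>. (U \<omega>, \<tau> \<omega>)) = two_point v0 (- w0) \<Otimes>\<^sub>M PiM UNIV (\<lambda>_. expo lam)"
proof -
  interpret M: prob_space M using X by (simp add: telegraph_process_def)
  obtain V where V: "telegraph_velocity M v0 w0 lam V" and XV: "\<And>\<omega> t. \<omega>\<in>space M \<Longrightarrow> t\<ge>0 \<Longrightarrow> X t \<omega> = (\<integral>s. V s \<omega> \<partial>lebesgue_on {0..t})"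
    using X unfolding telegraph_process_def by blast
  define U where "U = V 0"
  obtain \<sigma> where \<sigma>0: "\<forall>n. distributed M lborel (\<sigma> n) (exponential_density lam)"
    "M.indep_vars (\<lambda>_. borel) (case_nat (V 0) \<sigma>) UNIV"
    "\<forall>\<omega>\<in>space M. (\<forall>n. 0 < \<sigma> n \<omega>) \<and> filterlim (\<lambda>n. \<Sum>i<n. \<sigma> i \<omega>) at_top sequentially \<and>
        (\<forall>n t. (\<Sum>i<n. \<sigma> i \<omega>) \<le> t \<and> t < (\<Sum>i<Suc n. \<sigma> i \<omega>) \<longrightarrow>
          V t \<omega> = (if even n then V 0 \<omega> else v0 - w0 - V 0 \<omega>))"
    using V unfolding telegraph_velocity_def by (elim conjE exE) (rule that)
  note \<sigma>0 = \<sigma>0[folded U_def]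
  note \<sigma> = spec[OF \<sigma>0(1)] \<sigma>0(2) bspec[OF \<sigma>0(3), THEN conjunct1, rule_format]
    bspec[OF \<sigma>0(3), THEN conjunct2, THEN conjunct1]
    bspec[OF \<sigma>0(3), THEN conjunct2, THEN conjunct2, rule_format, OF _ conjI]
  define \<tau> where "\<tau> \<omega> n = \<sigma> n \<omega>" for \<omega> n
  have ne: "v0 \<noteq> - w0" using v by auto
  have rv: "case_nat U \<sigma> i \<in> borel_measurable M" for i
    using \<sigma>(2) by (simp add: M.indep_vars_def)
  have U [measurable]: "U \<in> borel_measurable M" using rv[of 0] by simp
  have \<sigma>m [measurable]: "\<sigma> n \<in> borel_measurable M" for n using rv[of "Suc n"] by simp
  have \<tau>m [measurable]: "\<tau> \<in> M \<rightarrow>\<^sub>M seq_borel"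
    unfolding \<tau>_def[abs_def] by (rule measurable_PiM_single') auto
  have adm: "admissible (\<tau> \<omega>)" if w: "\<omega> \<in> space M" for \<omega>
  proof -
    have "\<exists>n. real k < switch_time (\<tau> \<omega>) n" for k
    proof -
      have "eventually (\<lambda>n. real k < (\<Sum>i<n. \<sigma> i \<omega>)) sequentially"
        using \<sigma>(4)[OF w] by (simp add: filterlim_at_top_dense)
      then show ?thesis unfolding switch_time_def \<tau>_def by (auto simp: eventually_sequentially)
    qed
    with \<sigma>(3)[OF w] show ?thesis by (auto simp: admissible_def \<tau>_def)
  qed
  have U_val: "U \<omega> \<in> {v0, - w0}" if "\<omega> \<in> space M" for \<omega>
    using V that by (auto simp: telegraph_velocity_def U_def)
  have X_eq: "X t \<omega> = (v0 - w0) / 2 * t + (U \<omega> - (v0 - w0) / 2) * tele (\<tau> \<omega>) t" if w: "\<omega> \<in> space M" "0 \<le> t" for \<omega> t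
    unfolding XV[OF w]
  proof (rule integral_alternating_velocity[OF adm[OF w(1)] w(2)])
    fix n s assume "switch_time (\<tau> \<omega>) n \<le> s" "s < switch_time (\<tau> \<omega>) (Suc n)"
    then show "V s \<omega> = (if even n then U \<omega> else 2 * ((v0 - w0) / 2) - U \<omega>)"
      using \<sigma>(5)[OF w(1), of n s] by (simp add: switch_time_def \<tau>_def)
  qed
  have U_law: "emeasure M {\<omega>\<in>space M. U \<omega> \<in> A} = emeasure (two_point v0 (- w0)) A" if A: "A \<in> sets borel" for A
  proof -
    have half: "emeasure M {\<omega>\<in>space M. U \<omega> = x} = 1 / 2" if "x \<in> {v0, - w0}" for x
    proof -
      have m: "measure M {\<omega>\<in>space M. U \<omega> = x} = 1 / 2"
        using V that ne unfolding telegraph_velocity_def U_def[symmetric] by (auto simp: card_insert_if)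
      show ?thesis unfolding M.emeasure_eq_measure m by (metis ennreal_divide_numeral ennreal_1 zero_le_one)
    qed
    have "{\<omega>\<in>space M. U \<omega> \<in> A} = (if v0 \<in> A then {\<omega>\<in>space M. U \<omega> = v0} else {}) \<union> (if - w0 \<in> A then {\<omega>\<in>space M. U \<omega> = - w0} else {})"
    proof (rule set_eqI)
      fix \<omega>
      show "\<omega> \<in> {\<omega>\<in>space M. U \<omega> \<in> A} \<longleftrightarrow> \<omega> \<in> (if v0 \<in> A then {\<omega>\<in>space M. U \<omega> = v0} else {}) \<union> (if - w0 \<in> A then {\<omega>\<in>space M. U \<omega> = - w0} else {})"
        using U_val[of \<omega>] by (cases "\<omega> \<in> space M") auto
    qed
    also have "emeasure M \<dots> = emeasure M (if v0 \<in> A then {\<omega>\<in>space M. U \<omega> = v0} else {}) + emeasure M (if - w0 \<in> A then {\<omega>\<in>space M. U \<omega> = - w0} else {})"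
      using ne by (intro plus_emeasure[symmetric]) auto
    also have "\<dots> = indicator A v0 * (1/2) + indicator A (- w0) * (1 / 2)" using half by auto
    finally show ?thesis using ne A by (simp add: emeasure_two_point ennreal_divide_times distrib_right[symmetric] divide_ennreal_def)
  qed
  have \<sigma>_law: "emeasure M (\<sigma> n -` C \<inter> space M) = emeasure (expo lam) C" if "C \<in> sets borel" for n C
    using that distributed_distr_eq_density[OF \<sigma>(1)[of n]] unfolding expo_def
    by (metis emeasure_distr \<sigma>m measurable_lborel1 sets_lborel)
  have "distr M (borel \<Otimes>\<^sub>M seq_borel) (\<lambda>\<omega>. (U \<omega>, \<tau> \<omega>)) = two_point v0 (- w0) \<Otimes>\<^sub>M PiM UNIV (\<lambda>_. expo lam)"
  proof (rule distr_pair_sequence_eqI[OF M.prob_space_axioms prob_space_two_point _ prob_space_expo[OF lam] _ U \<tau>m])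
    fix A :: "real set" and C :: "nat \<Rightarrow> real set" and n assume A: "A \<in> sets borel" and C: "\<And>i. C i \<in> sets borel"
    have "{\<omega>\<in>space M. U \<omega> \<in> A \<and> (\<forall>i<n. \<tau> \<omega> i \<in> C i)} = (\<Inter>i\<in>{..n}. case_nat U \<sigma> i -` (case_nat A C i) \<inter> space M)"
      by (auto simp: \<tau>_def split: nat.splits) 
    then have "emeasure M {\<omega>\<in>space M. U \<omega> \<in> A \<and> (\<forall>i<n. \<tau> \<omega> i \<in> C i)} = ennreal (\<Prod>i\<le>n. M.prob (case_nat U \<sigma> i -` (case_nat A C i) \<inter> space M))"
      using M.indep_varsD[OF \<sigma>(2), of "{..n}" "case_nat A C"] A C by (auto simp: M.emeasure_eq_measure split: nat.splits)
    also have "\<dots> = (\<Prod>i\<le>n. emeasure M (case_nat U \<sigma> i -` (case_nat A C i) \<inter> space M))"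
      by (simp add: M.emeasure_eq_measure prod_ennreal)
    also have "\<dots> = emeasure M (U -` A \<inter> space M) * (\<Prod>i<n. emeasure M (\<sigma> i -` C i \<inter> space M))"
      by (subst prod.atMost_shift) simp
    also have "U -` A \<inter> space M = {\<omega>\<in>space M. U \<omega> \<in> A}" by auto
    finally show "emeasure M {\<omega>\<in>space M. U \<omega> \<in> A \<and> (\<forall>i<n. \<tau> \<omega> i \<in> C i)} = emeasure (two_point v0 (- w0)) A * (\<Prod>i<n. emeasure (expo lam) (C i))"
      using U_law[OF A] \<sigma>_law[OF C] by simp
  qed auto
  then show ?thesis using U \<tau>m adm U_val X_eq that by blast
qed

section \<open>Exponential moments of the telegraph path\<close>

abbreviation expo_seq :: "real \<Rightarrow> (nat \<Rightarrow> real) measure" where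
  "expo_seq l \<equiv> PiM UNIV (\<lambda>_. expo l)"

lemma sets_expo_seq [simp, measurable_cong]: "sets (expo_seq l) = sets seq_borel"
  by (intro sets_PiM_cong) auto

lemma space_expo_seq [simp]: "space (expo_seq l) = UNIV"
  by (simp add: space_PiM)

lemma prob_space_expo_seq: "0 < l \<Longrightarrow> prob_space (expo_seq l)"
  by (intro prob_space_PiM prob_space_expo)

lemma measurable_case_nat_seq [measurable (raw)]:
  assumes "f \<in> borel_measurable M" "g \<in> M \<rightarrow>\<^sub>M seq_borel"
  shows "(\<lambda>x. case_nat (f x) (g x)) \<in> M \<rightarrow>\<^sub>M seq_borel"
  using assms by (rule measurable_case_nat')

text \<open>Splitting off the first holding time leaves an independent sequence of the same law.
  Every later recursion (renewal equation, moments, orthogonality) conditions on the first holding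
  time through this identity.\<close>

lemma expo_seq_iter:
  assumes "0 < l"
  shows "distr (expo l \<Otimes>\<^sub>M expo_seq l) (expo_seq l) (\<lambda>(s, \<omega>). case_nat s \<omega>) = expo_seq l"
proof -
  interpret prob_space "expo l" using assms by (rule prob_space_expo)
  interpret sequence_space "expo l" ..
  show ?thesis by (rule PiM_iter)
qed

lemma nn_integral_expo_seq:
  assumes l: "0 < l" and [measurable]: "f \<in> borel_measurable seq_borel"
  shows "(\<integral>\<^sup>+\<tau>. f \<tau> \<partial>expo_seq l) = (\<integral>\<^sup>+s. \<integral>\<^sup>+\<omega>. f (case_nat s \<omega>) \<partial>expo_seq l \<partial>expo l)"
proof -
  interpret S: prob_space "expo_seq l" using l by (rule prob_space_expo_seq)
  have "(\<integral>\<^sup>+\<tau>. f \<tau> \<partial>expo_seq l) = (\<integral>\<^sup>+p. f (case_nat (fst p) (snd p)) \<partial>(expo l \<Otimes>\<^sub>M expo_seq l))"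
    by (subst expo_seq_iter[OF l, symmetric], subst nn_integral_distr) (auto simp: split_beta')
  also have "\<dots> = (\<integral>\<^sup>+s. \<integral>\<^sup>+\<omega>. f (case_nat s \<omega>) \<partial>expo_seq l \<partial>expo l)"
    by (subst S.nn_integral_fst[symmetric]) auto
  finally show ?thesis .
qed

lemma nn_integral_expo:
  assumes [measurable]: "f \<in> borel_measurable borel"
  shows "(\<integral>\<^sup>+s. f s \<partial>expo l) = (\<integral>\<^sup>+s. ennreal (exponential_density l s) * f s \<partial>lborel)"
  unfolding expo_def by (subst nn_integral_density) auto

lemma AE_expo_pos: "0 < l \<Longrightarrow> AE s in expo l. 0 < s"
proof -
  assume "0 < l"
  have "AE s in lborel. s \<noteq> (0::real)" by (rule AE_lborel_singleton)
  then show ?thesis unfolding expo_def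
    by (subst AE_density) (auto simp: exponential_density_def elim!: eventually_mono split: if_splits)
qed

text \<open>Exponential tilting: the factor \<open>exp (- (c * s))\<close> turns the density of rate
  \<open>l\<close> into a multiple of the density of rate \<open>l + c\<close>.\<close>

lemma nn_integral_exp_expo:
  assumes "0 < l" "0 \<le> c"
  shows "(\<integral>\<^sup>+s. ennreal (exp (- (c * s))) \<partial>expo l) = ennreal (l / (l + c))"
proof -
  interpret E: prob_space "expo (l + c)" using assms by (intro prob_space_expo) simp
  have "(\<integral>\<^sup>+s. ennreal (exp (- (c * s))) \<partial>expo l) = (\<integral>\<^sup>+s. ennreal (l / (l + c)) * ennreal (exponential_density (l + c) s) \<partial>lborel)"
  proof (subst nn_integral_expo)
    have "l + c \<noteq> 0" using assms by simp
    then have "exponential_density l s * exp (- (c * s)) = l / (l + c) * exponential_density (l + c) s" for s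
      by (auto simp: exponential_density_def mult_exp_exp algebra_simps nonzero_eq_divide_eq)
    then show "(\<integral>\<^sup>+s. ennreal (exponential_density l s) * ennreal (exp (- (c * s))) \<partial>lborel) = (\<integral>\<^sup>+s. ennreal (l / (l + c)) * ennreal (exponential_density (l + c) s) \<partial>lborel)"
      using assms by (intro nn_integral_cong) (simp add: exponential_density_nonneg flip: ennreal_mult)
  qed measurable
  also have "\<dots> = ennreal (l / (l + c)) * (\<integral>\<^sup>+s. ennreal (exponential_density (l + c) s) \<partial>lborel)"
    by (rule nn_integral_cmult) measurable
  also have "(\<integral>\<^sup>+s. ennreal (exponential_density (l + c) s) \<partial>lborel) = (\<integral>\<^sup>+s. 1 \<partial>expo (l + c))"
    by (subst nn_integral_expo) auto
  also have "\<dots> = 1" using E.emeasure_space_1 by simp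
  finally show ?thesis by simp
qed

lemma AE_expo_seq_pos: 
  assumes "0 < l"
  shows "AE \<tau> in expo_seq l. \<forall>n. 0 < \<tau> n"
  unfolding AE_all_countable by (intro allI AE_PiM_component prob_space_expo AE_expo_pos assms) auto

text \<open>
  The mean of \<open>exp (- switch_time \<tau> n)\<close> is \<open>(l / (l + 1)) ^ n\<close>, so by Markov's inequality the switching
  times almost surely do not all stay below a given bound.
\<close>

lemma AE_admissible:
  assumes l: "0 < l"
  shows "AE \<tau> in expo_seq l. admissible \<tau>"
proof -
  interpret S: prob_space "expo_seq l" using l by (rule prob_space_expo_seq)
  let ?q = "l / (l + 1)"
  have q: "0 \<le> ?q" "?q < 1" using l by auto
  have e: "(\<integral>\<^sup>+\<tau>. ennreal (exp (- switch_time \<tau> n)) \<partial>expo_seq l) = ennreal (?q ^ n)" for n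
  proof (induction n)
    case (Suc n)
    have "(\<integral>\<^sup>+\<tau>. ennreal (exp (- switch_time \<tau> (Suc n))) \<partial>expo_seq l) =
      (\<integral>\<^sup>+s. \<integral>\<^sup>+\<omega>. ennreal (exp (- s)) * ennreal (exp (- switch_time \<omega> n)) \<partial>expo_seq l \<partial>expo l)"
      by (subst nn_integral_expo_seq[OF l]) (auto simp: switch_time_case_nat mult_exp_exp simp flip: ennreal_mult)
    also have "\<dots> = (\<integral>\<^sup>+s. ennreal (exp (- s)) * ennreal (?q ^ n) \<partial>expo l)"
      by (intro nn_integral_cong) (subst nn_integral_cmult, auto simp: Suc)
    also have "\<dots> = ennreal ?q * ennreal (?q ^ n)"
      by (subst nn_integral_multc) (auto simp: nn_integral_exp_expo[OF l zero_le_one, simplified])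
    finally show ?case using q by (simp flip: ennreal_mult)
  qed (simp add: S.emeasure_space_1[simplified])
  have "AE \<tau> in expo_seq l. \<exists>n. real k < switch_time \<tau> n" for k
  proof -
    let ?A = "{\<tau>. \<forall>n. switch_time \<tau> n \<le> real k}"
    have "{\<tau>\<in>space seq_borel. \<forall>n. switch_time \<tau> n \<le> real k} \<in> sets seq_borel" by measurable
    then have A: "?A \<in> sets (expo_seq l)" by (simp add: space_PiM)
    have "emeasure (expo_seq l) ?A \<le> ennreal (exp (real k) * ?q ^ n)" for n
    proof -
      have "emeasure (expo_seq l) ?A = (\<integral>\<^sup>+\<tau>. indicator ?A \<tau> \<partial>expo_seq l)" using A by simp
      also have "\<dots> \<le> (\<integral>\<^sup>+\<tau>. ennreal (exp (real k)) * ennreal (exp (- switch_time \<tau> n)) \<partial>expo_seq l)"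
        by (intro nn_integral_mono) (auto simp: mult_exp_exp split: split_indicator simp flip: ennreal_mult)
      also have "\<dots> = ennreal (exp (real k)) * ennreal (?q ^ n)" by (subst nn_integral_cmult) (auto simp: e)
      finally show ?thesis using q by (simp add: ennreal_mult)
    qed
    moreover have "(\<lambda>n. ennreal (exp (real k) * ?q ^ n)) \<longlonglongrightarrow> ennreal (exp (real k) * 0)"
      using q by (intro tendsto_ennrealI tendsto_mult tendsto_const LIMSEQ_realpow_zero)
    ultimately have "emeasure (expo_seq l) ?A \<le> ennreal (exp (real k) * 0)"
      by (intro LIMSEQ_le_const) auto
    then have "?A \<in> null_sets (expo_seq l)" using A by (auto simp: null_sets_def)
    then show ?thesis by (rule AE_I') (auto simp: not_less)
  qed
  then have "AE \<tau> in expo_seq l. \<forall>k::nat. \<exists>n. real k < switch_time \<tau> n" by (simp add: AE_all_countable)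
  with AE_expo_seq_pos[OF l] show ?thesis by eventually_elim (simp add: admissible_def)
qed

lemma admissible_case_nat:
  assumes "0 < s" "admissible \<tau>"
  shows "admissible (case_nat s \<tau>)"
  unfolding admissible_def
proof safe
  fix n show "0 < (case n of 0 \<Rightarrow> s | Suc m \<Rightarrow> \<tau> m)"
    using assms by (auto simp: admissible_pos split: nat.split)
next
  fix k :: nat
  obtain n where "real k < switch_time \<tau> n" using assms by (auto simp: admissible_def)
  then show "\<exists>n. real k < switch_time (case_nat s \<tau>) n"
    using assms by (intro exI[of _ "Suc n"]) (simp add: switch_time_case_nat)
qed

text \<open>The renewal property: after the first switch the path restarts with reversed velocity,
  driven by the remaining holding times.\<close>

lemma tele_case_nat:
  assumes s: "0 < s" and a: "admissible \<tau>" and t: "0 \<le> t"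
  shows "tele (case_nat s \<tau>) t = (if t < s then t else s - tele \<tau> (t - s))"
proof -
  note a' = admissible_case_nat[OF s a]
  obtain n where n: "t - s < switch_time \<tau> n" using admissible_exceeds[OF a] by blast
  have "tele (case_nat s \<tau>) t = (\<Sum>i<Suc n. (-1) ^ i * elapsed (case_nat s \<tau>) t i)"
    using n by (intro tele_eq_sum[OF a']) (simp add: switch_time_case_nat)
  also have "\<dots> = max 0 (min s t) - (\<Sum>i<n. (-1) ^ i * elapsed \<tau> (t - s) i)"
    by (subst sum.lessThan_Suc_shift) (simp add: elapsed_case_nat sum_negf)
  also have "(\<Sum>i<n. (-1) ^ i * elapsed \<tau> (t - s) i) = tele \<tau> (t - s)"
    using n by (intro tele_eq_sum[OF a, symmetric]) simp
  \<comment> \<open>For \<open>t < s\<close> the remaining time \<open>t - s\<close> is negative and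
    \<open>tele\<close> vanishes there, being an empty sum.\<close>
  finally show ?thesis
    using s t tele_eq_sum[OF a, of "t - s" 0] by (auto simp: max_def min_def)
qed

text \<open>Found by solving the linear system for the two initial velocities, whose matrix has rows
  (w - l, l) and (l, -w - l). Its eigenvalues are -l plus or minus the square root of l^2 + w^2, and
  both components start at 1.\<close>

definition tele_mgf :: "real \<Rightarrow> real \<Rightarrow> real \<Rightarrow> real" where
  "tele_mgf l w t = exp (- l * t) * (cosh (sqrt (l\<^sup>2 + w\<^sup>2) * t) + (l + w) / sqrt (l\<^sup>2 + w\<^sup>2) * sinh (sqrt (l\<^sup>2 + w\<^sup>2) * t))"

text \<open>
  \<open>tele_mgf l w\<close> and \<open>tele_mgf l (- w)\<close> solve the linear system of the moment generating functions
  of the path started with velocity \<open>1\<close> and \<open>- 1\<close>; only the renewal equation is used, and only as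
  an upper bound.
\<close>

lemma tele_mgf_deriv:
  assumes l: "0 < l"
  shows "((\<lambda>t. tele_mgf l w t) has_real_derivative (w - l) * tele_mgf l w t + l * tele_mgf l (- w) t) (at t)"
proof -
  define r where "r = sqrt (l\<^sup>2 + w\<^sup>2)"
  have r: "r \<noteq> 0" "r * r = l\<^sup>2 + w\<^sup>2" using l unfolding r_def by (auto simp: add_nonneg_eq_0_iff)
  have mgf: "tele_mgf l w t = exp (- l * t) * (cosh (r * t) + (l + w) / r * sinh (r * t))"
    "tele_mgf l (- w) t = exp (- l * t) * (cosh (r * t) + (l - w) / r * sinh (r * t))" for t
    by (simp_all add: tele_mgf_def r_def)
  have D: "((\<lambda>t. exp (- l * t) * (cosh (r * t) + (l + w) / r * sinh (r * t))) has_real_derivative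
     (- l) * exp (- l * t) * (cosh (r * t) + (l + w) / r * sinh (r * t)) + exp (- l * t) * (r * sinh (r * t) + (l + w) * cosh (r * t))) (at t)"
  proof -
    define k where "k = (l + w) / r"
    have k: "k * r = l + w" using r(1) by (simp add: k_def)
    show ?thesis unfolding k_def[symmetric] k[symmetric]
      by (auto intro!: derivative_eq_intros simp: algebra_simps)
  qed
  have I: "r * S + (l + w) * C = w * (C + (l + w) / r * S) + l * (C + (l - w) / r * S)" for S C
  proof -
    have "w * ((l + w) / r * S) + l * ((l - w) / r * S) = (l\<^sup>2 + w\<^sup>2) / r * S"
      using r(1) by (simp add: field_simps power2_eq_square)
    also have "\<dots> = r * S" using r by (simp flip: r(2))
    finally show ?thesis by (simp add: algebra_simps)
  qed
  show ?thesis
    unfolding mgf using D by (rule DERIV_cong) (unfold I, simp add: algebra_simps add_divide_distrib diff_divide_distrib)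
qed

text \<open>Since the square root dominates \<bar>w\<bar> and l is positive, the coefficient of sinh
  is at least -1, and cosh - sinh is positive.\<close>

lemma tele_mgf_nonneg:
  assumes l: "0 < l" and t: "0 \<le> t"
  shows "0 \<le> tele_mgf l w t"
proof -
  let ?r = "sqrt (l\<^sup>2 + w\<^sup>2)"
  have r: "0 < ?r" using l by (auto simp: add_pos_nonneg)
  have "\<bar>w\<bar> \<le> ?r" by (intro real_le_rsqrt) auto
  then have "- ?r \<le> l + w" using l by linarith
  then have "- 1 \<le> (l + w) / ?r" using r by (simp add: le_divide_eq)
  then have "- 1 * sinh (?r * t) \<le> (l + w) / ?r * sinh (?r * t)"
    using r t by (intro mult_right_mono) auto
  moreover have "cosh (?r * t) - sinh (?r * t) = exp (- (?r * t))" using cosh_plus_sinh[of "- (?r * t)"] by simp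
  then have "sinh (?r * t) \<le> cosh (?r * t)" using exp_gt_zero[of "- (?r * t)"] by linarith
  ultimately show ?thesis unfolding tele_mgf_def by (intro mult_nonneg_nonneg) auto
qed

lemma tele_mgf_0 [simp]: "tele_mgf l w 0 = 1"
  by (simp add: tele_mgf_def)

lemma tele_mgf_continuous: "continuous_on A (tele_mgf l w)"
  unfolding tele_mgf_def by (intro continuous_intros)

lemma tele_mgf_measurable [measurable]: "tele_mgf l w \<in> borel_measurable borel"
  by (intro borel_measurable_continuous_onI tele_mgf_continuous)

text \<open>By the differential system the integrand over \<open>[0, t]\<close> is the exact
  derivative in \<open>s\<close> of \<open>- exp ((w - l) * s) * tele_mgf l w (t - s)\<close>. The
  boundary term at \<open>s = t\<close> cancels against the event that no switch happens before
  \<open>t\<close>.\<close>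

lemma tele_mgf_renewal:
  assumes l: "0 < l" and t: "0 \<le> t"
  shows "(\<integral>\<^sup>+s. (if t < s then ennreal (exp (w * t)) else ennreal (exp (w * s)) * ennreal (tele_mgf l (- w) (t - s))) \<partial>expo l) = ennreal (tele_mgf l w t)"
proof -
  let ?f = "\<lambda>s. l * exp ((w - l) * s) * tele_mgf l (- w) (t - s)"
  have tail: "(\<integral>\<^sup>+s. ennreal (l * exp (- l * s)) * indicator {t..} s \<partial>lborel) = ennreal (0 - (- exp (- l * t)))"
  proof (rule nn_integral_FTC_atLeast)
    show "((\<lambda>s. - exp (- l * s)) \<longlongrightarrow> 0) at_top"
      using l by real_asymp
  qed (use l in \<open>auto intro!: derivative_eq_intros\<close>)
  have dF: "((\<lambda>s. - exp ((w - l) * s) * tele_mgf l w (t - s)) has_real_derivative ?f s) (at s)" for s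
    by (rule DERIV_cong[OF DERIV_mult[OF _ DERIV_chain2[OF tele_mgf_deriv[OF l]]]])
       (auto intro!: derivative_eq_intros simp: algebra_simps)
  have f0: "0 \<le> ?f s" if "0 \<le> s" "s \<le> t" for s using l that by (intro mult_nonneg_nonneg tele_mgf_nonneg) auto
  have main: "(\<integral>\<^sup>+s. ennreal (?f s) * indicator {0..t} s \<partial>lborel) = ennreal ((- exp ((w - l) * t) * tele_mgf l w (t - t)) - (- exp ((w - l) * 0) * tele_mgf l w (t - 0)))"
  proof (rule nn_integral_FTC_Icc)
    show "?f \<in> borel_measurable borel" by measurable
    fix s assume s: "s \<in> {0..t}"
    show "((\<lambda>s. - exp ((w - l) * s) * tele_mgf l w (t - s)) has_real_derivative ?f s) (at s)" by (rule dF)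
    show "0 \<le> ?f s" using s by (intro f0) auto
  qed fact
  have "(\<integral>\<^sup>+s. (if t < s then ennreal (exp (w * t)) else ennreal (exp (w * s)) * ennreal (tele_mgf l (- w) (t - s))) \<partial>expo l) =
     (\<integral>\<^sup>+s. ennreal (exp (w * t)) * (ennreal (l * exp (- l * s)) * indicator {t..} s) + ennreal (?f s) * indicator {0..t} s \<partial>lborel)"
  proof (subst nn_integral_expo)
    show "(\<integral>\<^sup>+s. ennreal (exponential_density l s) * (if t < s then ennreal (exp (w * t)) else ennreal (exp (w * s)) * ennreal (tele_mgf l (- w) (t - s))) \<partial>lborel) =
     (\<integral>\<^sup>+s. ennreal (exp (w * t)) * (ennreal (l * exp (- l * s)) * indicator {t..} s) + ennreal (?f s) * indicator {0..t} s \<partial>lborel)"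
    proof (rule nn_integral_cong_AE)
      have "AE s in lborel. s \<noteq> t" by (rule AE_lborel_singleton)
      then show "AE s in lborel. ennreal (exponential_density l s) * (if t < s then ennreal (exp (w * t)) else ennreal (exp (w * s)) * ennreal (tele_mgf l (- w) (t - s))) =
       ennreal (exp (w * t)) * (ennreal (l * exp (- l * s)) * indicator {t..} s) + ennreal (?f s) * indicator {0..t} s"
      proof eventually_elim
        case (elim s)
        consider "s < 0" | "0 \<le> s" "s < t" | "t < s" using elim by linarith
        then show ?case
        proof cases
          case 2
          then have "0 \<le> tele_mgf l (- w) (t - s)" using l by (intro tele_mgf_nonneg) auto
          moreover have "exp ((w - l) * s) = exp (- l * s) * exp (w * s)" by (simp add: mult_exp_exp algebra_simps)
          ultimately show ?thesis using 2 l by (simp add: exponential_density_def mult_ac flip: ennreal_mult)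
        qed (use t l in \<open>auto simp: exponential_density_def mult_ac simp flip: ennreal_mult\<close>)
      qed
    qed
  qed measurable
  also have "\<dots> = ennreal (exp (w * t)) * (\<integral>\<^sup>+s. ennreal (l * exp (- l * s)) * indicator {t..} s \<partial>lborel) + (\<integral>\<^sup>+s. ennreal (?f s) * indicator {0..t} s \<partial>lborel)"
    by (subst nn_integral_add) (auto simp: nn_integral_cmult)
  also have "\<dots> = ennreal (exp (w * t)) * ennreal (exp (- l * t)) + ennreal (tele_mgf l w t - exp ((w - l) * t))"
    unfolding tail main by simp
  also have "\<dots> = ennreal (exp ((w - l) * t)) + ennreal (tele_mgf l w t - exp ((w - l) * t))"
    by (simp add: mult_exp_exp algebra_simps flip: ennreal_mult)
  also have "\<dots> = ennreal (tele_mgf l w t)"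
  proof -
    \<comment> \<open>Adding extended nonnegative reals agrees with real addition only for
      nonnegative summands; here the sign comes from the monotonicity of the primitive.\<close>
    have "0 \<le> tele_mgf l w t - exp ((w - l) * t)"
      using DERIV_nonneg_imp_nondecreasing[OF t, of "\<lambda>s. - exp ((w - l) * s) * tele_mgf l w (t - s)"] dF f0 by fastforce
    then show ?thesis by (simp flip: ennreal_plus)
  qed
  finally show ?thesis .
qed

text \<open>Restricting to paths with fewer than \<open>n\<close> switches up to time
  \<open>t\<close> makes an induction on \<open>n\<close> possible: the base case is empty, and each
  step is one use of the renewal equation. Fatou's lemma removes the restriction. This avoids any
  discussion of uniqueness for the renewal equation.\<close>

lemma nn_integral_exp_tele_le:
  assumes l: "0 < l" and t: "0 \<le> t"
  shows "(\<integral>\<^sup>+\<tau>. ennreal (exp (w * tele \<tau> t)) \<partial>expo_seq l) \<le> ennreal (tele_mgf l w t)"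
proof -
  interpret S: prob_space "expo_seq l" using l by (rule prob_space_expo_seq)
  let ?J = "\<lambda>n w t \<tau>. ennreal (exp (w * tele \<tau> t)) * indicator {..<switch_time \<tau> n} t"
  have J: "(\<integral>\<^sup>+\<tau>. ?J n w t \<tau> \<partial>expo_seq l) \<le> ennreal (tele_mgf l w t)" if "0 \<le> t" for n w t
    using that
  proof (induction n arbitrary: w t)
    case (Suc n)
    have "(\<integral>\<^sup>+\<tau>. ?J (Suc n) w t \<tau> \<partial>expo_seq l) = (\<integral>\<^sup>+s. \<integral>\<^sup>+\<omega>. ?J (Suc n) w t (case_nat s \<omega>) \<partial>expo_seq l \<partial>expo l)"
      unfolding lessThan_def by (rule nn_integral_expo_seq[OF l]) measurable
    also have "\<dots> \<le> (\<integral>\<^sup>+s. (if t < s then ennreal (exp (w * t)) else ennreal (exp (w * s)) * ennreal (tele_mgf l (- w) (t - s))) \<partial>expo l)"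
      using AE_expo_pos[OF l]
    proof (intro nn_integral_mono_AE, eventually_elim)
      case (elim s)
      have "(\<integral>\<^sup>+\<omega>. ?J (Suc n) w t (case_nat s \<omega>) \<partial>expo_seq l) \<le>
        (\<integral>\<^sup>+\<omega>. (if t < s then ennreal (exp (w * t)) else ennreal (exp (w * s)) * ?J n (- w) (t - s) \<omega>) \<partial>expo_seq l)"
        using AE_admissible[OF l]
      proof (intro nn_integral_mono_AE, eventually_elim)
        case (elim \<omega>)
        then show ?case
          using \<open>0 < s\<close> Suc.prems
          by (auto simp: tele_case_nat switch_time_case_nat mult_exp_exp algebra_simps split: split_indicator simp flip: ennreal_mult)
      qed
      also have "\<dots> \<le> (if t < s then ennreal (exp (w * t)) else ennreal (exp (w * s)) * ennreal (tele_mgf l (- w) (t - s)))"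
      proof (cases "t < s")
        case True
        then show ?thesis by (simp add: S.emeasure_space_1[simplified])
      next
        case False
        then have "(\<integral>\<^sup>+\<omega>. (if t < s then ennreal (exp (w * t)) else ennreal (exp (w * s)) * ?J n (- w) (t - s) \<omega>) \<partial>expo_seq l)
          = ennreal (exp (w * s)) * (\<integral>\<^sup>+\<omega>. ?J n (- w) (t - s) \<omega> \<partial>expo_seq l)"
          unfolding lessThan_def by (simp only: if_False, subst nn_integral_cmult) (auto simp: mult_ac)
        also have "\<dots> \<le> ennreal (exp (w * s)) * ennreal (tele_mgf l (- w) (t - s))"
          using False by (intro mult_left_mono Suc.IH) auto
        finally show ?thesis using False by simp
      qed
      finally show ?case .
    qed
    also have "\<dots> = ennreal (tele_mgf l w t)" by (rule tele_mgf_renewal[OF l Suc.prems])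
    finally show ?case .
  qed simp
  have "(\<integral>\<^sup>+\<tau>. ennreal (exp (w * tele \<tau> t)) \<partial>expo_seq l) \<le> (\<integral>\<^sup>+\<tau>. liminf (\<lambda>n. ?J n w t \<tau>) \<partial>expo_seq l)"
    using AE_admissible[OF l]
  proof (intro nn_integral_mono_AE, eventually_elim)
    case (elim \<tau>)
    obtain m where m: "t < switch_time \<tau> m" using admissible_exceeds[OF elim(2)] by blast
    have "eventually (\<lambda>n. ?J n w t \<tau> = ennreal (exp (w * tele \<tau> t))) sequentially"
      using eventually_ge_at_top[of m]
    proof eventually_elim
      case (elim n)
      have "switch_time \<tau> m \<le> switch_time \<tau> n" using elim admissible_pos[OF \<open>admissible \<tau>\<close>] by (intro switch_time_mono)
      with m show ?case by simp
    qed
    then have "(\<lambda>n. ?J n w t \<tau>) \<longlonglongrightarrow> ennreal (exp (w * tele \<tau> t))" by (rule tendsto_eventually)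
    then have "liminf (\<lambda>n. ?J n w t \<tau>) = ennreal (exp (w * tele \<tau> t))" by (intro lim_imp_Liminf) auto
    then show ?case by simp
  qed
  also have "\<dots> \<le> liminf (\<lambda>n. \<integral>\<^sup>+\<tau>. ?J n w t \<tau> \<partial>expo_seq l)"
    unfolding lessThan_def by (rule nn_integral_liminf) measurable
  also have "\<dots> \<le> liminf (\<lambda>n. ennreal (tele_mgf l w t))"
    by (intro Liminf_mono always_eventually allI J t)
  finally show ?thesis by (simp add: Liminf_const)
qed

text \<open>Averaging over the two initial velocities cancels the part of the sinh coefficient that
  is odd in \<open>w\<close>; what remains is \<open>l\<close> divided by the square root, hence at
  most 1, and cosh + sinh is a single exponential.\<close>

lemma tele_mgf_symmetrized_le:
  assumes l: "0 < l" and t: "0 \<le> t"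
  shows "(tele_mgf l w t + tele_mgf l (- w) t) / 2 \<le> exp ((sqrt (l\<^sup>2 + w\<^sup>2) - l) * t)"
proof -
  let ?r = "sqrt (l\<^sup>2 + w\<^sup>2)"
  have r: "0 < ?r" using l by (auto simp: add_pos_nonneg)
  have lr: "l \<le> ?r" using l by (intro real_le_rsqrt) auto
  have "(tele_mgf l w t + tele_mgf l (- w) t) / 2 = exp (- l * t) * (cosh (?r * t) + l / ?r * sinh (?r * t))"
    unfolding tele_mgf_def using r by (simp add: algebra_simps add_divide_distrib diff_divide_distrib)
  also have "\<dots> \<le> exp (- l * t) * (cosh (?r * t) + 1 * sinh (?r * t))"
    using lr r t by (intro mult_left_mono add_left_mono mult_right_mono) auto
  also have "\<dots> = exp (- l * t) * exp (?r * t)" by (simp add: cosh_plus_sinh)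
  also have "\<dots> = exp ((?r - l) * t)" by (simp add: mult_exp_exp algebra_simps)
  finally show ?thesis .
qed

section \<open>Deviation from the embedded random walk\<close>

lemma has_bochner_integral_expo:
  fixes f :: "real \<Rightarrow> real"
  assumes "0 < l" and [measurable]: "f \<in> borel_measurable borel"
  shows "has_bochner_integral (expo l) f x \<longleftrightarrow> has_bochner_integral lborel (\<lambda>s. exponential_density l s * f s) x"
  unfolding expo_def using assms
  by (simp add: has_bochner_integral_iff integrable_density integral_density exponential_density_nonneg)

lemma expo_moment:
  assumes l: "0 < l"
  shows "has_bochner_integral (expo l) (\<lambda>s. s ^ k) (fact k / l ^ k)"
proof -
  interpret prob_space "expo l" using l by (rule prob_space_expo)
  have "distributed (expo l) lborel (\<lambda>s. s) (exponential_density l)"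
    unfolding distributed_def expo_def by (auto simp: distr_id2)
  from has_bochner_integral_erlang_ith_moment[OF l this, of k] show ?thesis by simp
qed

text \<open>Lack of memory: beyond \<open>u\<close> the excess is again exponential, with total mass
  \<open>exp (- l * u)\<close>. The second factor is an indicator that matters for
  \<open>k = 0\<close>, where the zeroth power of 0 would count the event without excess.\<close>

lemma expo_excess_moment:
  assumes l: "0 < l" and u: "0 \<le> u"
  shows "has_bochner_integral (expo l) (\<lambda>s. (if u < s then s - u else 0) ^ k * (if u < s then 1 else 0)) (exp (- l * u) * (fact k / l ^ k))"
proof -
  have "has_bochner_integral lborel (\<lambda>y. exponential_density l y * y ^ k) (fact k / l ^ k)"
    using expo_moment[OF l, of k] by (subst (asm) has_bochner_integral_expo[OF l]) auto
  then have "has_bochner_integral lborel (\<lambda>y. exponential_density l (- u + 1 * y) * (- u + 1 * y) ^ k) (fact k / l ^ k)"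
    by (subst (asm) lborel_has_bochner_integral_real_affine_iff[where c=1 and t="- u"]) auto
  then have h: "has_bochner_integral lborel (\<lambda>y. exp (- l * u) * (exponential_density l (y - u) * (y - u) ^ k)) (exp (- l * u) * (fact k / l ^ k))"
    by (intro has_bochner_integral_mult_right) (simp add: algebra_simps)
  show ?thesis
  proof (subst has_bochner_integral_expo[OF l])
    show "has_bochner_integral lborel (\<lambda>s. exponential_density l s * ((if u < s then s - u else 0) ^ k * (if u < s then 1 else 0))) (exp (- l * u) * (fact k / l ^ k))"
    proof (rule has_bochner_integral_cong_AE[THEN iffD1, OF _ _ _ h])
      have "AE y in lborel. y \<noteq> u" by (rule AE_lborel_singleton)
      then show "AE y in lborel. exp (- l * u) * (exponential_density l (y - u) * (y - u) ^ k) =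
        exponential_density l y * ((if u < y then y - u else 0) ^ k * (if u < y then 1 else 0))"
      proof eventually_elim
        case (elim y)
        have "exp (- l * u) * exp (- (y - u) * l) = exp (- y * l)" by (simp add: mult_exp_exp algebra_simps)
        with elim u show ?case by (cases "u < y") (auto simp: exponential_density_def)
      qed
    qed auto
  qed measurable
qed

text \<open>
  The contribution of a single holding time \<open>s\<close> to the deviation of the path from its value at the
  \<open>n\<close>-th switching time, when \<open>t\<close> is the time left: \<open>increment False\<close> for intervals after
  the \<open>n\<close>-th switch, \<open>increment True\<close> for those before.
\<close>

definition increment :: "bool \<Rightarrow> real \<Rightarrow> real \<Rightarrow> real" where
  "increment b t s = max 0 (min s t) - (if b then s else 0)"

definition increment_mean :: "real \<Rightarrow> bool \<Rightarrow> real \<Rightarrow> real" where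
  "increment_mean l b t = (1 - exp (- l * max 0 t)) / l - (if b then 1 / l else 0)"

lemma measurable_increment [measurable]: "(\<lambda>s. increment b t s) \<in> borel_measurable borel"
  unfolding increment_def by measurable

text \<open>For a positive holding time the increment has a fixed sign, positive part before
  truncation or negative excess, so the mean of the absolute value is the absolute value of the
  mean. For the excess the second moment equals \<open>2 / l\<close> times this mean; for the
  truncated holding time it is smaller. This proportionality turns variances into expected time
  below.\<close>

lemma increment_moments:
  assumes l: "0 < l"
  shows "has_bochner_integral (expo l) (increment b t) (increment_mean l b t)"
    "has_bochner_integral (expo l) (\<lambda>s. \<bar>increment b t s\<bar>) \<bar>increment_mean l b t\<bar>"
    "integrable (expo l) (\<lambda>s. (increment b t s)\<^sup>2)"
    "(\<integral>s. (increment b t s)\<^sup>2 \<partial>expo l) \<le> 2 / l * \<bar>increment_mean l b t\<bar>"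
proof -
  define u where "u = max 0 t"
  have u: "0 \<le> u" by (simp add: u_def)
  let ?e = "exp (- l * u)"
  define X where "X s = (if u < s then s - u else (0::real))" for s
  have X1: "has_bochner_integral (expo l) X (?e / l)"
    using expo_excess_moment[OF l u, of 1] by (simp add: X_def[abs_def] if_distrib cong: if_cong)
  have X2: "has_bochner_integral (expo l) (\<lambda>s. (X s)\<^sup>2) (?e * (2 / l\<^sup>2))"
  proof -
    have "(\<lambda>s. (if u < s then s - u else 0) ^ 2 * (if u < s then 1 else 0)) = (\<lambda>s. (X s)\<^sup>2)"
      by (auto simp: X_def fun_eq_iff)
    then show ?thesis using expo_excess_moment[OF l u, of 2] by simp
  qed
  have s1: "has_bochner_integral (expo l) (\<lambda>s. s) (1 / l)" and s2: "has_bochner_integral (expo l) (\<lambda>s. s\<^sup>2) (2 / l\<^sup>2)"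
    using expo_moment[OF l, of 1] expo_moment[OF l, of 2] by simp_all
  have [measurable]: "X \<in> borel_measurable borel" unfolding X_def[abs_def] by measurable
  have pos: "AE s in expo l. 0 < s" by (rule AE_expo_pos[OF l])
  have e1: "?e \<le> 1" using l u by simp
  have "has_bochner_integral (expo l) (increment b t) (increment_mean l b t) \<and>
      has_bochner_integral (expo l) (\<lambda>s. \<bar>increment b t s\<bar>) \<bar>increment_mean l b t\<bar> \<and>
      integrable (expo l) (\<lambda>s. (increment b t s)\<^sup>2) \<and>
      (\<integral>s. (increment b t s)\<^sup>2 \<partial>expo l) \<le> 2 / l * \<bar>increment_mean l b t\<bar>"
  proof (cases b)
    case True
    have i: "increment b t s = - X s" if "0 < s" for s
      using True that by (auto simp: increment_def X_def u_def min_def max_def)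
    have m: "increment_mean l b t = - (?e / l)" using True by (simp add: increment_mean_def u_def diff_divide_distrib)
    have "has_bochner_integral (expo l) (increment b t) (- (?e / l))"
      using pos by (intro has_bochner_integral_cong_AE[THEN iffD1, OF _ _ _ has_bochner_integral_minus[OF X1]]) (auto elim!: eventually_mono simp: i)
    moreover have "has_bochner_integral (expo l) (\<lambda>s. \<bar>increment b t s\<bar>) (?e / l)"
      using pos by (intro has_bochner_integral_cong_AE[THEN iffD1, OF _ _ _ X1]) (auto elim!: eventually_mono simp: i X_def)
    moreover have "has_bochner_integral (expo l) (\<lambda>s. (increment b t s)\<^sup>2) (?e * (2 / l\<^sup>2))"
      using pos by (intro has_bochner_integral_cong_AE[THEN iffD1, OF _ _ _ X2]) (auto elim!: eventually_mono simp: i)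
    ultimately show ?thesis
      unfolding m using l by (auto simp: has_bochner_integral_iff power2_eq_square mult.commute)
  next
    case False
    have i: "increment b t s = s - X s" if "0 < s" for s
      using False that by (auto simp: increment_def X_def u_def min_def max_def)
    have m: "increment_mean l b t = 1 / l - ?e / l" using False by (simp add: increment_mean_def u_def diff_divide_distrib)
    \<comment> \<open>With \<open>X s\<close> the excess over \<open>u\<close>, the truncated time
      is \<open>s - X s\<close>, and \<open>s * X s\<close> equals
      \<open>(X s)\<^sup>2 + u * X s\<close> because \<open>X s\<close> is either 0 or
      \<open>s - u\<close>.\<close>
    have sq: "(increment b t s)\<^sup>2 = s\<^sup>2 - (X s)\<^sup>2 - 2 * u * X s" if "0 < s" for s
      unfolding i[OF that] by (auto simp: X_def power2_eq_square algebra_simps)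
    have d: "has_bochner_integral (expo l) (\<lambda>s. s - X s) (1 / l - ?e / l)"
      by (rule has_bochner_integral_diff[OF s1 X1])
    have "has_bochner_integral (expo l) (increment b t) (1 / l - ?e / l)"
      using pos by (intro has_bochner_integral_cong_AE[THEN iffD1, OF _ _ _ d]) (auto elim!: eventually_mono simp: i)
    moreover have "has_bochner_integral (expo l) (\<lambda>s. \<bar>increment b t s\<bar>) (1 / l - ?e / l)"
    proof (rule has_bochner_integral_cong_AE[THEN iffD1, OF _ _ _ d])
      show "AE s in expo l. s - X s = \<bar>increment b t s\<bar>"
        using pos by eventually_elim (use u in \<open>auto simp: i X_def\<close>)
    qed auto
    moreover have q: "has_bochner_integral (expo l) (\<lambda>s. (increment b t s)\<^sup>2) (2 / l\<^sup>2 - ?e * (2 / l\<^sup>2) - 2 * u * (?e / l))"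
    proof (rule has_bochner_integral_cong_AE[THEN iffD1])
      show "has_bochner_integral (expo l) (\<lambda>s. s\<^sup>2 - (X s)\<^sup>2 - 2 * u * X s) (2 / l\<^sup>2 - ?e * (2 / l\<^sup>2) - 2 * u * (?e / l))"
        by (intro has_bochner_integral_diff has_bochner_integral_mult_right s2 X1 X2)
      show "AE s in expo l. s\<^sup>2 - (X s)\<^sup>2 - 2 * u * X s = (increment b t s)\<^sup>2"
        using pos by eventually_elim (simp add: sq)
    qed auto
    moreover have "2 / l\<^sup>2 - ?e * (2 / l\<^sup>2) - 2 * u * (?e / l) \<le> 2 / l * \<bar>1 / l - ?e / l\<bar>"
    proof -
      have "0 \<le> 1 / l - ?e / l" using l e1 by (simp add: divide_right_mono)
      moreover have "2 / l * (1 / l - ?e / l) = 2 / l\<^sup>2 - ?e * (2 / l\<^sup>2)" by (simp add: power2_eq_square right_diff_distrib)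
      moreover have "0 \<le> 2 * u * (?e / l)" using u l by simp
      ultimately show ?thesis by simp
    qed
    moreover have "0 \<le> 1 / l - ?e / l" using l e1 by (simp add: divide_right_mono)
    ultimately show ?thesis
      unfolding m by (auto simp: has_bochner_integral_iff)
  qed
  then show "has_bochner_integral (expo l) (increment b t) (increment_mean l b t)"
    "has_bochner_integral (expo l) (\<lambda>s. \<bar>increment b t s\<bar>) \<bar>increment_mean l b t\<bar>"
    "integrable (expo l) (\<lambda>s. (increment b t s)\<^sup>2)"
    "(\<integral>s. (increment b t s)\<^sup>2 \<partial>expo l) \<le> 2 / l * \<bar>increment_mean l b t\<bar>"
    by blast+
qed

text \<open>
  The deviation of the \<open>m\<close>-step path from its value at the \<open>n\<close>-th switching time, centred
  conditionally on the past so that the summands become orthogonal.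
\<close>

definition martingale_part :: "real \<Rightarrow> nat \<Rightarrow> nat \<Rightarrow> real \<Rightarrow> (nat \<Rightarrow> real) \<Rightarrow> real" where
  "martingale_part l m n t \<tau> = (\<Sum>i<m. (-1) ^ i * (increment (i < n) (t - switch_time \<tau> i) (\<tau> i) - increment_mean l (i < n) (t - switch_time \<tau> i)))"

definition total_increment :: "nat \<Rightarrow> nat \<Rightarrow> real \<Rightarrow> (nat \<Rightarrow> real) \<Rightarrow> real" where
  "total_increment m n t \<tau> = (\<Sum>i<m. \<bar>increment (i < n) (t - switch_time \<tau> i) (\<tau> i)\<bar>)"

lemma measurable_martingale_part [measurable]: "martingale_part l m n t \<in> borel_measurable seq_borel"
  unfolding martingale_part_def increment_def increment_mean_def by measurable

lemma measurable_total_increment [measurable]: "total_increment m n t \<in> borel_measurable seq_borel"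
  unfolding total_increment_def increment_def by measurable

section \<open>Orthogonality of the centred steps and control of their compensator\<close>

lemma Suc_less_iff: "Suc i < n \<longleftrightarrow> i < n - 1" by auto

text \<open>The minus sign reflects the reversal of velocity at the first switch. For
  \<open>n = 0\<close> the truncated difference \<open>n - 1\<close> stays 0, as it should: then no
  interval lies before the reference switch.\<close>

lemma martingale_part_case_nat:
  "martingale_part l (Suc m) n t (case_nat s \<tau>) = (increment (0 < n) t s - increment_mean l (0 < n) t) - martingale_part l m (n - 1) (t - s) \<tau>"
  unfolding martingale_part_def
  by (subst sum.lessThan_Suc_shift) (simp add: switch_time_case_nat sum_negf Suc_less_iff diff_diff_eq)

lemma total_increment_case_nat:
  "total_increment (Suc m) n t (case_nat s \<tau>) = \<bar>increment (0 < n) t s\<bar> + total_increment m (n - 1) (t - s) \<tau>"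
  unfolding total_increment_def
  by (subst sum.lessThan_Suc_shift) (simp add: switch_time_case_nat Suc_less_iff diff_diff_eq)

lemma integrable_expo_seq_component:
  assumes l: "0 < l"
  shows "integrable (expo_seq l) (\<lambda>\<tau>. \<bar>\<tau> i\<bar>)" "integrable (expo_seq l) (\<lambda>\<tau>. (\<tau> i)\<^sup>2)"
proof -
  have "distr (expo_seq l) (expo l) (\<lambda>\<tau>. \<tau> i) = expo l"
    using l by (intro distr_PiM_component prob_space_expo) auto
  then have "integrable (expo_seq l) (\<lambda>\<tau>. f (\<tau> i))" if "integrable (expo l) f" for f :: "real \<Rightarrow> real"
    using integrable_distr[of "\<lambda>\<tau>. \<tau> i" "expo_seq l" "expo l" f] that by simp
  note i = this
  show "integrable (expo_seq l) (\<lambda>\<tau>. \<bar>\<tau> i\<bar>)" "integrable (expo_seq l) (\<lambda>\<tau>. (\<tau> i)\<^sup>2)"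
    using expo_moment[OF l, of 1] expo_moment[OF l, of 2] by (auto intro!: i integrable_abs simp: has_bochner_integral_iff)
qed

lemma sum_power2_le: "(\<Sum>i<m. f i)\<^sup>2 \<le> real m * (\<Sum>i<m. (f i :: real)\<^sup>2)"
  using Cauchy_Schwarz_ineq_sum[of "\<lambda>_. 1" f "{..<m}"] by simp

lemma integrable_martingale_part:
  assumes l: "0 < l"
  shows "integrable (expo_seq l) (martingale_part l m n t)" "integrable (expo_seq l) (\<lambda>\<tau>. (martingale_part l m n t \<tau>)\<^sup>2)"
    "integrable (expo_seq l) (total_increment m n t)"
proof -
  interpret S: prob_space "expo_seq l" using l by (rule prob_space_expo_seq)
  let ?g = "\<lambda>i \<tau>::nat \<Rightarrow> real. 2 * \<bar>\<tau> i\<bar> + 2 / l"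
  have inc: "\<bar>increment b u s\<bar> \<le> 2 * \<bar>s\<bar>" for b u s by (auto simp: increment_def min_def max_def)
  have mean: "\<bar>increment_mean l b u\<bar> \<le> 2 / l" for b u
  proof -
    have e: "0 \<le> exp (- l * max 0 u)" "exp (- l * max 0 u) \<le> 1" using l by auto
    have "increment_mean l b u = (1 - exp (- l * max 0 u) - (if b then 1 else 0)) / l"
      by (simp add: increment_mean_def diff_divide_distrib)
    then have "\<bar>increment_mean l b u\<bar> = \<bar>1 - exp (- l * max 0 u) - (if b then 1 else 0)\<bar> / l" using l by (simp add: abs_divide)
    also have "\<dots> \<le> 2 / l" using e l by (cases b) (intro divide_right_mono; simp only: if_True if_False; linarith)+
    finally show ?thesis .
  qed
  have b: "\<bar>martingale_part l m n t \<tau>\<bar> \<le> (\<Sum>i<m. ?g i \<tau>)" for \<tau>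
    unfolding martingale_part_def
  proof (rule order_trans[OF sum_abs], rule sum_mono)
    fix i
    show "\<bar>(-1) ^ i * (increment (i < n) (t - switch_time \<tau> i) (\<tau> i) - increment_mean l (i < n) (t - switch_time \<tau> i))\<bar> \<le> ?g i \<tau>"
      using inc[of "i < n" "t - switch_time \<tau> i" "\<tau> i"] mean[of "i < n" "t - switch_time \<tau> i"]
      by (simp add: abs_mult power_abs)
  qed
  have ig: "integrable (expo_seq l) (\<lambda>\<tau>. \<Sum>i<m. ?g i \<tau>)"
    using integrable_expo_seq_component[OF l] by (intro Bochner_Integration.integrable_sum Bochner_Integration.integrable_add integrable_mult_right) auto
  show "integrable (expo_seq l) (martingale_part l m n t)"
    by (rule Bochner_Integration.integrable_bound[OF ig]) (use b in \<open>auto intro: order_trans[OF _ abs_ge_self]\<close>)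
  have g2: "(?g i \<tau>)\<^sup>2 = 4 * (\<tau> i)\<^sup>2 + 8 / l * \<bar>\<tau> i\<bar> + 4 / l\<^sup>2" for i \<tau>
    by (simp add: power2_sum power_mult_distrib power_divide)
  have ig2: "integrable (expo_seq l) (\<lambda>\<tau>. real m * (\<Sum>i<m. (?g i \<tau>)\<^sup>2))"
    unfolding g2 using integrable_expo_seq_component[OF l]
    by (intro integrable_mult_right Bochner_Integration.integrable_sum Bochner_Integration.integrable_add) auto
  show "integrable (expo_seq l) (\<lambda>\<tau>. (martingale_part l m n t \<tau>)\<^sup>2)"
  proof (rule Bochner_Integration.integrable_bound[OF ig2])
    have "(martingale_part l m n t \<tau>)\<^sup>2 \<le> real m * (\<Sum>i<m. (?g i \<tau>)\<^sup>2)" for \<tau>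
    proof -
      have "(martingale_part l m n t \<tau>)\<^sup>2 \<le> (\<Sum>i<m. ?g i \<tau>)\<^sup>2"
        using b[of \<tau>] by (simp add: abs_le_square_iff[symmetric])
      also have "\<dots> \<le> real m * (\<Sum>i<m. (?g i \<tau>)\<^sup>2)" by (rule sum_power2_le)
      finally show ?thesis .
    qed
    then show "AE \<tau> in expo_seq l. norm ((martingale_part l m n t \<tau>)\<^sup>2) \<le> norm (real m * (\<Sum>i<m. (?g i \<tau>)\<^sup>2))"
      by (intro always_eventually allI) (simp add: sum_nonneg)
  qed measurable
  have "\<bar>total_increment m n t \<tau>\<bar> \<le> (\<Sum>i<m. ?g i \<tau>)" for \<tau>
  proof -
    have "total_increment m n t \<tau> \<le> (\<Sum>i<m. ?g i \<tau>)"
      unfolding total_increment_def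
    proof (rule sum_mono)
      fix i show "\<bar>increment (i < n) (t - switch_time \<tau> i) (\<tau> i)\<bar> \<le> ?g i \<tau>"
        using inc[of "i < n" "t - switch_time \<tau> i" "\<tau> i"] l by (smt (verit) divide_nonneg_pos)
    qed
    moreover have "0 \<le> total_increment m n t \<tau>" unfolding total_increment_def by (intro sum_nonneg) auto
    ultimately show ?thesis by simp
  qed
  then show "integrable (expo_seq l) (total_increment m n t)"
    by (intro Bochner_Integration.integrable_bound[OF ig]) (auto intro: order_trans[OF _ abs_ge_self])
qed

lemma integral_expo_seq:
  fixes f :: "(nat \<Rightarrow> real) \<Rightarrow> real"
  assumes l: "0 < l" and f: "integrable (expo_seq l) f"
  shows "integrable (expo l) (\<lambda>s. \<integral>\<omega>. f (case_nat s \<omega>) \<partial>expo_seq l)"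
    "(\<integral>\<tau>. f \<tau> \<partial>expo_seq l) = (\<integral>s. \<integral>\<omega>. f (case_nat s \<omega>) \<partial>expo_seq l \<partial>expo l)"
proof -
  interpret E: prob_space "expo l" using l by (rule prob_space_expo)
  interpret S: prob_space "expo_seq l" using l by (rule prob_space_expo_seq)
  interpret P: pair_sigma_finite "expo l" "expo_seq l" ..
  have [measurable]: "f \<in> borel_measurable (expo_seq l)" using f by simp
  have i: "integrable (expo l \<Otimes>\<^sub>M expo_seq l) (\<lambda>p. f (case_nat (fst p) (snd p)))"
    using f by (subst (asm) expo_seq_iter[OF l, symmetric], subst (asm) integrable_distr_eq) (auto simp: split_beta')
  show "integrable (expo l) (\<lambda>s. \<integral>\<omega>. f (case_nat s \<omega>) \<partial>expo_seq l)"
    using P.integrable_fst'[OF i] by simp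
  have "(\<integral>\<tau>. f \<tau> \<partial>expo_seq l) = (\<integral>p. f (case_nat (fst p) (snd p)) \<partial>(expo l \<Otimes>\<^sub>M expo_seq l))"
    by (subst expo_seq_iter[OF l, symmetric], subst integral_distr) (auto simp: split_beta')
  then show "(\<integral>\<tau>. f \<tau> \<partial>expo_seq l) = (\<integral>s. \<integral>\<omega>. f (case_nat s \<omega>) \<partial>expo_seq l \<partial>expo l)"
    using P.integral_fst'[OF i] by simp
qed

text \<open>Conditionally on the first holding time the remainder is centred for every remaining
  time, so the cross term vanishes and second moments add. Each step contributes at most its
  uncentred second moment, which \<open>increment_moments\<close> bounds by \<open>2 / l\<close>
  times its mean absolute value.\<close>

lemma martingale_part_moments:
  assumes l: "0 < l"
  shows "(\<integral>\<tau>. martingale_part l m n t \<tau> \<partial>expo_seq l) = 0 \<and>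
    (\<integral>\<tau>. (martingale_part l m n t \<tau>)\<^sup>2 \<partial>expo_seq l) \<le> 2 / l * (\<integral>\<tau>. total_increment m n t \<tau> \<partial>expo_seq l)"
proof (induction m arbitrary: n t)
  case (Suc m)
  interpret E: prob_space "expo l" using l by (rule prob_space_expo)
  interpret S: prob_space "expo_seq l" using l by (rule prob_space_expo_seq)
  let ?Y = "\<lambda>s. increment (0 < n) t s - increment_mean l (0 < n) t"
  let ?R = "\<lambda>s. martingale_part l m (n - 1) (t - s)"
  let ?I = "\<lambda>s. total_increment m (n - 1) (t - s)"
  note int = integrable_martingale_part[OF l]
  note inc = increment_moments[OF l, of "0 < n" t]
  have Y: "integrable (expo l) ?Y" "(\<integral>s. ?Y s \<partial>expo l) = 0"
    using inc(1) by (auto simp: has_bochner_integral_iff E.prob_space[simplified])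
  show ?case
  proof
    have "(\<integral>\<tau>. martingale_part l (Suc m) n t \<tau> \<partial>expo_seq l) = (\<integral>s. \<integral>\<omega>. ?Y s - ?R s \<omega> \<partial>expo_seq l \<partial>expo l)"
      unfolding integral_expo_seq(2)[OF l int(1)] martingale_part_case_nat ..
    also have "\<dots> = (\<integral>s. ?Y s \<partial>expo l)"
      using Suc.IH[THEN conjunct1] int(1) by (simp add: S.prob_space[simplified])
    finally show "(\<integral>\<tau>. martingale_part l (Suc m) n t \<tau> \<partial>expo_seq l) = 0" using Y by simp
  next
    have Y2: "integrable (expo l) (\<lambda>s. (?Y s)\<^sup>2)" "(\<integral>s. (?Y s)\<^sup>2 \<partial>expo l) \<le> (\<integral>s. (increment (0 < n) t s)\<^sup>2 \<partial>expo l)"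
    proof -
      let ?c = "increment_mean l (0 < n) t"
      have e: "(?Y s)\<^sup>2 = (increment (0 < n) t s)\<^sup>2 - 2 * ?c * increment (0 < n) t s + ?c\<^sup>2" for s
        by (simp add: power2_diff)
      show "integrable (expo l) (\<lambda>s. (?Y s)\<^sup>2)" "(\<integral>s. (?Y s)\<^sup>2 \<partial>expo l) \<le> (\<integral>s. (increment (0 < n) t s)\<^sup>2 \<partial>expo l)"
        unfolding e using inc by (auto simp: has_bochner_integral_iff E.prob_space[simplified] power2_eq_square)
    qed
    have sq: "(\<integral>\<omega>. (?Y s - ?R s \<omega>)\<^sup>2 \<partial>expo_seq l) = (?Y s)\<^sup>2 + (\<integral>\<omega>. (?R s \<omega>)\<^sup>2 \<partial>expo_seq l)" for s
      unfolding power2_diff using int Suc.IH[THEN conjunct1] by (simp add: S.prob_space[simplified])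
    have iI: "integrable (expo l) (\<lambda>s. \<integral>\<omega>. total_increment (Suc m) n t (case_nat s \<omega>) \<partial>expo_seq l)"
      by (rule integral_expo_seq(1)[OF l int(3)])
    have I_eq: "(\<integral>\<omega>. total_increment (Suc m) n t (case_nat s \<omega>) \<partial>expo_seq l) = \<bar>increment (0 < n) t s\<bar> + (\<integral>\<omega>. ?I s \<omega> \<partial>expo_seq l)" for s
      using int(3) by (simp add: total_increment_case_nat S.prob_space[simplified])
    have iI': "integrable (expo l) (\<lambda>s. \<integral>\<omega>. ?I s \<omega> \<partial>expo_seq l)"
    proof -
      have "integrable (expo l) (\<lambda>s. (\<bar>increment (0 < n) t s\<bar> + (\<integral>\<omega>. ?I s \<omega> \<partial>expo_seq l)) - \<bar>increment (0 < n) t s\<bar>)"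
        using iI inc(2) unfolding I_eq by (intro Bochner_Integration.integrable_diff) (auto simp: has_bochner_integral_iff)
      then show ?thesis by simp
    qed
    have "(\<integral>\<tau>. (martingale_part l (Suc m) n t \<tau>)\<^sup>2 \<partial>expo_seq l) = (\<integral>s. (?Y s)\<^sup>2 + (\<integral>\<omega>. (?R s \<omega>)\<^sup>2 \<partial>expo_seq l) \<partial>expo l)"
      unfolding integral_expo_seq(2)[OF l int(2)] martingale_part_case_nat sq ..
    also have "\<dots> \<le> (\<integral>s. (?Y s)\<^sup>2 + 2 / l * (\<integral>\<omega>. ?I s \<omega> \<partial>expo_seq l) \<partial>expo l)"
    proof (rule integral_mono)
      show "integrable (expo l) (\<lambda>s. (?Y s)\<^sup>2 + (\<integral>\<omega>. (?R s \<omega>)\<^sup>2 \<partial>expo_seq l))"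
        using integral_expo_seq(1)[OF l int(2), of "Suc m" n t] unfolding martingale_part_case_nat sq .
      show "integrable (expo l) (\<lambda>s. (?Y s)\<^sup>2 + 2 / l * (\<integral>\<omega>. ?I s \<omega> \<partial>expo_seq l))"
        using Y2 iI' by (intro Bochner_Integration.integrable_add integrable_mult_right)
    qed (use Suc.IH[THEN conjunct2] in simp)
    also have "\<dots> = (\<integral>s. (?Y s)\<^sup>2 \<partial>expo l) + 2 / l * (\<integral>s. (\<integral>\<omega>. ?I s \<omega> \<partial>expo_seq l) \<partial>expo l)"
      using Y2(1) iI' by simp
    also have "\<dots> \<le> 2 / l * (\<integral>s. \<bar>increment (0 < n) t s\<bar> \<partial>expo l) + 2 / l * (\<integral>s. (\<integral>\<omega>. ?I s \<omega> \<partial>expo_seq l) \<partial>expo l)"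
      using Y2(2) inc(2,4) by (auto simp: has_bochner_integral_iff)
    also have "\<dots> = 2 / l * (\<integral>s. \<bar>increment (0 < n) t s\<bar> + (\<integral>\<omega>. ?I s \<omega> \<partial>expo_seq l) \<partial>expo l)"
      using iI' inc(2) by (simp add: has_bochner_integral_iff distrib_left)
    also have "\<dots> = 2 / l * (\<integral>\<tau>. total_increment (Suc m) n t \<tau> \<partial>expo_seq l)"
      unfolding integral_expo_seq(2)[OF l int(3)] I_eq ..
    finally show "(\<integral>\<tau>. (martingale_part l (Suc m) n t \<tau>)\<^sup>2 \<partial>expo_seq l) \<le> 2 / l * (\<integral>\<tau>. total_increment (Suc m) n t \<tau> \<partial>expo_seq l)" .
  qed
next
  case 0
  have "martingale_part l 0 n t = (\<lambda>_. 0)" "total_increment 0 n t = (\<lambda>_. 0)" for n t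
    by (simp_all add: fun_eq_iff martingale_part_def total_increment_def)
  then show ?case by simp
qed

text \<open>Leibniz' bound: an alternating sum with decreasing nonnegative terms stays between 0 and
  its first term, whatever its length.\<close>

lemma alternating_sum_bounds:
  fixes p :: "nat \<Rightarrow> real"
  assumes "decseq p" "\<And>i. 0 \<le> p i"
  shows "0 \<le> (\<Sum>i<m. (-1) ^ i * p i) \<and> (\<Sum>i<m. (-1) ^ i * p i) \<le> p 0"
  using assms
proof (induction m arbitrary: p)
  case (Suc m)
  have "decseq (\<lambda>i. p (Suc i))" using Suc.prems(1) by (auto simp: decseq_def)
  then have IH: "0 \<le> (\<Sum>i<m. (-1) ^ i * p (Suc i))" "(\<Sum>i<m. (-1) ^ i * p (Suc i)) \<le> p 1"
    using Suc.IH[of "\<lambda>i. p (Suc i)"] Suc.prems(2) by auto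
  have e: "(\<Sum>i<Suc m. (-1) ^ i * p i) = p 0 - (\<Sum>i<m. (-1) ^ i * p (Suc i))"
    by (subst sum.lessThan_Suc_shift) (simp add: sum_negf)
  have "p 1 \<le> p 0" using Suc.prems(1) by (simp add: decseq_def)
  with IH show ?case unfolding e by simp
qed simp

text \<open>The conditional means form two alternating sums: one with terms decreasing because the
  time left decreases, the other constant up to \<open>n\<close> and then 0. Both lie in
  \<open>[0, 1 / l]\<close>, so the compensator is bounded independently of the number of
  steps.\<close>

lemma martingale_part_close:
  assumes l: "0 < l" and pos: "\<And>i. 0 < \<tau> i"
  shows "\<bar>(\<Sum>i<m. (-1) ^ i * increment (i < n) (t - switch_time \<tau> i) (\<tau> i)) - martingale_part l m n t \<tau>\<bar> \<le> 1 / l"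
proof -
  define p where "p i = (1 - exp (- l * max 0 (t - switch_time \<tau> i))) / l" for i
  define q where "q i = (if i < n then 1 / l else 0)" for i
  have "(\<Sum>i<m. (-1) ^ i * increment (i < n) (t - switch_time \<tau> i) (\<tau> i)) - martingale_part l m n t \<tau>
     = (\<Sum>i<m. (-1) ^ i * p i) - (\<Sum>i<m. (-1) ^ i * q i)"
    unfolding martingale_part_def increment_mean_def p_def q_def
    by (simp add: sum_subtractf[symmetric] right_diff_distrib)
  moreover have "0 \<le> (\<Sum>i<m. (-1) ^ i * p i) \<and> (\<Sum>i<m. (-1) ^ i * p i) \<le> p 0"
  proof (rule alternating_sum_bounds)
    show "decseq p" unfolding decseq_def p_def
    proof safe
      fix i j :: nat assume "i \<le> j"
      then have "switch_time \<tau> i \<le> switch_time \<tau> j" by (rule switch_time_mono[OF pos])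
      then have "l * max 0 (t - switch_time \<tau> j) \<le> l * max 0 (t - switch_time \<tau> i)" using l by (intro mult_left_mono) auto
      then show "(1 - exp (- l * max 0 (t - switch_time \<tau> j))) / l \<le> (1 - exp (- l * max 0 (t - switch_time \<tau> i))) / l"
        using l by (intro divide_right_mono) auto
    qed
    show "0 \<le> p i" for i using l by (simp add: p_def)
  qed
  moreover have "p 0 \<le> 1 / l" using l by (simp add: p_def divide_right_mono)
  moreover have "0 \<le> (\<Sum>i<m. (-1) ^ i * q i) \<and> (\<Sum>i<m. (-1) ^ i * q i) \<le> q 0"
    by (rule alternating_sum_bounds) (use l in \<open>auto simp: decseq_def q_def\<close>)
  moreover have "q 0 \<le> 1 / l" using l by (simp add: q_def)
  ultimately show ?thesis by linarith
qed

text \<open>The absolute increments are the lengths of the holding intervals lying between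
  \<open>t\<close> and the \<open>n\<close>-th switching time, so they add up to at most the
  distance of these two times.\<close>

lemma total_increment_le:
  assumes pos: "\<And>i. 0 < \<tau> i" and t: "0 \<le> t" and mn: "n \<le> m"
  shows "total_increment m n t \<tau> \<le> \<bar>switch_time \<tau> n - t\<bar>"
proof -
  have split: "(\<Sum>i<m. h i) = (\<Sum>i<n. h i) + (\<Sum>i\<in>{n..<m}. h i)" for h :: "nat \<Rightarrow> real"
    using sum.atLeastLessThan_concat[of 0 n m h] mn by (simp add: lessThan_atLeast0)
  have "\<bar>increment (i < n) (t - switch_time \<tau> i) (\<tau> i)\<bar> = (if i < n then \<tau> i - elapsed \<tau> t i else elapsed \<tau> t i)" for i
    using pos[of i] by (auto simp: increment_def elapsed_def min_def max_def)
  then have "total_increment m n t \<tau> = (\<Sum>i<m. if i < n then \<tau> i - elapsed \<tau> t i else elapsed \<tau> t i)"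
    by (simp add: total_increment_def)
  also have "\<dots> = (\<Sum>i<n. \<tau> i - elapsed \<tau> t i) + (\<Sum>i\<in>{n..<m}. elapsed \<tau> t i)"
    by (subst split) (auto intro!: arg_cong2[where f="(+)"] sum.cong)
  also have "(\<Sum>i\<in>{n..<m}. elapsed \<tau> t i) = (\<Sum>i<m. elapsed \<tau> t i) - (\<Sum>i<n. elapsed \<tau> t i)"
    using split[of "elapsed \<tau> t"] by simp
  also have "(\<Sum>i<n. \<tau> i - elapsed \<tau> t i) = switch_time \<tau> n - min t (switch_time \<tau> n)"
    using sum_elapsed[of \<tau> t n] pos t by (simp add: sum_subtractf switch_time_def)
  finally have "total_increment m n t \<tau> = switch_time \<tau> n - min t (switch_time \<tau> n) + (min t (switch_time \<tau> m) - min t (switch_time \<tau> n))"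
    using sum_elapsed[of \<tau> t n] sum_elapsed[of \<tau> t m] pos t by simp
  moreover have "switch_time \<tau> n \<le> switch_time \<tau> m" by (rule switch_time_mono[OF pos mn])
  ultimately show ?thesis by linarith
qed

section \<open>Fluctuations of the switching times and their effect on the position\<close>

lemma switch_time_moments:
  assumes l: "0 < l"
  shows "integrable (expo_seq l) (\<lambda>\<tau>. (switch_time \<tau> n - real n / l)\<^sup>2) \<and> integrable (expo_seq l) (\<lambda>\<tau>. switch_time \<tau> n) \<and>
    (\<integral>\<tau>. switch_time \<tau> n - real n / l \<partial>expo_seq l) = 0 \<and> (\<integral>\<tau>. (switch_time \<tau> n - real n / l)\<^sup>2 \<partial>expo_seq l) = real n / l\<^sup>2"
proof (induction n)
  case 0
  then show ?case by simp
next
  case (Suc n)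
  interpret E: prob_space "expo l" using l by (rule prob_space_expo)
  interpret S: prob_space "expo_seq l" using l by (rule prob_space_expo_seq)
  let ?S = "\<lambda>n \<tau>. switch_time \<tau> n - real n / l"
  have i1: "integrable (expo_seq l) (\<lambda>\<tau>. switch_time \<tau> n)" for n
  proof -
    have "integrable (expo_seq l) (\<lambda>\<tau>. \<tau> i)" for i using integrable_expo_seq_component(1)[OF l, of i] by (subst (asm) integrable_abs_iff) auto
    then show ?thesis unfolding switch_time_def by (intro Bochner_Integration.integrable_sum)
  qed
  have i2: "integrable (expo_seq l) (\<lambda>\<tau>. (?S n \<tau>)\<^sup>2)" for n
  proof -
    have "integrable (expo_seq l) (\<lambda>\<tau>. (switch_time \<tau> n)\<^sup>2)"
    proof (rule Bochner_Integration.integrable_bound)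
      show "integrable (expo_seq l) (\<lambda>\<tau>. real n * (\<Sum>i<n. (\<tau> i)\<^sup>2))"
        using integrable_expo_seq_component(2)[OF l] by (intro integrable_mult_right Bochner_Integration.integrable_sum)
      show "AE \<tau> in expo_seq l. norm ((switch_time \<tau> n)\<^sup>2) \<le> norm (real n * (\<Sum>i<n. (\<tau> i)\<^sup>2))"
        unfolding switch_time_def using sum_power2_le by (intro always_eventually allI) (simp add: sum_nonneg)
    qed measurable
    then show ?thesis unfolding power2_diff using i1 by (intro Bochner_Integration.integrable_add Bochner_Integration.integrable_diff) (auto simp: mult.assoc)
  qed
  have c: "?S (Suc n) (case_nat s \<omega>) = (s - 1 / l) + ?S n \<omega>" for s \<omega>
    by (simp add: switch_time_case_nat add_divide_distrib)
  have s1: "integrable (expo l) (\<lambda>s. s)" "(\<integral>s. s \<partial>expo l) = 1 / l"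
    and s2: "integrable (expo l) (\<lambda>s. s\<^sup>2)" "(\<integral>s. s\<^sup>2 \<partial>expo l) = 2 / l\<^sup>2"
    using expo_moment[OF l, of 1] expo_moment[OF l, of 2] by (auto simp: has_bochner_integral_iff)
  have iS: "integrable (expo_seq l) (?S n)" for n using i1 by simp
  have "(\<integral>\<tau>. ?S (Suc n) \<tau> \<partial>expo_seq l) = (\<integral>s. \<integral>\<omega>. (s - 1 / l) + ?S n \<omega> \<partial>expo_seq l \<partial>expo l)"
    unfolding integral_expo_seq(2)[OF l iS] c ..
  also have "\<dots> = (\<integral>s. s - 1 / l \<partial>expo l)"
    using Suc iS[of n] by (intro Bochner_Integration.integral_cong refl, subst Bochner_Integration.integral_add) (auto simp: S.prob_space[simplified])
  also have "\<dots> = 0" using s1 by (simp add: E.prob_space[simplified])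
  finally have m: "(\<integral>\<tau>. ?S (Suc n) \<tau> \<partial>expo_seq l) = 0" .
  have "(\<integral>\<tau>. (?S (Suc n) \<tau>)\<^sup>2 \<partial>expo_seq l) = (\<integral>s. \<integral>\<omega>. ((s - 1 / l) + ?S n \<omega>)\<^sup>2 \<partial>expo_seq l \<partial>expo l)"
    unfolding integral_expo_seq(2)[OF l i2] c ..
  also have "\<dots> = (\<integral>s. (s - 1 / l)\<^sup>2 + real n / l\<^sup>2 \<partial>expo l)"
  proof (intro Bochner_Integration.integral_cong refl)
    fix s
    have "((s - 1 / l) + ?S n \<omega>)\<^sup>2 = (s - 1 / l)\<^sup>2 + (?S n \<omega>)\<^sup>2 + 2 * (s - 1 / l) * ?S n \<omega>" for \<omega> by (rule power2_sum)
    then have "(\<integral>\<omega>. ((s - 1 / l) + ?S n \<omega>)\<^sup>2 \<partial>expo_seq l) = (\<integral>\<omega>. (s - 1 / l)\<^sup>2 \<partial>expo_seq l) + (\<integral>\<omega>. (?S n \<omega>)\<^sup>2 \<partial>expo_seq l) + (\<integral>\<omega>. 2 * (s - 1 / l) * ?S n \<omega> \<partial>expo_seq l)"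
      using i2[of n] iS[of n] by (simp only:) (subst Bochner_Integration.integral_add, auto intro!: integrable_mult_right Bochner_Integration.integral_add)
    also have "(\<integral>\<omega>. 2 * (s - 1 / l) * ?S n \<omega> \<partial>expo_seq l) = 2 * (s - 1 / l) * (\<integral>\<omega>. ?S n \<omega> \<partial>expo_seq l)"
      by (rule integral_mult_right_zero)
    also have "(\<integral>\<omega>. ?S n \<omega> \<partial>expo_seq l) = 0" using Suc by blast
    also have "(\<integral>\<omega>. (?S n \<omega>)\<^sup>2 \<partial>expo_seq l) = real n / l\<^sup>2" using Suc by blast
    finally show "(\<integral>\<omega>. ((s - 1 / l) + ?S n \<omega>)\<^sup>2 \<partial>expo_seq l) = (s - 1 / l)\<^sup>2 + real n / l\<^sup>2"
      by (simp add: S.prob_space[simplified])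
  qed
  also have "\<dots> = (\<integral>s. s\<^sup>2 - 2 / l * s + (1 / l\<^sup>2 + real n / l\<^sup>2) \<partial>expo l)"
    by (intro Bochner_Integration.integral_cong refl) (simp add: power2_diff power_divide)
  also have "\<dots> = 2 / l\<^sup>2 - 2 / l * (1 / l) + (1 / l\<^sup>2 + real n / l\<^sup>2)"
    using s1 s2 by (simp add: E.prob_space[simplified])
  also have "\<dots> = real (Suc n) / l\<^sup>2" by (simp add: power2_eq_square add_divide_distrib)
  finally show ?case using m i1 i2 by blast
qed

lemma switch_time_deviation:
  assumes l: "0 < l"
  shows "integrable (expo_seq l) (\<lambda>\<tau>. \<bar>switch_time \<tau> n - t\<bar>)"
    "(\<integral>\<tau>. \<bar>switch_time \<tau> n - t\<bar> \<partial>expo_seq l) \<le> sqrt (real n) / l + \<bar>real n / l - t\<bar>"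
proof -
  interpret S: prob_space "expo_seq l" using l by (rule prob_space_expo_seq)
  note m = switch_time_moments[OF l, of n]
  have i: "integrable (expo_seq l) (\<lambda>\<tau>. \<bar>switch_time \<tau> n - c\<bar>)" for c using m by (intro integrable_abs) simp
  show "integrable (expo_seq l) (\<lambda>\<tau>. \<bar>switch_time \<tau> n - t\<bar>)" by (rule i)
  have "(\<integral>\<tau>. \<bar>switch_time \<tau> n - t\<bar> \<partial>expo_seq l) \<le> (\<integral>\<tau>. \<bar>switch_time \<tau> n - real n / l\<bar> + \<bar>real n / l - t\<bar> \<partial>expo_seq l)"
    by (intro integral_mono i Bochner_Integration.integrable_add) auto
  also have "\<dots> = (\<integral>\<tau>. \<bar>(switch_time \<tau> n - real n / l) * 1\<bar> \<partial>expo_seq l) + \<bar>real n / l - t\<bar>"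
    using i by (simp add: S.prob_space[simplified])
  also have "(\<integral>\<tau>. \<bar>(switch_time \<tau> n - real n / l) * 1\<bar> \<partial>expo_seq l) \<le> sqrt (\<integral>\<tau>. (switch_time \<tau> n - real n / l)\<^sup>2 \<partial>expo_seq l) * sqrt (\<integral>\<tau>. 1\<^sup>2 \<partial>expo_seq l)"
    using m by (intro Cauchy_Schwarz_integral) auto
  also have "\<dots> = sqrt (real n) / l"
    using m l by (simp add: S.prob_space[simplified] real_sqrt_divide)
  finally show "(\<integral>\<tau>. \<bar>switch_time \<tau> n - t\<bar> \<partial>expo_seq l) \<le> sqrt (real n) / l + \<bar>real n / l - t\<bar>" by simp
qed

text \<open>The telegraph counterpart of the second moment of a Brownian increment: the squared
  deviation is of the order of the time deviation, not of its square. Splitting into martingale part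
  and compensator costs a factor 2, which gives 2 times \<open>2 / l\<close> and 2 times the square
  of \<open>1 / l\<close>. The number of steps is finally sent to infinity by Fatou's lemma.\<close>

lemma tele_switch_deviation:
  assumes l: "0 < l" and t: "0 \<le> t"
  shows "(\<integral>\<^sup>+\<tau>. ennreal ((tele \<tau> t - (\<Sum>i<n. (-1) ^ i * \<tau> i))\<^sup>2) \<partial>expo_seq l) \<le>
    ennreal (4 / l * (sqrt (real n) / l + \<bar>real n / l - t\<bar>) + 2 / l\<^sup>2)"
proof -
  interpret S: prob_space "expo_seq l" using l by (rule prob_space_expo_seq)
  let ?D = "\<lambda>m \<tau>. (\<Sum>i<m. (-1) ^ i * increment (i < n) (t - switch_time \<tau> i) (\<tau> i))"
  have mD [measurable]: "?D m \<in> borel_measurable seq_borel" for m unfolding increment_def by measurable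
  note int = integrable_martingale_part[OF l]
  have b: "(\<integral>\<^sup>+\<tau>. ennreal ((?D m \<tau>)\<^sup>2) \<partial>expo_seq l) \<le> ennreal (4 / l * (sqrt (real n) / l + \<bar>real n / l - t\<bar>) + 2 / l\<^sup>2)" if "n \<le> m" for m
  proof -
    have "(\<integral>\<^sup>+\<tau>. ennreal ((?D m \<tau>)\<^sup>2) \<partial>expo_seq l) \<le> (\<integral>\<^sup>+\<tau>. ennreal (2 * (martingale_part l m n t \<tau>)\<^sup>2 + 2 / l\<^sup>2) \<partial>expo_seq l)"
      using AE_expo_seq_pos[OF l]
    proof (intro nn_integral_mono_AE, eventually_elim)
      case (elim \<tau>)
      let ?M = "martingale_part l m n t \<tau>"
      have c: "\<bar>?D m \<tau> - ?M\<bar> \<le> 1 / l" using elim by (intro martingale_part_close l) auto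
      then have "(?D m \<tau> - ?M)\<^sup>2 \<le> (1 / l)\<^sup>2" using l by (simp add: abs_le_square_iff[symmetric])
      moreover have "(?D m \<tau>)\<^sup>2 \<le> 2 * ?M\<^sup>2 + 2 * (?D m \<tau> - ?M)\<^sup>2"
        using sum_squares_bound[of "?M" "?D m \<tau> - ?M"] power2_sum[of "?M" "?D m \<tau> - ?M"] by simp
      ultimately show ?case by (intro ennreal_leI) (simp add: power_divide)
    qed
    also have "\<dots> = ennreal (\<integral>\<tau>. 2 * (martingale_part l m n t \<tau>)\<^sup>2 + 2 / l\<^sup>2 \<partial>expo_seq l)"
      using int by (intro nn_integral_eq_integral) auto
    also have "(\<integral>\<tau>. 2 * (martingale_part l m n t \<tau>)\<^sup>2 + 2 / l\<^sup>2 \<partial>expo_seq l) = 2 * (\<integral>\<tau>. (martingale_part l m n t \<tau>)\<^sup>2 \<partial>expo_seq l) + 2 / l\<^sup>2"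
      using int by (simp add: S.prob_space[simplified])
    also have "\<dots> \<le> 2 * (2 / l * (\<integral>\<tau>. total_increment m n t \<tau> \<partial>expo_seq l)) + 2 / l\<^sup>2"
      using martingale_part_moments[OF l, of m n t] by simp
    also have "\<dots> \<le> 2 * (2 / l * (\<integral>\<tau>. \<bar>switch_time \<tau> n - t\<bar> \<partial>expo_seq l)) + 2 / l\<^sup>2"
    proof -
      have "(\<integral>\<tau>. total_increment m n t \<tau> \<partial>expo_seq l) \<le> (\<integral>\<tau>. \<bar>switch_time \<tau> n - t\<bar> \<partial>expo_seq l)"
      proof (rule integral_mono_AE[OF int(3) switch_time_deviation(1)[OF l]])
        show "AE \<tau> in expo_seq l. total_increment m n t \<tau> \<le> \<bar>switch_time \<tau> n - t\<bar>"
          using AE_expo_seq_pos[OF l] by eventually_elim (intro total_increment_le t that, auto)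
      qed
      then show ?thesis using l by (intro add_right_mono mult_left_mono) auto
    qed
    also have "\<dots> \<le> 2 * (2 / l * (sqrt (real n) / l + \<bar>real n / l - t\<bar>)) + 2 / l\<^sup>2"
      using switch_time_deviation(2)[OF l, of n t] l by (intro add_right_mono mult_left_mono) auto
    finally show ?thesis by (simp add: ennreal_leI)
  qed
  have "(\<integral>\<^sup>+\<tau>. ennreal ((tele \<tau> t - (\<Sum>i<n. (-1) ^ i * \<tau> i))\<^sup>2) \<partial>expo_seq l) \<le> (\<integral>\<^sup>+\<tau>. liminf (\<lambda>m. ennreal ((?D m \<tau>)\<^sup>2)) \<partial>expo_seq l)"
  proof (rule nn_integral_mono_AE)
    show "AE \<tau> in expo_seq l. ennreal ((tele \<tau> t - (\<Sum>i<n. (-1) ^ i * \<tau> i))\<^sup>2) \<le> liminf (\<lambda>m. ennreal ((?D m \<tau>)\<^sup>2))"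
      using AE_admissible[OF l]
    proof eventually_elim
      case (elim \<tau>)
      note pos = admissible_pos[OF elim]
      obtain k where k: "t < switch_time \<tau> k" using admissible_exceeds[OF elim] by blast
      \<comment> \<open>Once \<open>m\<close> exceeds both \<open>n\<close> and the number of
        switches before \<open>t\<close>, the finite sum is the exact deviation.\<close>
      have "eventually (\<lambda>m. ennreal ((?D m \<tau>)\<^sup>2) = ennreal ((tele \<tau> t - (\<Sum>i<n. (-1) ^ i * \<tau> i))\<^sup>2)) sequentially"
        using eventually_ge_at_top[of "max k n"]
      proof eventually_elim
        case (elim m)
        have "switch_time \<tau> k \<le> switch_time \<tau> m" using elim by (intro switch_time_mono pos) auto
        with k have "tele \<tau> t = (\<Sum>i<m. (-1) ^ i * elapsed \<tau> t i)" by (intro tele_eq_sum \<open>admissible \<tau>\<close>) auto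
        moreover have "(\<Sum>i<n. (-1) ^ i * \<tau> i) = (\<Sum>i<m. (-1) ^ i * (if i < n then \<tau> i else 0))"
          using elim by (intro sum.mono_neutral_cong_left) auto
        ultimately have "?D m \<tau> = tele \<tau> t - (\<Sum>i<n. (-1) ^ i * \<tau> i)"
          by (simp only: sum_subtractf[symmetric] right_diff_distrib[symmetric] increment_def elapsed_def)
        then show ?case by simp
      qed
      then have "(\<lambda>m. ennreal ((?D m \<tau>)\<^sup>2)) \<longlonglongrightarrow> ennreal ((tele \<tau> t - (\<Sum>i<n. (-1) ^ i * \<tau> i))\<^sup>2)" by (rule tendsto_eventually)
      then have "liminf (\<lambda>m. ennreal ((?D m \<tau>)\<^sup>2)) = ennreal ((tele \<tau> t - (\<Sum>i<n. (-1) ^ i * \<tau> i))\<^sup>2)" by (intro lim_imp_Liminf) auto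
      then show ?case by simp
    qed
  qed
  also have "\<dots> \<le> liminf (\<lambda>m. \<integral>\<^sup>+\<tau>. ennreal ((?D m \<tau>)\<^sup>2) \<partial>expo_seq l)"
    by (rule nn_integral_liminf) measurable
  also have "\<dots> \<le> liminf (\<lambda>m. ennreal (4 / l * (sqrt (real n) / l + \<bar>real n / l - t\<bar>) + 2 / l\<^sup>2))"
    by (rule Liminf_mono) (use b in \<open>auto simp: eventually_sequentially\<close>)
  finally show ?thesis by (simp add: Liminf_const)
qed

section \<open>Gaussian mixtures and pairs of holding times\<close>

definition laplace :: "real \<Rightarrow> real measure" where
  "laplace l = density lborel (\<lambda>x. ennreal (l / 2 * exp (- l * \<bar>x\<bar>)))"

text \<open>By Brownian scaling, the value at an exponential time of rate \<open>l / 2\<close> of a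
  Brownian motion with diffusivity \<open>1 / l\<close>.\<close>

definition gauss_mixture :: "real \<Rightarrow> real measure" where
  "gauss_mixture l = distr (expo (l / 2) \<Otimes>\<^sub>M std_normal_distribution) borel (\<lambda>p. sqrt (fst p / l) * snd p)"

section \<open>Identification of the mixture by characteristic functions\<close>

lemma has_bochner_integral_cos_exp:
  fixes l t :: real
  assumes l: "0 < l"
  shows "has_bochner_integral lborel (\<lambda>x::real. indicator {0..} x *\<^sub>R (cos (t * x) * exp (- l * x))) (l / (l\<^sup>2 + t\<^sup>2))"
proof -
  let ?f = "\<lambda>x. cos (t * x) * exp (- l * x)"
  \<comment> \<open>The real part of the primitive of the complex exponential with exponent (-l + i
    t) x.\<close>
  let ?F = "\<lambda>x. exp (- l * x) * (t * sin (t * x) - l * cos (t * x)) / (l\<^sup>2 + t\<^sup>2)"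
  have "0 < l\<^sup>2 + t\<^sup>2" using l by (intro add_pos_nonneg) auto
  then have nz: "l\<^sup>2 + t\<^sup>2 \<noteq> 0" by (rule less_imp_neq[THEN not_sym])
  interpret E: prob_space "expo l" using l by (rule prob_space_expo)
  have int: "integrable lborel (\<lambda>x. indicator {0..} x *\<^sub>R ?f x)"
  proof (rule Bochner_Integration.integrable_bound)
    have "has_bochner_integral lborel (\<lambda>s. exponential_density l s * 1) 1"
      using expo_moment[OF l, of 0] by (subst (asm) has_bochner_integral_expo[OF l]) auto
    then show "integrable lborel (\<lambda>s. 1 / l * (exponential_density l s * 1))"
      by (intro integrable_mult_right) (simp add: has_bochner_integral_iff)
    show "AE x in lborel. norm (indicator {0..} x *\<^sub>R ?f x) \<le> norm (1 / l * (exponential_density l x * 1))"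
    proof (intro always_eventually allI)
      fix x
      have "\<bar>cos (t * x)\<bar> * exp (- l * x) \<le> 1 * exp (- l * x)" by (intro mult_right_mono) auto
      then show "norm (indicator {0..} x *\<^sub>R ?f x) \<le> norm (1 / l * (exponential_density l x * 1))"
        using l by (auto simp: exponential_density_def abs_mult mult.commute split: split_indicator)
    qed
  qed measurable
  have "((\<lambda>b. \<integral>x. indicator {..b} x *\<^sub>R (indicator {0..} x *\<^sub>R ?f x) \<partial>lborel) \<longlongrightarrow> (\<integral>x. indicator {0..} x *\<^sub>R ?f x \<partial>lborel)) at_top"
    by (rule tendsto_integral_at_top) (use int in auto)
  moreover have "((\<lambda>b. \<integral>x. indicator {..b} x *\<^sub>R (indicator {0..} x *\<^sub>R ?f x) \<partial>lborel) \<longlongrightarrow> 0 - ?F 0) at_top"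
  proof (rule Lim_transform_eventually)
    have F0: "(?F \<longlongrightarrow> 0) at_top"
    proof (rule Lim_null_comparison)
      show "\<forall>\<^sub>F x in at_top. norm (?F x) \<le> exp (- l * x) * ((\<bar>t\<bar> + l) / (l\<^sup>2 + t\<^sup>2))"
      proof (intro always_eventually allI)
        fix x
        have "\<bar>t * sin (t * x)\<bar> \<le> \<bar>t\<bar> * 1" unfolding abs_mult by (intro mult_left_mono) auto
        moreover have "\<bar>l * cos (t * x)\<bar> \<le> l * 1" using l unfolding abs_mult by (intro mult_mono) auto
        ultimately have "\<bar>t * sin (t * x) - l * cos (t * x)\<bar> \<le> \<bar>t\<bar> + l" by linarith
        then have "exp (- l * x) * \<bar>t * sin (t * x) - l * cos (t * x)\<bar> / (l\<^sup>2 + t\<^sup>2) \<le> exp (- l * x) * (\<bar>t\<bar> + l) / (l\<^sup>2 + t\<^sup>2)"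
          by (intro divide_right_mono mult_left_mono) auto
        then show "norm (?F x) \<le> exp (- l * x) * ((\<bar>t\<bar> + l) / (l\<^sup>2 + t\<^sup>2))" by (simp add: abs_mult)
      qed
      have "((\<lambda>x. exp (- l * x)) \<longlongrightarrow> 0) at_top" using l by real_asymp
      then show "((\<lambda>x. exp (- l * x) * ((\<bar>t\<bar> + l) / (l\<^sup>2 + t\<^sup>2))) \<longlongrightarrow> 0) at_top"
        by (rule tendsto_mult_left_zero)
    qed
    show "((\<lambda>b. ?F b - ?F 0) \<longlongrightarrow> 0 - ?F 0) at_top" by (intro tendsto_diff F0 tendsto_const)
    show "\<forall>\<^sub>F b in at_top. ?F b - ?F 0 = (\<integral>x. indicator {..b} x *\<^sub>R (indicator {0..} x *\<^sub>R ?f x) \<partial>lborel)"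
      using eventually_ge_at_top[of 0]
    proof eventually_elim
      case (elim b)
      have "(\<integral>x. ?f x * indicator {0..b} x \<partial>lborel) = ?F b - ?F 0"
      proof (rule integral_FTC_Icc_real[OF elim])
        fix x
        have "(?F has_real_derivative ((- l * exp (- l * x)) * (t * sin (t * x) - l * cos (t * x)) + exp (- l * x) * (t * (t * cos (t * x)) + l * (t * sin (t * x)))) / (l\<^sup>2 + t\<^sup>2)) (at x)"
          by (rule DERIV_cdivide) (auto intro!: derivative_eq_intros simp: algebra_simps)
        moreover have "((- l * exp (- l * x)) * (t * sin (t * x) - l * cos (t * x)) + exp (- l * x) * (t * (t * cos (t * x)) + l * (t * sin (t * x)))) / (l\<^sup>2 + t\<^sup>2) = ?f x"
        proof -
          have "(- l * exp (- l * x)) * (t * sin (t * x) - l * cos (t * x)) + exp (- l * x) * (t * (t * cos (t * x)) + l * (t * sin (t * x))) = ?f x * (l\<^sup>2 + t\<^sup>2)"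
            by (simp add: algebra_simps power2_eq_square)
          then show ?thesis using nz by simp
        qed
        ultimately show "(?F has_real_derivative ?f x) (at x)" by simp
      qed (auto intro!: continuous_intros)
      moreover have "(\<integral>x. indicator {..b} x *\<^sub>R (indicator {0..} x *\<^sub>R ?f x) \<partial>lborel) = (\<integral>x. ?f x * indicator {0..b} x \<partial>lborel)"
        by (intro Bochner_Integration.integral_cong refl) (auto split: split_indicator)
      ultimately show ?case by simp
    qed
  qed
  ultimately have "(\<integral>x. indicator {0..} x *\<^sub>R ?f x \<partial>lborel) = 0 - ?F 0"
    by (rule tendsto_unique[OF trivial_limit_at_top_linorder])
  with int show ?thesis by (simp add: has_bochner_integral_iff)
qed

lemma laplace_cos_integral:
  fixes l t :: real
  assumes l: "0 < l"
  shows "has_bochner_integral lborel (\<lambda>x::real. l / 2 * exp (- l * \<bar>x\<bar>) * cos (t * x)) (l\<^sup>2 / (l\<^sup>2 + t\<^sup>2))"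
proof -
  have "has_bochner_integral lborel (\<lambda>x::real. indicator {0..} x *\<^sub>R (cos (t * x) * exp (- l * \<bar>x\<bar>))) (l / (l\<^sup>2 + t\<^sup>2))"
    using has_bochner_integral_cos_exp[OF l, of t]
    by (rule has_bochner_integral_cong[THEN iffD1, rotated -1]) (auto simp: abs_of_nonneg indicator_def)
  then have "has_bochner_integral lborel (\<lambda>x. cos (t * x) * exp (- l * \<bar>x\<bar>)) (2 *\<^sub>R (l / (l\<^sup>2 + t\<^sup>2)))"
    by (rule has_bochner_integral_even_function) simp
  then have "has_bochner_integral lborel (\<lambda>x. l / 2 * (cos (t * x) * exp (- l * \<bar>x\<bar>))) (l / 2 * (2 *\<^sub>R (l / (l\<^sup>2 + t\<^sup>2))))"
    by (rule has_bochner_integral_mult_right)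
  then show ?thesis by (simp add: power2_eq_square mult_ac)
qed

lemma prob_space_laplace: 
  assumes l: "0 < l"
  shows "prob_space (laplace l)"
proof
  have "has_bochner_integral lborel (\<lambda>x. l / 2 * exp (- l * \<bar>x\<bar>)) 1" using laplace_cos_integral[OF l, of 0] l by simp
  then have "(\<integral>\<^sup>+x. ennreal (l / 2 * exp (- l * \<bar>x\<bar>)) \<partial>lborel) = 1"
    using l by (subst nn_integral_eq_integral) (auto simp: has_bochner_integral_iff)
  then show "emeasure (laplace l) (space (laplace l)) = 1"
    unfolding laplace_def by (subst emeasure_density) auto
qed

lemma char_laplace:
  assumes l: "0 < l"
  shows "char (laplace l) t = complex_of_real (l\<^sup>2 / (l\<^sup>2 + t\<^sup>2))"
proof -
  interpret prob_space "laplace l" using l by (rule prob_space_laplace)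
  have sets [measurable_cong]: "sets (laplace l) = sets borel" by (simp add: laplace_def)
  have c: "(\<integral>x. cos (t * x) \<partial>laplace l) = l\<^sup>2 / (l\<^sup>2 + t\<^sup>2)"
  proof -
    have "(\<integral>x. cos (t * x) \<partial>laplace l) = (\<integral>x. l / 2 * exp (- l * \<bar>x\<bar>) * cos (t * x) \<partial>lborel)"
      unfolding laplace_def using l by (subst integral_density) auto
    also have "\<dots> = l\<^sup>2 / (l\<^sup>2 + t\<^sup>2)"
      by (rule has_bochner_integral_integral_eq[OF laplace_cos_integral[OF l]])
    finally show ?thesis .
  qed
  \<comment> \<open>Reflection at the origin: the density is even and the sine odd, so the imaginary
    part of the characteristic function vanishes.\<close>
  have "(\<integral>x. l / 2 * exp (- l * \<bar>x\<bar>) * sin (t * x) \<partial>lborel) = (\<integral>x. - (l / 2 * exp (- l * \<bar>x\<bar>) * sin (t * x)) \<partial>lborel)"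
    by (subst lborel_integral_real_affine[where c="-1" and t=0]) auto
  then have s0: "(\<integral>x. l / 2 * exp (- l * \<bar>x\<bar>) * sin (t * x) \<partial>lborel) = 0" by simp
  have s: "(\<integral>x. sin (t * x) \<partial>laplace l) = 0"
    unfolding laplace_def using s0 l by (subst integral_density) auto
  have i: "integrable (laplace l) (\<lambda>x. cos (t * x))" "integrable (laplace l) (\<lambda>x. sin (t * x))"
    by (auto intro!: integrable_const_bound[of _ 1])
  have "char (laplace l) t = (\<integral>x. complex_of_real (cos (t * x)) + \<i> * complex_of_real (sin (t * x)) \<partial>laplace l)"
    unfolding char_def by (intro Bochner_Integration.integral_cong refl) (simp only: exp_Euler cos_of_real sin_of_real)
  also have "\<dots> = complex_of_real (\<integral>x. cos (t * x) \<partial>laplace l) + \<i> * complex_of_real (\<integral>x. sin (t * x) \<partial>laplace l)"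
    using i by (simp only: Bochner_Integration.integral_add integrable_of_real integrable_mult_right integral_of_real integral_mult_right_zero)
  finally show ?thesis by (simp add: c s)
qed

text \<open>Given the exponential time \<xi>, the Gaussian characteristic function is exp(-t^2 \<xi>
  / (2 l)). The claim is then the Laplace transform of the exponential law of rate l/2 at t^2 / (2
  l).\<close>

lemma char_gauss_mixture:
  assumes l: "0 < l"
  shows "char (gauss_mixture l) t = complex_of_real (l\<^sup>2 / (l\<^sup>2 + t\<^sup>2))"
proof -
  interpret E: prob_space "expo (l / 2)" using l by (intro prob_space_expo) simp
  interpret G: prob_space std_normal_distribution by (intro prob_space_normal_density) simp
  interpret P: pair_prob_space "expo (l / 2)" std_normal_distribution ..
  let ?g = "\<lambda>p. iexp (t * (sqrt (fst p / l) * snd p))"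
  have cs: "(\<integral>z. iexp (s * z) \<partial>std_normal_distribution) = complex_of_real (exp (- (s\<^sup>2) / 2))" for s
    using fun_cong[OF char_std_normal_distribution, of s] unfolding char_def .
  have i: "integrable (expo (l / 2) \<Otimes>\<^sub>M std_normal_distribution) ?g"
    by (intro P.integrable_const_bound[of _ 1]) (auto simp: norm_exp_eq_Re)
  have "char (gauss_mixture l) t = (\<integral>p. ?g p \<partial>(expo (l / 2) \<Otimes>\<^sub>M std_normal_distribution))"
    unfolding char_def gauss_mixture_def by (subst integral_distr) auto
  also have "\<dots> = (\<integral>\<xi>. \<integral>z. iexp ((t * sqrt (\<xi> / l)) * z) \<partial>std_normal_distribution \<partial>expo (l / 2))"
    by (subst P.integral_fst'[OF i, symmetric]) (simp add: mult.assoc)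
  also have "\<dots> = (\<integral>\<xi>. complex_of_real (exp (- ((t * sqrt (\<xi> / l))\<^sup>2) / 2)) \<partial>expo (l / 2))"
    by (simp only: cs)
  also have "\<dots> = complex_of_real (\<integral>\<xi>. exp (- ((t * sqrt (\<xi> / l))\<^sup>2) / 2) \<partial>expo (l / 2))"
    by (rule integral_complex_of_real)
  also have "(\<integral>\<xi>. exp (- ((t * sqrt (\<xi> / l))\<^sup>2) / 2) \<partial>expo (l / 2)) = (\<integral>\<xi>. exp (- (t\<^sup>2 / (2 * l) * \<xi>)) \<partial>expo (l / 2))"
  proof (rule integral_cong_AE)
    have "0 < l / 2" using l by simp
    from AE_expo_pos[OF this] show "AE \<xi> in expo (l / 2). exp (- ((t * sqrt (\<xi> / l))\<^sup>2) / 2) = exp (- (t\<^sup>2 / (2 * l) * \<xi>))"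
      by eventually_elim (use l in \<open>simp add: power_mult_distrib field_simps\<close>)
  qed auto
  also have "\<dots> = enn2real (\<integral>\<^sup>+\<xi>. ennreal (exp (- (t\<^sup>2 / (2 * l) * \<xi>))) \<partial>expo (l / 2))"
    by (rule integral_eq_nn_integral) auto
  also have "\<dots> = (l / 2) / (l / 2 + t\<^sup>2 / (2 * l))"
    using l by (subst nn_integral_exp_expo) auto
  also have "\<dots> = l\<^sup>2 / (l\<^sup>2 + t\<^sup>2)"
    using l by (simp add: field_simps power2_eq_square)
  finally show ?thesis .
qed

lemma gauss_mixture_eq_laplace:
  assumes l: "0 < l"
  shows "gauss_mixture l = laplace l"
proof (rule Levy_uniqueness)
  interpret E: prob_space "expo (l / 2)" using l by (intro prob_space_expo) simp
  interpret G: prob_space std_normal_distribution by (intro prob_space_normal_density) simp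
  interpret P: pair_prob_space "expo (l / 2)" std_normal_distribution ..
  have "prob_space (gauss_mixture l)" unfolding gauss_mixture_def by (rule P.prob_space_distr) measurable
  then show "real_distribution (gauss_mixture l)"
    by (auto simp: real_distribution_def real_distribution_axioms_def gauss_mixture_def)
  show "real_distribution (laplace l)"
    using prob_space_laplace[OF l] by (auto simp: real_distribution_def real_distribution_axioms_def laplace_def)
  show "char (gauss_mixture l) = char (laplace l)"
    by (intro ext) (simp add: char_laplace[OF l] char_gauss_mixture[OF l])
qed

lemma nn_integral_std_normal_scale:
  assumes c: "0 < c" and [measurable]: "h \<in> borel_measurable borel"
  shows "(\<integral>\<^sup>+z. h (c * z) \<partial>std_normal_distribution) = (\<integral>\<^sup>+x. ennreal (normal_density 0 c x) * h x \<partial>lborel)"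
proof -
  have "(\<integral>\<^sup>+x. ennreal (normal_density 0 c x) * h x \<partial>lborel) = ennreal c * (\<integral>\<^sup>+z. ennreal (normal_density 0 c (c * z)) * h (c * z) \<partial>lborel)"
    using c by (subst nn_integral_real_affine[where c=c and t=0]) auto
  also have "\<dots> = (\<integral>\<^sup>+z. ennreal (std_normal_density z) * h (c * z) \<partial>lborel)"
  proof (subst nn_integral_cmult[symmetric])
    have "c * normal_density 0 c (c * z) = std_normal_density z" for z
      using c by (simp add: normal_density_def real_sqrt_mult power_mult_distrib)
    then show "(\<integral>\<^sup>+z. ennreal c * (ennreal (normal_density 0 c (c * z)) * h (c * z)) \<partial>lborel) = (\<integral>\<^sup>+z. ennreal (std_normal_density z) * h (c * z) \<partial>lborel)"
      using c by (intro nn_integral_cong) (simp add: mult.assoc[symmetric] flip: ennreal_mult)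
  qed measurable
  also have "\<dots> = (\<integral>\<^sup>+z. h (c * z) \<partial>std_normal_distribution)"
    by (subst nn_integral_density) auto
  finally show ?thesis by simp
qed

text \<open>A Brownian motion stopped at an independent exponential time has a Laplace distribution.\<close>

lemma gaussian_exponential_mixture:
  assumes l: "0 < l" and [measurable]: "h \<in> borel_measurable borel"
  shows "(\<integral>\<^sup>+\<xi>. \<integral>\<^sup>+x. ennreal (normal_density 0 (sqrt (\<xi> / l)) x) * h x \<partial>lborel \<partial>expo (l / 2)) =
    (\<integral>\<^sup>+x. ennreal (l / 2 * exp (- l * \<bar>x\<bar>)) * h x \<partial>lborel)"
proof -
  have l2: "0 < l / 2" using l by simp
  interpret G: prob_space std_normal_distribution by (intro prob_space_normal_density) simp
  have "(\<integral>\<^sup>+x. ennreal (l / 2 * exp (- l * \<bar>x\<bar>)) * h x \<partial>lborel) = (\<integral>\<^sup>+x. h x \<partial>laplace l)"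
    unfolding laplace_def by (subst nn_integral_density) auto
  also have "\<dots> = (\<integral>\<^sup>+p. h (sqrt (fst p / l) * snd p) \<partial>(expo (l / 2) \<Otimes>\<^sub>M std_normal_distribution))"
    unfolding gauss_mixture_eq_laplace[OF l, symmetric] gauss_mixture_def by (subst nn_integral_distr) auto
  also have "\<dots> = (\<integral>\<^sup>+\<xi>. \<integral>\<^sup>+z. h (sqrt (\<xi> / l) * z) \<partial>std_normal_distribution \<partial>expo (l / 2))"
    by (subst G.nn_integral_fst[symmetric]) auto
  also have "\<dots> = (\<integral>\<^sup>+\<xi>. \<integral>\<^sup>+x. ennreal (normal_density 0 (sqrt (\<xi> / l)) x) * h x \<partial>lborel \<partial>expo (l / 2))"
    using AE_expo_pos[OF l2] by (intro nn_integral_cong_AE, eventually_elim) (use l in \<open>simp add: nn_integral_std_normal_scale\<close>)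
  finally show ?thesis by simp
qed

text \<open>
  Two independent exponential holding times \<open>p\<close>, \<open>q\<close> are recovered from their difference, which
  is Laplace distributed, and their minimum, which is independent of it.
\<close>

lemma laplace_minimum:
  assumes l: "0 < l" and [measurable]: "h \<in> borel_measurable (borel \<Otimes>\<^sub>M borel)"
  shows "(\<integral>\<^sup>+m. \<integral>\<^sup>+x. ennreal (l / 2 * exp (- l * \<bar>x\<bar>)) * h (m + max x 0, m + max (- x) 0) \<partial>lborel \<partial>expo (2 * l)) =
    (\<integral>\<^sup>+p. \<integral>\<^sup>+q. h (p, q) \<partial>expo l \<partial>expo l)"
proof -
  let ?e = "\<lambda>p q. ennreal (exponential_density l p) * ennreal (exponential_density l q)"
  let ?E = "exponential_density (2 * l)"
  have 1: "(\<integral>\<^sup>+x. ennreal (?E m) * (ennreal (l / 2 * exp (- l * \<bar>x\<bar>)) * h (m + max x 0, m + max (- x) 0)) \<partial>lborel) =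
    (\<integral>\<^sup>+p. ?e p m * h (p, m) * indicator {m<..} p \<partial>lborel) + (\<integral>\<^sup>+q. ?e m q * h (m, q) * indicator {m..} q \<partial>lborel)" for m
  proof -
    \<comment> \<open>The two pieces distinguish which of the two times is the larger one. Strict
      inequality in one and weak inequality in the other ensure that the diagonal is counted exactly
      once.\<close>
    let ?A = "\<lambda>x. ?e (m + x) m * h (m + x, m) * indicator {m<..} (m + x)"
    let ?B = "\<lambda>x. ?e m (m - x) * h (m, m - x) * indicator {m..} (m - x)"
    have "(\<integral>\<^sup>+x. ennreal (?E m) * (ennreal (l / 2 * exp (- l * \<bar>x\<bar>)) * h (m + max x 0, m + max (- x) 0)) \<partial>lborel) = (\<integral>\<^sup>+x. ?A x + ?B x \<partial>lborel)"
    proof (intro nn_integral_cong)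
      fix x
      \<comment> \<open>The exponents match because 2 m + \<bar>x\<bar> is the sum of m plus the
        positive part and m plus the negative part of x; the prefactors match because 2 l times l /
        2 is l^2.\<close>
      have e: "?E m * (l / 2 * exp (- l * \<bar>x\<bar>)) = exponential_density l (m + max x 0) * exponential_density l (m + max (- x) 0)"
      proof (cases "m < 0")
        case True
        then show ?thesis by (auto simp: exponential_density_def max_def)
      next
        case False
        then show ?thesis by (auto simp: exponential_density_def max_def mult_exp_exp algebra_simps)
      qed
      have "ennreal (?E m) * (ennreal (l / 2 * exp (- l * \<bar>x\<bar>)) * h (m + max x 0, m + max (- x) 0)) =
        ennreal (?E m * (l / 2 * exp (- l * \<bar>x\<bar>))) * h (m + max x 0, m + max (- x) 0)"
        using l by (subst ennreal_mult) (auto simp: exponential_density_nonneg mult.assoc)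
      also have "\<dots> = ?e (m + max x 0) (m + max (- x) 0) * h (m + max x 0, m + max (- x) 0)"
        unfolding e using l by (simp add: ennreal_mult exponential_density_nonneg)
      also have "\<dots> = ?A x + ?B x" by (cases "0 < x") (auto simp: max_def)
      finally show "ennreal (?E m) * (ennreal (l / 2 * exp (- l * \<bar>x\<bar>)) * h (m + max x 0, m + max (- x) 0)) = ?A x + ?B x" .
    qed
    also have "\<dots> = (\<integral>\<^sup>+x. ?A x \<partial>lborel) + (\<integral>\<^sup>+x. ?B x \<partial>lborel)"
      by (rule nn_integral_add) measurable
    also have "(\<integral>\<^sup>+x. ?A x \<partial>lborel) = (\<integral>\<^sup>+p. ?e p m * h (p, m) * indicator {m<..} p \<partial>lborel)"
      by (subst (2) nn_integral_real_affine[where c=1 and t=m]) auto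
    also have "(\<integral>\<^sup>+x. ?B x \<partial>lborel) = (\<integral>\<^sup>+q. ?e m q * h (m, q) * indicator {m..} q \<partial>lborel)"
      by (subst (2) nn_integral_real_affine[where c="-1" and t=m]) auto
    finally show ?thesis .
  qed
  have "(\<integral>\<^sup>+m. \<integral>\<^sup>+x. ennreal (l / 2 * exp (- l * \<bar>x\<bar>)) * h (m + max x 0, m + max (- x) 0) \<partial>lborel \<partial>expo (2 * l)) =
    (\<integral>\<^sup>+m. \<integral>\<^sup>+x. ennreal (?E m) * (ennreal (l / 2 * exp (- l * \<bar>x\<bar>)) * h (m + max x 0, m + max (- x) 0)) \<partial>lborel \<partial>lborel)"
    by (subst nn_integral_expo) (auto simp: nn_integral_cmult)
  also have "\<dots> = (\<integral>\<^sup>+m. \<integral>\<^sup>+p. ?e p m * h (p, m) * indicator {m<..} p \<partial>lborel \<partial>lborel) + (\<integral>\<^sup>+m. \<integral>\<^sup>+q. ?e m q * h (m, q) * indicator {m..} q \<partial>lborel \<partial>lborel)"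
    unfolding 1 by (rule nn_integral_add) (simp_all add: greaterThan_def atLeast_def)
  also have "(\<integral>\<^sup>+m. \<integral>\<^sup>+p. ?e p m * h (p, m) * indicator {m<..} p \<partial>lborel \<partial>lborel) = (\<integral>\<^sup>+p. \<integral>\<^sup>+m. ?e p m * h (p, m) * indicator {m<..} p \<partial>lborel \<partial>lborel)"
    by (rule lborel_pair.Fubini') (simp add: split_beta' greaterThan_def)
  also have "\<dots> + (\<integral>\<^sup>+m. \<integral>\<^sup>+q. ?e m q * h (m, q) * indicator {m..} q \<partial>lborel \<partial>lborel) =
    (\<integral>\<^sup>+p. (\<integral>\<^sup>+q. ?e p q * h (p, q) * indicator {q<..} p \<partial>lborel) + (\<integral>\<^sup>+q. ?e p q * h (p, q) * indicator {p..} q \<partial>lborel) \<partial>lborel)"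
    by (rule nn_integral_add[symmetric]) (simp_all add: greaterThan_def atLeast_def)
  also have "\<dots> = (\<integral>\<^sup>+p. \<integral>\<^sup>+q. ?e p q * h (p, q) \<partial>lborel \<partial>lborel)"
  proof (intro nn_integral_cong)
    fix p
    have "(\<integral>\<^sup>+q. ?e p q * h (p, q) * indicator {q<..} p \<partial>lborel) + (\<integral>\<^sup>+q. ?e p q * h (p, q) * indicator {p..} q \<partial>lborel) =
      (\<integral>\<^sup>+q. ?e p q * h (p, q) * indicator {q<..} p + ?e p q * h (p, q) * indicator {p..} q \<partial>lborel)"
      by (rule nn_integral_add[symmetric]) (simp_all add: greaterThan_def)
    also have "\<dots> = (\<integral>\<^sup>+q. ?e p q * h (p, q) \<partial>lborel)"
      by (intro nn_integral_cong) (auto split: split_indicator)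
    finally show "(\<integral>\<^sup>+q. ?e p q * h (p, q) * indicator {q<..} p \<partial>lborel) + (\<integral>\<^sup>+q. ?e p q * h (p, q) * indicator {p..} q \<partial>lborel) = (\<integral>\<^sup>+q. ?e p q * h (p, q) \<partial>lborel)" .
  qed
  also have "\<dots> = (\<integral>\<^sup>+p. \<integral>\<^sup>+q. h (p, q) \<partial>expo l \<partial>expo l)"
  proof -
    interpret E: prob_space "expo l" using l by (rule prob_space_expo)
    have "(\<lambda>p. \<integral>\<^sup>+q. h (p, q) \<partial>expo l) \<in> borel_measurable borel" by measurable
    then have "(\<integral>\<^sup>+p. \<integral>\<^sup>+q. h (p, q) \<partial>expo l \<partial>expo l) = (\<integral>\<^sup>+p. ennreal (exponential_density l p) * (\<integral>\<^sup>+q. h (p, q) \<partial>expo l) \<partial>lborel)"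
      by (rule nn_integral_expo)
    also have "\<dots> = (\<integral>\<^sup>+p. \<integral>\<^sup>+q. ?e p q * h (p, q) \<partial>lborel \<partial>lborel)"
      by (intro nn_integral_cong) (simp add: nn_integral_expo nn_integral_cmult[symmetric] mult.assoc)
    finally show ?thesis by simp
  qed
  finally show ?thesis .
qed

section \<open>Coupling with Brownian motion\<close>

lemma AE_pair_fst:
  assumes "sigma_finite_measure M2" "AE x in M1. P x"
  shows "AE p in M1 \<Otimes>\<^sub>M M2. P (fst p)"
proof -
  interpret M2: sigma_finite_measure M2 by fact
  obtain Z where Z: "{x\<in>space M1. \<not> P x} \<subseteq> Z" "emeasure M1 Z = 0" "Z \<in> sets M1" using AE_E[OF assms(2)] .
  have "emeasure (M1 \<Otimes>\<^sub>M M2) (Z \<times> space M2) = 0" using Z by (simp add: M2.emeasure_pair_measure_Times)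
  then show ?thesis
    using Z by (intro AE_I'[of "Z \<times> space M2"]) (auto simp: null_sets_def space_pair_measure)
qed

lemma AE_pair_snd:
  assumes "sigma_finite_measure M2" "AE y in M2. P y"
  shows "AE p in M1 \<Otimes>\<^sub>M M2. P (snd p)"
proof -
  interpret M2: sigma_finite_measure M2 by fact
  obtain Z where Z: "{x\<in>space M2. \<not> P x} \<subseteq> Z" "emeasure M2 Z = 0" "Z \<in> sets M2" using AE_E[OF assms(2)] .
  have "emeasure (M1 \<Otimes>\<^sub>M M2) (space M1 \<times> Z) = 0" using Z by (simp add: M2.emeasure_pair_measure_Times)
  then show ?thesis
    using Z by (intro AE_I'[of "space M1 \<times> Z"]) (auto simp: null_sets_def space_pair_measure)
qed

lemma nn_integral_pair3:
  assumes "sigma_finite_measure M2" "sigma_finite_measure M3" and [measurable]: "f \<in> borel_measurable (M1 \<Otimes>\<^sub>M (M2 \<Otimes>\<^sub>M M3))"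
  shows "(\<integral>\<^sup>+k. f k \<partial>(M1 \<Otimes>\<^sub>M (M2 \<Otimes>\<^sub>M M3))) = (\<integral>\<^sup>+u. \<integral>\<^sup>+\<xi>. \<integral>\<^sup>+m. f (u, \<xi>, m) \<partial>M3 \<partial>M2 \<partial>M1)"
proof -
  interpret M2: sigma_finite_measure M2 by fact
  interpret M3: sigma_finite_measure M3 by fact
  interpret P: pair_sigma_finite M2 M3 ..
  have "(\<integral>\<^sup>+k. f k \<partial>(M1 \<Otimes>\<^sub>M (M2 \<Otimes>\<^sub>M M3))) = (\<integral>\<^sup>+u. \<integral>\<^sup>+k. f (u, k) \<partial>(M2 \<Otimes>\<^sub>M M3) \<partial>M1)"
    by (subst P.nn_integral_fst[symmetric]) auto
  also have "\<dots> = (\<integral>\<^sup>+u. \<integral>\<^sup>+\<xi>. \<integral>\<^sup>+m. f (u, \<xi>, m) \<partial>M3 \<partial>M2 \<partial>M1)"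
    by (intro nn_integral_cong) (subst M3.nn_integral_fst[symmetric], auto)
  finally show ?thesis .
qed

section \<open>Measurability and moments of Brownian motion\<close>

lemma brownian_motionD:
  assumes "brownian_motion N \<sigma>2 B"
  shows "prob_space N" "\<omega> \<in> space N \<Longrightarrow> B 0 \<omega> = 0" "\<omega> \<in> space N \<Longrightarrow> continuous_on {0..} (\<lambda>t. B t \<omega>)"
    "0 \<le> s \<Longrightarrow> s < t \<Longrightarrow> distributed N lborel (\<lambda>\<omega>. B t \<omega> - B s \<omega>) (normal_density 0 (sqrt (\<sigma>2 * (t - s))))"
    "0 \<le> u 0 \<Longrightarrow> incseq u \<Longrightarrow> prob_space.indep_vars N (\<lambda>_. borel) (\<lambda>i \<omega>. B (u (Suc i)) \<omega> - B (u i) \<omega>) UNIV"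
  using assms by (auto simp: brownian_motion_def)

lemma brownian_motion_measurable:
  assumes "brownian_motion N \<sigma>2 B" "0 \<le> t"
  shows "B t \<in> borel_measurable N"
proof (cases "t = 0")
  case True
  then show ?thesis using brownian_motionD(2)[OF assms(1)] by (simp cong: measurable_cong)
next
  case False
  then have "(\<lambda>\<omega>. B t \<omega> - B 0 \<omega>) \<in> borel_measurable N"
    using brownian_motionD(4)[OF assms(1), of 0 t] assms(2) by (auto dest: distributed_measurable)
  then show ?thesis using brownian_motionD(2)[OF assms(1)] by (simp cong: measurable_cong)
qed

text \<open>Joint measurability follows from continuity by rounding the time up to a grid. The
  maximum with 0 makes the map meaningful on all of the real line, since nothing is assumed about
  negative times.\<close>

lemma brownian_motion_jointly_measurable:
  fixes N :: "'a measure"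
  assumes bm: "brownian_motion N \<sigma>2 B"
  shows "(\<lambda>p. B (max 0 (fst p)) (snd p)) \<in> borel_measurable (borel \<Otimes>\<^sub>M N)"
proof (rule borel_measurable_LIMSEQ_real)
  let ?k = "\<lambda>n t. nat \<lceil>max 0 t * real (Suc n)\<rceil>"
  fix p :: "real \<times> 'a" assume "p \<in> space (borel \<Otimes>\<^sub>M N)"
  then have \<omega>: "snd p \<in> space N" by (auto simp: space_pair_measure)
  let ?t = "max 0 (fst p)"
  have "(\<lambda>n. real (?k n (fst p)) / real (Suc n)) \<longlonglongrightarrow> ?t"
  proof (rule tendsto_sandwich)
    have k: "?t * real (Suc n) \<le> real (?k n (fst p))" "real (?k n (fst p)) \<le> ?t * real (Suc n) + 1" for n
    proof -
      have "0 \<le> ?t * real (Suc n)" by simp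
      then have "real (?k n (fst p)) = of_int \<lceil>?t * real (Suc n)\<rceil>" by simp
      then show "?t * real (Suc n) \<le> real (?k n (fst p))" "real (?k n (fst p)) \<le> ?t * real (Suc n) + 1" by linarith+
    qed
    show "\<forall>\<^sub>F n in sequentially. ?t \<le> real (?k n (fst p)) / real (Suc n)"
      using k(1) by (intro always_eventually allI) (simp add: le_divide_eq del: of_nat_Suc)
    show "\<forall>\<^sub>F n in sequentially. real (?k n (fst p)) / real (Suc n) \<le> ?t + 1 / real (Suc n)"
    proof (intro always_eventually allI)
      fix n
      have "real (?k n (fst p)) / real (Suc n) \<le> (?t * real (Suc n) + 1) / real (Suc n)" using k(2) by (intro divide_right_mono) auto
      then show "real (?k n (fst p)) / real (Suc n) \<le> ?t + 1 / real (Suc n)" by (simp add: add_divide_distrib del: of_nat_Suc)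
    qed
    show "(\<lambda>n. ?t + 1 / real (Suc n)) \<longlonglongrightarrow> ?t" using LIMSEQ_inverse_real_of_nat_add[of ?t] by (simp add: inverse_eq_divide)
  qed simp
  then show "(\<lambda>n. B (real (?k n (fst p)) / real (Suc n)) (snd p)) \<longlonglongrightarrow> B (max 0 (fst p)) (snd p)"
  proof (rule continuous_on_tendsto_compose[OF brownian_motionD(3)[OF bm \<omega>]])
    show "\<forall>\<^sub>F n in sequentially. real (?k n (fst p)) / real (Suc n) \<in> {0..}"
      by (intro always_eventually allI) (simp only: atLeast_iff, intro divide_nonneg_nonneg of_nat_0_le_iff)
  qed simp
next
  fix n
  have "(\<lambda>p. B (real k / real (Suc n)) (snd p)) \<in> borel_measurable (borel \<Otimes>\<^sub>M N)" for k :: nat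
    using brownian_motion_measurable[OF bm, of "real k / real (Suc n)"] by (intro measurable_compose[OF measurable_snd]) auto
  moreover have "(\<lambda>p. nat \<lceil>max 0 (fst p) * real (Suc n)\<rceil>) \<in> (borel \<Otimes>\<^sub>M N) \<rightarrow>\<^sub>M count_space UNIV"
    by measurable
  ultimately show "(\<lambda>p. B (real (nat \<lceil>max 0 (fst p) * real (Suc n)\<rceil>) / real (Suc n)) (snd p)) \<in> borel_measurable (borel \<Otimes>\<^sub>M N)"
    by (rule measurable_compose_countable)
qed

lemma brownian_motion_increment_square:
  assumes bm: "brownian_motion N \<sigma>2 B" and \<sigma>: "0 < \<sigma>2" and st: "0 \<le> s" "0 \<le> t"
  shows "(\<integral>\<^sup>+\<omega>. ennreal ((B s \<omega> - B t \<omega>)\<^sup>2) \<partial>N) = ennreal (\<sigma>2 * \<bar>s - t\<bar>)"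
proof -
  have *: "(\<integral>\<^sup>+\<omega>. ennreal ((B t \<omega> - B s \<omega>)\<^sup>2) \<partial>N) = ennreal (\<sigma>2 * (t - s))" if "0 \<le> s" "s < t" for s t
  proof -
    let ?c = "sqrt (\<sigma>2 * (t - s))"
    have c: "0 < ?c" using that \<sigma> by simp
    have "(\<integral>\<^sup>+\<omega>. ennreal ((B t \<omega> - B s \<omega>)\<^sup>2) \<partial>N) = (\<integral>\<^sup>+x. ennreal (normal_density 0 ?c x) * ennreal (x\<^sup>2) \<partial>lborel)"
      by (rule distributed_nn_integral[symmetric, OF brownian_motionD(4)[OF bm that]]) simp
    also have "\<dots> = (\<integral>\<^sup>+x. ennreal (normal_density 0 ?c x * x\<^sup>2) \<partial>lborel)" by (simp add: ennreal_mult)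
    also have "\<dots> = ennreal (\<sigma>2 * (t - s))"
      using normal_moment_even[OF c, of 0 1] that \<sigma>
      by (subst nn_integral_eq_integral) (auto simp: has_bochner_integral_iff power2_eq_square)
    finally show ?thesis .
  qed
  show ?thesis
    using *[of s t] *[of t s] st by (cases s t rule: linorder_cases) (auto simp: power2_commute)
qed

lemma brownian_motion_mgf:
  assumes bm: "brownian_motion N \<sigma>2 B" and \<sigma>: "0 < \<sigma>2" and t: "0 \<le> t"
  shows "(\<integral>\<^sup>+\<omega>. ennreal (exp (\<theta> * B t \<omega>)) \<partial>N) = ennreal (exp (\<theta>\<^sup>2 * \<sigma>2 * t / 2))"
proof (cases "t = 0")
  case True
  interpret prob_space N by (rule brownian_motionD(1)[OF bm])
  have "(\<integral>\<^sup>+\<omega>. ennreal (exp (\<theta> * B t \<omega>)) \<partial>N) = (\<integral>\<^sup>+\<omega>. 1 \<partial>N)"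
    using True brownian_motionD(2)[OF bm] by (intro nn_integral_cong) auto
  then show ?thesis using True by (simp add: emeasure_space_1)
next
  case False
  let ?c = "sqrt (\<sigma>2 * t)"
  have t: "0 < t" and c: "0 < ?c" and c2: "?c\<^sup>2 = \<sigma>2 * t" using False t \<sigma> by auto
  have "(\<integral>\<^sup>+\<omega>. ennreal (exp (\<theta> * B t \<omega>)) \<partial>N) = (\<integral>\<^sup>+\<omega>. ennreal (exp (\<theta> * (B t \<omega> - B 0 \<omega>))) \<partial>N)"
    using brownian_motionD(2)[OF bm] by (intro nn_integral_cong) auto
  also have "\<dots> = (\<integral>\<^sup>+x. ennreal (normal_density 0 ?c x) * ennreal (exp (\<theta> * x)) \<partial>lborel)"
    using brownian_motionD(4)[OF bm order.refl t] by (intro distributed_nn_integral[symmetric]) auto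
  also have "\<dots> = (\<integral>\<^sup>+x. ennreal (exp (\<theta>\<^sup>2 * \<sigma>2 * t / 2)) * ennreal (normal_density (\<theta> * ?c\<^sup>2) ?c x) \<partial>lborel)"
  proof (intro nn_integral_cong)
    fix x
    \<comment> \<open>Completing the square shifts the mean by \<theta> times the variance.\<close>
    have "- (x - 0)\<^sup>2 / (2 * ?c\<^sup>2) + \<theta> * x = \<theta>\<^sup>2 * \<sigma>2 * t / 2 + - (x - \<theta> * ?c\<^sup>2)\<^sup>2 / (2 * ?c\<^sup>2)"
      unfolding c2 using \<sigma> t by (simp add: field_simps power2_eq_square)
    then have "exp (- (x - 0)\<^sup>2 / (2 * ?c\<^sup>2)) * exp (\<theta> * x) = exp (\<theta>\<^sup>2 * \<sigma>2 * t / 2) * exp (- (x - \<theta> * ?c\<^sup>2)\<^sup>2 / (2 * ?c\<^sup>2))"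
      unfolding mult_exp_exp by (simp only:)
    then have "normal_density 0 ?c x * exp (\<theta> * x) = exp (\<theta>\<^sup>2 * \<sigma>2 * t / 2) * normal_density (\<theta> * ?c\<^sup>2) ?c x"
      unfolding normal_density_def by (simp only: mult.assoc) (simp only: mult.left_commute)
    then show "ennreal (normal_density 0 ?c x) * ennreal (exp (\<theta> * x)) = ennreal (exp (\<theta>\<^sup>2 * \<sigma>2 * t / 2)) * ennreal (normal_density (\<theta> * ?c\<^sup>2) ?c x)"
      by (simp flip: ennreal_mult)
  qed
  also have "\<dots> = ennreal (exp (\<theta>\<^sup>2 * \<sigma>2 * t / 2)) * (\<integral>\<^sup>+x. ennreal (normal_density (\<theta> * ?c\<^sup>2) ?c x) \<partial>lborel)"
    by (rule nn_integral_cmult) measurable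
  also have "(\<integral>\<^sup>+x. ennreal (normal_density (\<theta> * ?c\<^sup>2) ?c x) \<partial>lborel) = 1"
    using c by (subst nn_integral_eq_integral) auto
  finally show ?thesis by simp
qed

text \<open>
  Holding times read off from a path \<open>b\<close> sampled at the renewal times with holding times \<open>\<xi>\<close>:
  the \<open>j\<close>-th scaled increment is the difference of the holding times \<open>2 j\<close> and \<open>2 j + 1\<close>,
  and \<open>m j\<close> is their minimum.
\<close>

definition rebuilt :: "real \<Rightarrow> (real \<Rightarrow> real) \<Rightarrow> (nat \<Rightarrow> real) \<Rightarrow> (nat \<Rightarrow> real) \<Rightarrow> nat \<Rightarrow> real" where
  "rebuilt c b \<xi> m i = (let x = c * (b (switch_time \<xi> (Suc (i div 2))) - b (switch_time \<xi> (i div 2)))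
     in m (i div 2) + (if even i then max x 0 else max (- x) 0))"

lemma rebuilt_even: "rebuilt c b \<xi> m (2 * j) = m j + max (c * (b (switch_time \<xi> (Suc j)) - b (switch_time \<xi> j))) 0"
  and rebuilt_odd: "rebuilt c b \<xi> m (Suc (2 * j)) = m j + max (- (c * (b (switch_time \<xi> (Suc j)) - b (switch_time \<xi> j)))) 0"
  by (simp_all add: rebuilt_def Let_def)

text \<open>In each pair the common minimum cancels and the positive part minus the negative part is
  the scaled increment itself, so the sum telescopes. At its even switching times the rebuilt path
  thus sits exactly on the sampled Brownian path, up to the scale \<open>c\<close>.\<close>

lemma alternating_sum_rebuilt:
  "(\<Sum>i<2 * k. (-1) ^ i * rebuilt c b \<xi> m i) = c * (b (switch_time \<xi> k) - b 0)"
proof (induction k)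
  case (Suc k)
  have "(\<Sum>i<2 * Suc k. (-1) ^ i * rebuilt c b \<xi> m i) = (\<Sum>i<2 * k. (-1) ^ i * rebuilt c b \<xi> m i) + rebuilt c b \<xi> m (2 * k) - rebuilt c b \<xi> m (Suc (2 * k))"
    by simp
  also have "\<dots> = c * (b (switch_time \<xi> (Suc k)) - b 0)"
    unfolding Suc rebuilt_even rebuilt_odd by (simp add: max_def algebra_simps)
  finally show ?case .
qed simp

section \<open>Law and cost of the rebuilt holding times\<close>

lemma nn_integral_expo_seq_pair_prod:
  assumes l: "0 < l" "0 < l'" and q: "\<And>j. case_prod (q j) \<in> borel_measurable (borel \<Otimes>\<^sub>M borel)"
  shows "(\<integral>\<^sup>+\<xi>. \<integral>\<^sup>+m. (\<Prod>j<n. q j (\<xi> j) (m j)) \<partial>expo_seq l' \<partial>expo_seq l) = (\<Prod>j<n. \<integral>\<^sup>+s. \<integral>\<^sup>+r. q j s r \<partial>expo l' \<partial>expo l)"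
  using q
proof (induction n arbitrary: q)
  case 0
  interpret S: prob_space "expo_seq l" using l by (intro prob_space_expo_seq)
  interpret S': prob_space "expo_seq l'" using l by (intro prob_space_expo_seq)
  show ?case by (simp add: S.emeasure_space_1[simplified] S'.emeasure_space_1[simplified])
next
  case (Suc n)
  interpret E: prob_space "expo l" using l by (intro prob_space_expo)
  interpret E': prob_space "expo l'" using l by (intro prob_space_expo)
  interpret S: prob_space "expo_seq l" using l by (intro prob_space_expo_seq)
  interpret S': prob_space "expo_seq l'" using l by (intro prob_space_expo_seq)
  interpret SE: pair_sigma_finite "expo_seq l" "expo l'" ..
  have q [measurable (raw)]: "(\<lambda>x. q j (f x) (g x)) \<in> borel_measurable M"
    if "f \<in> borel_measurable M" "g \<in> borel_measurable M" for j f g and M :: "'z measure"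
    using measurable_compose[OF measurable_Pair[OF that] Suc.prems[of j]] by simp
  let ?P = "\<lambda>\<xi> m. \<Prod>j<n. q (Suc j) (\<xi> j) (m j)"
  have "(\<integral>\<^sup>+\<xi>. \<integral>\<^sup>+m. (\<Prod>j<Suc n. q j (\<xi> j) (m j)) \<partial>expo_seq l' \<partial>expo_seq l) =
    (\<integral>\<^sup>+s. \<integral>\<^sup>+\<xi>. \<integral>\<^sup>+m. (\<Prod>j<Suc n. q j (case_nat s \<xi> j) (m j)) \<partial>expo_seq l' \<partial>expo_seq l \<partial>expo l)"
    by (rule nn_integral_expo_seq[OF l(1)]) measurable
  also have "\<dots> = (\<integral>\<^sup>+s. \<integral>\<^sup>+\<xi>. \<integral>\<^sup>+r. \<integral>\<^sup>+m. q 0 s r * ?P \<xi> m \<partial>expo_seq l' \<partial>expo l' \<partial>expo_seq l \<partial>expo l)"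
    by (intro nn_integral_cong, subst nn_integral_expo_seq[OF l(2)]) (simp_all del: prod.lessThan_Suc add: prod.lessThan_Suc_shift)
  also have "\<dots> = (\<integral>\<^sup>+s. \<integral>\<^sup>+\<xi>. \<integral>\<^sup>+r. q 0 s r * (\<integral>\<^sup>+m. ?P \<xi> m \<partial>expo_seq l') \<partial>expo l' \<partial>expo_seq l \<partial>expo l)"
    by (intro nn_integral_cong nn_integral_cmult) measurable
  also have "\<dots> = (\<integral>\<^sup>+s. \<integral>\<^sup>+\<xi>. (\<integral>\<^sup>+r. q 0 s r \<partial>expo l') * (\<integral>\<^sup>+m. ?P \<xi> m \<partial>expo_seq l') \<partial>expo_seq l \<partial>expo l)"
    by (intro nn_integral_cong nn_integral_multc) measurable
  also have "\<dots> = (\<integral>\<^sup>+s. (\<integral>\<^sup>+r. q 0 s r \<partial>expo l') * (\<integral>\<^sup>+\<xi>. \<integral>\<^sup>+m. ?P \<xi> m \<partial>expo_seq l' \<partial>expo_seq l) \<partial>expo l)"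
    by (intro nn_integral_cong nn_integral_cmult) measurable
  also have "\<dots> = (\<integral>\<^sup>+s. \<integral>\<^sup>+r. q 0 s r \<partial>expo l' \<partial>expo l) * (\<integral>\<^sup>+\<xi>. \<integral>\<^sup>+m. ?P \<xi> m \<partial>expo_seq l' \<partial>expo_seq l)"
    by (intro nn_integral_multc) measurable
  also have "(\<integral>\<^sup>+\<xi>. \<integral>\<^sup>+m. ?P \<xi> m \<partial>expo_seq l' \<partial>expo_seq l) = (\<Prod>j<n. \<integral>\<^sup>+s. \<integral>\<^sup>+r. q (Suc j) s r \<partial>expo l' \<partial>expo l)"
    by (rule Suc.IH) (rule Suc.prems)
  finally show ?case by (simp del: prod.lessThan_Suc add: prod.lessThan_Suc_shift)
qed

text \<open>With the renewal times frozen, they form a deterministic increasing sequence, to which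
  independence of increments applies. The condition on \<open>c\<close> normalises the diffusivity
  to \<open>1 / l\<close>.\<close>

lemma brownian_increments_box:
  assumes bm: "brownian_motion N \<sigma>2 B" and \<sigma>: "0 < \<sigma>2" and l: "0 < l" and c: "c\<^sup>2 * \<sigma>2 = 1 / l"
    and pos: "\<And>j. 0 < \<xi> j" and G: "\<And>j. G j \<in> sets borel"
  shows "emeasure N {\<omega>\<in>space N. \<forall>j<n. c * (B (switch_time \<xi> (Suc j)) \<omega> - B (switch_time \<xi> j) \<omega>) \<in> G j} =
    (\<Prod>j<n. \<integral>\<^sup>+x. ennreal (normal_density 0 (sqrt (\<xi> j / l)) x) * indicator (G j) x \<partial>lborel)"
proof -
  interpret N: prob_space N by (rule brownian_motionD(1)[OF bm])
  let ?D = "\<lambda>j \<omega>. B (switch_time \<xi> (Suc j)) \<omega> - B (switch_time \<xi> j) \<omega>"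
  have c0: "c \<noteq> 0" using c l by auto
  have inc: "incseq (switch_time \<xi>)" unfolding incseq_def using switch_time_mono[of \<xi>] pos by blast
  have ind: "N.indep_vars (\<lambda>_. borel) ?D UNIV" by (rule brownian_motionD(5)[OF bm _ inc]) simp
  then have m [measurable]: "?D j \<in> borel_measurable N" for j by (simp add: N.indep_vars_def)
  have G' [measurable]: "{x. c * x \<in> G j} \<in> sets borel" for j using G[of j] by measurable
  have one: "emeasure N (?D j -` {x. c * x \<in> G j} \<inter> space N) = (\<integral>\<^sup>+x. ennreal (normal_density 0 (sqrt (\<xi> j / l)) x) * indicator (G j) x \<partial>lborel)" for j
  proof -
    have d: "distributed N lborel (?D j) (normal_density 0 (sqrt (\<sigma>2 * \<xi> j)))"
      using brownian_motionD(4)[OF bm, of "switch_time \<xi> j" "switch_time \<xi> (Suc j)"] switch_time_nonneg[of \<xi> j] pos[of j] pos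
      by (simp add: switch_time_Suc)
    have "distributed N lborel (\<lambda>\<omega>. 0 + c * ?D j \<omega>) (normal_density (0 + c * 0) (\<bar>c\<bar> * sqrt (\<sigma>2 * \<xi> j)))"
      using \<sigma> pos[of j] by (intro N.normal_density_affine[OF d _ c0]) simp
    moreover have "\<bar>c\<bar> * sqrt (\<sigma>2 * \<xi> j) = sqrt (\<xi> j / l)"
    proof -
      have "\<bar>c\<bar> * sqrt (\<sigma>2 * \<xi> j) = sqrt (c\<^sup>2 * \<sigma>2 * \<xi> j)" by (simp add: real_sqrt_mult)
      then show ?thesis unfolding c by simp
    qed
    ultimately have d': "distributed N lborel (\<lambda>\<omega>. c * ?D j \<omega>) (normal_density 0 (sqrt (\<xi> j / l)))" by simp
    have "?D j -` {x. c * x \<in> G j} \<inter> space N = (\<lambda>\<omega>. c * ?D j \<omega>) -` G j \<inter> space N" by auto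
    then show ?thesis using distributed_emeasure[OF d', of "G j"] G[of j] by simp
  qed
  have "{\<omega>\<in>space N. \<forall>j<n. c * ?D j \<omega> \<in> G j} = (\<Inter>j\<in>{..<n}. ?D j -` {x. c * x \<in> G j} \<inter> space N)" if "n \<noteq> 0"
    using that by auto
  moreover have "N.prob (\<Inter>j\<in>{..<n}. ?D j -` {x. c * x \<in> G j} \<inter> space N) = (\<Prod>j<n. N.prob (?D j -` {x. c * x \<in> G j} \<inter> space N))" if "n \<noteq> 0"
    using that by (intro N.indep_varsD[OF ind]) (auto simp: lessThan_empty_iff)
  ultimately have "emeasure N {\<omega>\<in>space N. \<forall>j<n. c * ?D j \<omega> \<in> G j} = (\<Prod>j<n. emeasure N (?D j -` {x. c * x \<in> G j} \<inter> space N))"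
    by (cases "n = 0") (simp_all add: N.emeasure_space_1 N.emeasure_eq_measure prod_ennreal N.prob_space)
  then show ?thesis unfolding one .
qed

lemma measurable_rebuilt:
  assumes bm: "brownian_motion N \<sigma>2 B" and \<kappa> [measurable]: "\<kappa> \<in> borel_measurable borel"
  shows "(\<lambda>(\<omega>, u, \<xi>, m). (u, rebuilt (\<kappa> u) (\<lambda>t. B (max 0 t) \<omega>) \<xi> m)) \<in>
    N \<Otimes>\<^sub>M (borel \<Otimes>\<^sub>M (seq_borel \<Otimes>\<^sub>M seq_borel)) \<rightarrow>\<^sub>M borel \<Otimes>\<^sub>M seq_borel"
proof -
  let ?P = "N \<Otimes>\<^sub>M (borel \<Otimes>\<^sub>M (seq_borel \<Otimes>\<^sub>M seq_borel))"
  have B [measurable (raw)]: "(\<lambda>x. B (max 0 (f x)) (g x)) \<in> borel_measurable M" if "f \<in> borel_measurable M" "g \<in> M \<rightarrow>\<^sub>M N" for f g and M :: "'z measure"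
    using measurable_compose[OF measurable_Pair[OF that] brownian_motion_jointly_measurable[OF bm]] by simp
  have [measurable]: "(\<lambda>p. rebuilt (\<kappa> (fst (snd p))) (\<lambda>t. B (max 0 t) (fst p)) (fst (snd (snd p))) (snd (snd (snd p))) i) \<in> borel_measurable ?P" for i
    unfolding rebuilt_def Let_def by (cases "even i") (simp_all, measurable)
  have "(\<lambda>p. rebuilt (\<kappa> (fst (snd p))) (\<lambda>t. B (max 0 t) (fst p)) (fst (snd (snd p))) (snd (snd (snd p)))) \<in> ?P \<rightarrow>\<^sub>M seq_borel"
    by (rule measurable_PiM_single') auto
  then show ?thesis unfolding split_beta' by measurable
qed

text \<open>Initial velocity, holding times of the sampling clock, and minima of the pairs of
  telegraph holding times. The rates come from one cycle: two holding times last
  \<open>2 / l\<close> on average, and the minimum of two exponential times of rate \<open>l\<close>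
  has rate \<open>2 * l\<close>.\<close>

abbreviation coupling_noise :: "real \<Rightarrow> real \<Rightarrow> real \<Rightarrow> (real \<times> (nat \<Rightarrow> real) \<times> (nat \<Rightarrow> real)) measure" where
  "coupling_noise x y l \<equiv> two_point x y \<Otimes>\<^sub>M (expo_seq (l / 2) \<Otimes>\<^sub>M expo_seq (2 * l))"

text \<open>For frozen noise the scaled increments are independent normal variables. Integrating
  over the sampling times makes them Laplace distributed, and adding the independent minima yields
  pairs of exponential times. The scale depends on the initial velocity, but the normal law sees
  only its square, which is the same for both velocities; hence the holding times are independent of
  the initial velocity although they are built from it.\<close>

lemma rebuilt_law:
  assumes bm: "brownian_motion N \<sigma>2 B" and \<sigma>: "0 < \<sigma>2" and l: "0 < l" and xy: "x \<noteq> y"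
    and \<kappa> [measurable]: "\<kappa> \<in> borel_measurable borel" and \<kappa>_eq: "\<And>u. u \<in> {x, y} \<Longrightarrow> (\<kappa> u)\<^sup>2 * \<sigma>2 = 1 / l"
  shows "distr (N \<Otimes>\<^sub>M coupling_noise x y l) (borel \<Otimes>\<^sub>M seq_borel)
     (\<lambda>(\<omega>, u, \<xi>, m). (u, rebuilt (\<kappa> u) (\<lambda>t. B (max 0 t) \<omega>) \<xi> m)) = two_point x y \<Otimes>\<^sub>M expo_seq l"
proof -
  have l2: "0 < l / 2" "0 < 2 * l" using l by auto
  interpret N: prob_space N by (rule brownian_motionD(1)[OF bm])
  interpret D: prob_space "two_point x y" by (rule prob_space_two_point)
  interpret S1: prob_space "expo_seq (l / 2)" by (rule prob_space_expo_seq) fact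
  interpret S2: prob_space "expo_seq (2 * l)" by (rule prob_space_expo_seq) fact
  interpret S: pair_prob_space "expo_seq (l / 2)" "expo_seq (2 * l)" ..
  interpret K: pair_prob_space "two_point x y" "expo_seq (l / 2) \<Otimes>\<^sub>M expo_seq (2 * l)" ..
  interpret P: pair_prob_space N "coupling_noise x y l" ..
  let ?P = "N \<Otimes>\<^sub>M coupling_noise x y l"
  let ?\<tau> = "\<lambda>p. rebuilt (\<kappa> (fst (snd p))) (\<lambda>t. B (max 0 t) (fst p)) (fst (snd (snd p))) (snd (snd (snd p)))"
  have mP: "(\<lambda>p. (fst (snd p), ?\<tau> p)) \<in> ?P \<rightarrow>\<^sub>M borel \<Otimes>\<^sub>M seq_borel"
    using measurable_rebuilt[OF bm \<kappa>] unfolding split_beta' by (simp cong: measurable_cong_sets)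
  have m\<tau> [measurable]: "?\<tau> \<in> ?P \<rightarrow>\<^sub>M seq_borel"
    using measurable_compose[OF mP measurable_snd] by simp
  have "distr ?P (borel \<Otimes>\<^sub>M seq_borel) (\<lambda>p. (fst (snd p), ?\<tau> p)) = two_point x y \<Otimes>\<^sub>M expo_seq l"
  proof (rule distr_pair_sequence_eqI[OF P.prob_space_axioms prob_space_two_point _ prob_space_expo[OF l] _ _ m\<tau>])
    fix A :: "real set" and C :: "nat \<Rightarrow> real set" and n
    assume A [measurable]: "A \<in> sets borel" and C: "\<And>i. C i \<in> sets borel"
    \<comment> \<open>The holding times come in pairs, so the first \<open>n\<close> constraints are
      padded with \<open>UNIV\<close> to cover the \<open>2 * n\<close> members of \<open>n\<close>
      pairs.\<close>
    define C' where "C' i = (if i < n then C i else UNIV)" for i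
    have C' [measurable]: "C' i \<in> sets borel" for i using C by (simp add: C'_def)
    define G where "G m j = {z. m + max z 0 \<in> C' (2 * j) \<and> m + max (- z) 0 \<in> C' (Suc (2 * j))}" for m :: real and j
    have G: "G m j \<in> sets borel" for m j unfolding G_def by measurable
    define h where "h j p = indicator (C' (2 * j)) (fst p) * (indicator (C' (Suc (2 * j))) (snd p) :: ennreal)" for j and p :: "real \<times> real"
    have h [measurable]: "h j \<in> borel_measurable (borel \<Otimes>\<^sub>M borel)" for j unfolding h_def[abs_def] by measurable
    have hG: "indicator (G m j) z = h j (m + max z 0, m + max (- z) 0)" for m j z
      by (auto simp: G_def h_def split: split_indicator)
    define q where "q j s m = (\<integral>\<^sup>+z. ennreal (normal_density 0 (sqrt (s / l)) z) * h j (m + max z 0, m + max (- z) 0) \<partial>lborel)" for j and s m :: real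
    have q [measurable]: "case_prod (q j) \<in> borel_measurable (borel \<Otimes>\<^sub>M borel)" for j
      unfolding q_def[abs_def] normal_density_def split_beta' by measurable
    have blocks: "(\<forall>i<n. \<tau> i \<in> C i) \<longleftrightarrow> (\<forall>j<n. \<tau> (2 * j) \<in> C' (2 * j) \<and> \<tau> (Suc (2 * j)) \<in> C' (Suc (2 * j)))" for \<tau> :: "nat \<Rightarrow> real"
    proof
      assume R: "\<forall>j<n. \<tau> (2 * j) \<in> C' (2 * j) \<and> \<tau> (Suc (2 * j)) \<in> C' (Suc (2 * j))"
      show "\<forall>i<n. \<tau> i \<in> C i"
      proof safe
        fix i assume i: "i < n"
        then have "i div 2 < n" by simp
        with R have "\<tau> (2 * (i div 2)) \<in> C' (2 * (i div 2)) \<and> \<tau> (Suc (2 * (i div 2))) \<in> C' (Suc (2 * (i div 2)))" by blast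
        moreover have "i = 2 * (i div 2) \<or> i = Suc (2 * (i div 2))" by presburger
        ultimately have "\<tau> i \<in> C' i" by metis
        then show "\<tau> i \<in> C i" using i by (simp add: C'_def)
      qed
    qed (auto simp: C'_def)
    let ?Q = "{p\<in>space ?P. fst (snd p) \<in> A \<and> (\<forall>i<n. ?\<tau> p i \<in> C i)}"
    have Q: "?Q \<in> sets ?P" using C by measurable
    have "emeasure ?P ?Q = (\<integral>\<^sup>+k. emeasure N ((\<lambda>\<omega>. (\<omega>, k)) -` ?Q) \<partial>coupling_noise x y l)"
      by (rule P.emeasure_pair_measure_alt2[OF Q])
    also have "\<dots> = (\<integral>\<^sup>+k. indicator A (fst k) * (\<Prod>j<n. q j (fst (snd k) j) (snd (snd k) j)) \<partial>coupling_noise x y l)"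
    proof (rule nn_integral_cong_AE)
      have "AE k in coupling_noise x y l. fst k \<in> {x, y}"
        by (rule AE_pair_fst[OF S.sigma_finite_measure_axioms AE_two_point[OF xy]])
      moreover have "AE k in coupling_noise x y l. \<forall>j. 0 < fst (snd k) j"
        by (rule AE_pair_snd[OF S.sigma_finite_measure_axioms AE_pair_fst[OF S2.sigma_finite_measure_axioms AE_expo_seq_pos[OF l2(1)]]])
      moreover have "AE k in coupling_noise x y l. k \<in> space (coupling_noise x y l)" by (rule AE_space)
      ultimately show "AE k in coupling_noise x y l. emeasure N ((\<lambda>\<omega>. (\<omega>, k)) -` ?Q) = indicator A (fst k) * (\<Prod>j<n. q j (fst (snd k) j) (snd (snd k) j))"
      proof eventually_elim
        case (elim k)
        obtain u \<xi> m where k: "k = (u, \<xi>, m)" by (cases k) auto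
        have pos: "\<And>j. 0 < \<xi> j" using elim k by simp
        have mx: "max 0 (switch_time \<xi> j) = switch_time \<xi> j" for j using switch_time_nonneg[of \<xi> j] pos by simp
        have "(\<lambda>\<omega>. (\<omega>, k)) -` ?Q = (if u \<in> A then {\<omega>\<in>space N. \<forall>j<n. \<kappa> u * (B (switch_time \<xi> (Suc j)) \<omega> - B (switch_time \<xi> j) \<omega>) \<in> G (m j) j} else {})"
          using elim(3) unfolding blocks rebuilt_even rebuilt_odd k
          by (auto simp: space_pair_measure mx G_def)
        moreover have "emeasure N {\<omega>\<in>space N. \<forall>j<n. \<kappa> u * (B (switch_time \<xi> (Suc j)) \<omega> - B (switch_time \<xi> j) \<omega>) \<in> G (m j) j} = (\<Prod>j<n. q j (\<xi> j) (m j))"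
          using elim(1) k unfolding q_def hG[symmetric] by (intro brownian_increments_box[OF bm \<sigma> l \<kappa>_eq pos G]) auto
        ultimately show ?case using k by simp
      qed
    qed
    also have "\<dots> = (\<integral>\<^sup>+u. \<integral>\<^sup>+\<xi>. \<integral>\<^sup>+m. indicator A u * (\<Prod>j<n. q j (\<xi> j) (m j)) \<partial>expo_seq (2 * l) \<partial>expo_seq (l / 2) \<partial>two_point x y)"
      by (subst nn_integral_pair3[OF S1.sigma_finite_measure_axioms S2.sigma_finite_measure_axioms]) simp_all
    also have "\<dots> = (\<integral>\<^sup>+u. indicator A u * (\<integral>\<^sup>+\<xi>. \<integral>\<^sup>+m. (\<Prod>j<n. q j (\<xi> j) (m j)) \<partial>expo_seq (2 * l) \<partial>expo_seq (l / 2)) \<partial>two_point x y)"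
      by (intro nn_integral_cong) (simp add: nn_integral_cmult)
    also have "\<dots> = emeasure (two_point x y) A * (\<integral>\<^sup>+\<xi>. \<integral>\<^sup>+m. (\<Prod>j<n. q j (\<xi> j) (m j)) \<partial>expo_seq (2 * l) \<partial>expo_seq (l / 2))"
      by (subst nn_integral_multc) auto
    also have "(\<integral>\<^sup>+\<xi>. \<integral>\<^sup>+m. (\<Prod>j<n. q j (\<xi> j) (m j)) \<partial>expo_seq (2 * l) \<partial>expo_seq (l / 2)) = (\<Prod>j<n. \<integral>\<^sup>+s. \<integral>\<^sup>+r. q j s r \<partial>expo (2 * l) \<partial>expo (l / 2))"
      by (rule nn_integral_expo_seq_pair_prod[OF l2 q])
    also have "\<dots> = (\<Prod>j<n. emeasure (expo l) (C' (2 * j)) * emeasure (expo l) (C' (Suc (2 * j))))"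
    proof (intro prod.cong refl)
      fix j
      interpret E1: prob_space "expo (l / 2)" by (rule prob_space_expo) fact
      interpret E2: prob_space "expo (2 * l)" by (rule prob_space_expo) fact
      interpret E: prob_space "expo l" using l by (rule prob_space_expo)
      interpret EE: pair_sigma_finite "expo (2 * l)" "expo (l / 2)" ..
      have "(\<integral>\<^sup>+s. \<integral>\<^sup>+r. q j s r \<partial>expo (2 * l) \<partial>expo (l / 2)) = (\<integral>\<^sup>+r. \<integral>\<^sup>+s. q j s r \<partial>expo (l / 2) \<partial>expo (2 * l))"
        by (rule EE.Fubini') (use q[of j] in \<open>simp add: split_beta', measurable\<close>)
      also have "\<dots> = (\<integral>\<^sup>+r. \<integral>\<^sup>+z. ennreal (l / 2 * exp (- l * \<bar>z\<bar>)) * h j (r + max z 0, r + max (- z) 0) \<partial>lborel \<partial>expo (2 * l))"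
        unfolding q_def by (intro nn_integral_cong gaussian_exponential_mixture[OF l]) measurable
      also have "\<dots> = (\<integral>\<^sup>+p. \<integral>\<^sup>+q. h j (p, q) \<partial>expo l \<partial>expo l)"
        by (rule laplace_minimum[OF l h])
      also have "\<dots> = emeasure (expo l) (C' (2 * j)) * emeasure (expo l) (C' (Suc (2 * j)))"
        by (simp add: h_def nn_integral_cmult nn_integral_multc)
      finally show "(\<integral>\<^sup>+s. \<integral>\<^sup>+r. q j s r \<partial>expo (2 * l) \<partial>expo (l / 2)) = emeasure (expo l) (C' (2 * j)) * emeasure (expo l) (C' (Suc (2 * j)))" .
    qed
    also have "\<dots> = (\<Prod>i<2 * n. emeasure (expo l) (C' i))"
    proof -
      have "(\<Prod>j<k. emeasure (expo l) (C' (2 * j)) * emeasure (expo l) (C' (Suc (2 * j)))) = (\<Prod>i<2 * k. emeasure (expo l) (C' i))" for k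
        by (induction k) (simp_all add: mult.assoc)
      then show ?thesis .
    qed
    also have "\<dots> = (\<Prod>i<n. emeasure (expo l) (C i))"
    proof -
      interpret E: prob_space "expo l" using l by (rule prob_space_expo)
      have "(\<Prod>i<n. emeasure (expo l) (C i)) = (\<Prod>i<2 * n. emeasure (expo l) (C' i))"
        using E.emeasure_space_1 by (intro prod.mono_neutral_cong_left) (auto simp: C'_def)
      then show ?thesis by simp
    qed
    finally show "emeasure ?P ?Q = emeasure (two_point x y) A * (\<Prod>i<n. emeasure (expo l) (C i))" .
  qed auto
  then show ?thesis unfolding split_beta' .
qed

text \<open>The comparison passes through the position at the \<open>2 k\<close>-th switch, which is
  the Brownian value at the \<open>k\<close>-th sampling time. The first error depends only on the
  law of the rebuilt holding times; in the second, the sampling time is independent of the Brownian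
  motion and can be frozen.\<close>

lemma rebuilt_cost:
  assumes bm: "brownian_motion N \<sigma>2 B" and \<sigma>: "0 < \<sigma>2" and l: "0 < l" and xy: "x \<noteq> y"
    and \<kappa> [measurable]: "\<kappa> \<in> borel_measurable borel" and \<kappa>_eq: "\<And>u. u \<in> {x, y} \<Longrightarrow> (\<kappa> u)\<^sup>2 * \<sigma>2 = 1 / l"
    and t: "0 \<le> t"
  shows "(\<integral>\<^sup>+(\<omega>, u, \<xi>, m). ennreal ((tele (rebuilt (\<kappa> u) (\<lambda>t. B (max 0 t) \<omega>) \<xi> m) t / \<kappa> u - B t \<omega>)\<^sup>2) \<partial>(N \<Otimes>\<^sub>M coupling_noise x y l))
    \<le> ennreal (\<sigma>2 / l * (24 + 12 * sqrt (l * t)))"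
proof -
  have l2: "0 < l / 2" "0 < 2 * l" using l by auto
  interpret N: prob_space N by (rule brownian_motionD(1)[OF bm])
  interpret D: prob_space "two_point x y" by (rule prob_space_two_point)
  interpret E: prob_space "expo_seq l" by (rule prob_space_expo_seq) fact
  interpret S1: prob_space "expo_seq (l / 2)" by (rule prob_space_expo_seq) fact
  interpret S2: prob_space "expo_seq (2 * l)" by (rule prob_space_expo_seq) fact
  interpret S: pair_prob_space "expo_seq (l / 2)" "expo_seq (2 * l)" ..
  interpret K: pair_prob_space "two_point x y" "expo_seq (l / 2) \<Otimes>\<^sub>M expo_seq (2 * l)" ..
  interpret P: pair_prob_space N "coupling_noise x y l" ..
  let ?P = "N \<Otimes>\<^sub>M coupling_noise x y l"
  let ?\<tau> = "\<lambda>p. rebuilt (\<kappa> (fst (snd p))) (\<lambda>t. B (max 0 t) (fst p)) (fst (snd (snd p))) (snd (snd (snd p)))"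
  have mP: "(\<lambda>p. (fst (snd p), ?\<tau> p)) \<in> ?P \<rightarrow>\<^sub>M borel \<Otimes>\<^sub>M seq_borel"
    using measurable_rebuilt[OF bm \<kappa>] unfolding split_beta' by (simp cong: measurable_cong_sets)
  have m\<tau> [measurable]: "?\<tau> \<in> ?P \<rightarrow>\<^sub>M seq_borel"
    using measurable_compose[OF mP measurable_snd] by simp
  have B [measurable (raw)]: "(\<lambda>x. B (max 0 (f x)) (g x)) \<in> borel_measurable M" if "f \<in> borel_measurable M" "g \<in> M \<rightarrow>\<^sub>M N" for f g and M :: "'z measure"
    using measurable_compose[OF measurable_Pair[OF that] brownian_motion_jointly_measurable[OF bm]] by simp
  have Bt [measurable]: "B t \<in> borel_measurable N" by (rule brownian_motion_measurable[OF bm t])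
  define k where "k = nat \<lfloor>l * t / 2\<rfloor>"
  have lt: "0 \<le> l * t / 2" using l t by simp
  then have "real k = of_int \<lfloor>l * t / 2\<rfloor>" by (simp add: k_def)
  then have k: "real k \<le> l * t / 2" "l * t / 2 < real k + 1" by linarith+
  have k_time: "\<bar>real (2 * k) / l - t\<bar> \<le> 2 / l"
  proof -
    have "\<bar>2 * real k - l * t\<bar> \<le> 2" using k by linarith
    then have "\<bar>2 * real k - l * t\<bar> / l \<le> 2 / l" using l by (intro divide_right_mono) auto
    also have "\<bar>2 * real k - l * t\<bar> / l = \<bar>(2 * real k - l * t) / l\<bar>" using l by simp
    also have "(2 * real k - l * t) / l = real (2 * k) / l - t" using l by (simp add: field_simps)
    finally show ?thesis .
  qed
  have k_sqrt: "sqrt (real (2 * k)) \<le> sqrt (l * t)" "sqrt (real k) \<le> sqrt (l * t)" using k by simp_all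
  let ?f = "\<lambda>\<tau>. ennreal ((tele \<tau> t - (\<Sum>i<2 * k. (-1) ^ i * \<tau> i))\<^sup>2)"
  let ?g = "\<lambda>p. ennreal ((B (max 0 (switch_time (fst (snd (snd p))) k)) (fst p) - B t (fst p))\<^sup>2)"
  have "(\<integral>\<^sup>+(\<omega>, u, \<xi>, m). ennreal ((tele (rebuilt (\<kappa> u) (\<lambda>t. B (max 0 t) \<omega>) \<xi> m) t / \<kappa> u - B t \<omega>)\<^sup>2) \<partial>?P) \<le>
     (\<integral>\<^sup>+p. ennreal (2 * \<sigma>2 * l) * ?f (?\<tau> p) + ennreal 2 * ?g p \<partial>?P)"
  proof (rule nn_integral_mono_AE)
    have "AE p in ?P. fst (snd p) \<in> {x, y}"
      by (rule AE_pair_snd[OF K.sigma_finite_measure_axioms AE_pair_fst[OF S.sigma_finite_measure_axioms AE_two_point[OF xy]]])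
    moreover have "AE p in ?P. p \<in> space ?P" by (rule AE_space)
    ultimately show "AE p in ?P. (case p of (\<omega>, u, \<xi>, m) \<Rightarrow> ennreal ((tele (rebuilt (\<kappa> u) (\<lambda>t. B (max 0 t) \<omega>) \<xi> m) t / \<kappa> u - B t \<omega>)\<^sup>2))
       \<le> ennreal (2 * \<sigma>2 * l) * ?f (?\<tau> p) + ennreal 2 * ?g p"
    proof eventually_elim
      case (elim p)
      obtain \<omega> u \<xi> m where p: "p = (\<omega>, u, \<xi>, m)" by (cases p) auto
      have ke: "(\<kappa> u)\<^sup>2 * \<sigma>2 = 1 / l" using elim p by (intro \<kappa>_eq) simp
      then have k0: "\<kappa> u \<noteq> 0" using l by auto
      \<comment> \<open>Dividing by the scale multiplies the squared error of the unit-speed path by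
        the squared speed \<open>\<sigma>2 * l\<close>.\<close>
      have ki: "1 / (\<kappa> u)\<^sup>2 = \<sigma>2 * l" using ke k0 l by (simp add: field_simps)
      have w: "\<omega> \<in> space N" using elim p by (auto simp: space_pair_measure)
      define a where "a = tele (?\<tau> p) t - (\<Sum>i<2 * k. (-1) ^ i * ?\<tau> p i)"
      define b where "b = B (max 0 (switch_time \<xi> k)) \<omega> - B t \<omega>"
      have "(\<Sum>i<2 * k. (-1) ^ i * ?\<tau> p i) = \<kappa> u * B (max 0 (switch_time \<xi> k)) \<omega>"
        unfolding alternating_sum_rebuilt using brownian_motionD(2)[OF bm w] p by simp
      then have e: "tele (?\<tau> p) t / \<kappa> u - B t \<omega> = a / \<kappa> u + b" using k0 by (simp add: a_def b_def field_simps)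
      have "(a / \<kappa> u + b)\<^sup>2 \<le> 2 * (a / \<kappa> u)\<^sup>2 + 2 * b\<^sup>2"
        using sum_squares_bound[of "a / \<kappa> u" b] by (simp add: power2_sum)
      also have "(a / \<kappa> u)\<^sup>2 = \<sigma>2 * l * a\<^sup>2"
      proof -
        have "(a / \<kappa> u)\<^sup>2 = 1 / (\<kappa> u)\<^sup>2 * a\<^sup>2" by (simp add: power_divide)
        then show ?thesis unfolding ki .
      qed
      finally have "(tele (?\<tau> p) t / \<kappa> u - B t \<omega>)\<^sup>2 \<le> (2 * \<sigma>2 * l) * a\<^sup>2 + 2 * b\<^sup>2" unfolding e by simp
      then have "ennreal ((tele (?\<tau> p) t / \<kappa> u - B t \<omega>)\<^sup>2) \<le> ennreal ((2 * \<sigma>2 * l) * a\<^sup>2 + 2 * b\<^sup>2)" by (rule ennreal_leI)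
      also have "\<dots> = ennreal (2 * \<sigma>2 * l) * ennreal (a\<^sup>2) + ennreal 2 * ennreal (b\<^sup>2)"
        using \<sigma> l by (subst ennreal_plus) (auto simp: ennreal_mult)
      finally show ?case by (simp add: p a_def b_def)
    qed
  qed
  also have "\<dots> = ennreal (2 * \<sigma>2 * l) * (\<integral>\<^sup>+p. ?f (?\<tau> p) \<partial>?P) + ennreal 2 * (\<integral>\<^sup>+p. ?g p \<partial>?P)"
    by (subst nn_integral_add) (auto simp: nn_integral_cmult)
  also have "\<dots> \<le> ennreal (2 * \<sigma>2 * l) * ennreal (4 / l * (sqrt (real (2 * k)) / l + \<bar>real (2 * k) / l - t\<bar>) + 2 / l\<^sup>2)
     + ennreal 2 * ennreal (\<sigma>2 * (sqrt (real k) / (l / 2) + \<bar>real k / (l / 2) - t\<bar>))"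
  proof (intro add_mono mult_left_mono)
    have "(\<integral>\<^sup>+p. ?f (?\<tau> p) \<partial>?P) = (\<integral>\<^sup>+z. ?f (snd z) \<partial>distr ?P (borel \<Otimes>\<^sub>M seq_borel) (\<lambda>p. (fst (snd p), ?\<tau> p)))"
      by (subst nn_integral_distr[OF mP]) auto
    also have "distr ?P (borel \<Otimes>\<^sub>M seq_borel) (\<lambda>p. (fst (snd p), ?\<tau> p)) = two_point x y \<Otimes>\<^sub>M expo_seq l"
      using rebuilt_law[OF bm \<sigma> l xy \<kappa> \<kappa>_eq] unfolding split_beta' by simp
    also have "(\<integral>\<^sup>+z. ?f (snd z) \<partial>(two_point x y \<Otimes>\<^sub>M expo_seq l)) = (\<integral>\<^sup>+\<tau>. ?f \<tau> \<partial>expo_seq l)"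
      by (subst E.nn_integral_fst[symmetric]) (auto simp: D.emeasure_space_1)
    also have "\<dots> \<le> ennreal (4 / l * (sqrt (real (2 * k)) / l + \<bar>real (2 * k) / l - t\<bar>) + 2 / l\<^sup>2)"
      by (rule tele_switch_deviation[OF l t])
    finally show "(\<integral>\<^sup>+p. ?f (?\<tau> p) \<partial>?P) \<le> ennreal (4 / l * (sqrt (real (2 * k)) / l + \<bar>real (2 * k) / l - t\<bar>) + 2 / l\<^sup>2)" .
    have "(\<integral>\<^sup>+p. ?g p \<partial>?P) = (\<integral>\<^sup>+y. \<integral>\<^sup>+\<omega>. ?g (\<omega>, y) \<partial>N \<partial>coupling_noise x y l)"
      by (rule P.nn_integral_snd[symmetric]) measurable
    also have "\<dots> = (\<integral>\<^sup>+y. ennreal (\<sigma>2 * \<bar>max 0 (switch_time (fst (snd y)) k) - t\<bar>) \<partial>coupling_noise x y l)"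
      using brownian_motion_increment_square[OF bm \<sigma> _ t] by (intro nn_integral_cong) simp
    also have "\<dots> = (\<integral>\<^sup>+\<xi>. ennreal (\<sigma>2 * \<bar>max 0 (switch_time \<xi> k) - t\<bar>) \<partial>expo_seq (l / 2))"
      by (subst nn_integral_pair3[OF S1.sigma_finite_measure_axioms S2.sigma_finite_measure_axioms])
         (simp_all add: D.emeasure_space_1 S2.emeasure_space_1[simplified])
    also have "\<dots> \<le> (\<integral>\<^sup>+\<xi>. ennreal (\<sigma>2 * \<bar>switch_time \<xi> k - t\<bar>) \<partial>expo_seq (l / 2))"
      using t \<sigma> by (intro nn_integral_mono ennreal_leI mult_left_mono) auto
    also have "\<dots> = ennreal (\<integral>\<xi>. \<sigma>2 * \<bar>switch_time \<xi> k - t\<bar> \<partial>expo_seq (l / 2))"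
      using \<sigma> by (intro nn_integral_eq_integral integrable_mult_right switch_time_deviation l2) auto
    also have "\<dots> \<le> ennreal (\<sigma>2 * (sqrt (real k) / (l / 2) + \<bar>real k / (l / 2) - t\<bar>))"
      using switch_time_deviation(2)[OF l2(1), of k t] \<sigma> by (intro ennreal_leI) (simp add: mult_left_mono)
    finally show "(\<integral>\<^sup>+p. ?g p \<partial>?P) \<le> ennreal (\<sigma>2 * (sqrt (real k) / (l / 2) + \<bar>real k / (l / 2) - t\<bar>))" .
  qed auto
  also have "\<dots> = ennreal ((2 * \<sigma>2 * l) * (4 / l * (sqrt (real (2 * k)) / l + \<bar>real (2 * k) / l - t\<bar>) + 2 / l\<^sup>2)
     + 2 * (\<sigma>2 * (sqrt (real k) / (l / 2) + \<bar>real k / (l / 2) - t\<bar>)))"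
    using \<sigma> l by (subst ennreal_plus) (auto simp: ennreal_mult)
  \<comment> \<open>Both clocks have mean \<open>2 k / l\<close>, within \<open>2 / l\<close> of
    \<open>t\<close>, and both square roots are at most \<open>sqrt (l * t)\<close>. In units of
    \<open>\<sigma>2 / l\<close> the telegraph error contributes 20 and 8, the Brownian error 4 and
    4.\<close>
  also have "\<dots> \<le> ennreal (\<sigma>2 / l * (24 + 12 * sqrt (l * t)))"
  proof (rule ennreal_leI)
    have "(2 * \<sigma>2 * l) * (4 / l * (sqrt (real (2 * k)) / l + \<bar>real (2 * k) / l - t\<bar>) + 2 / l\<^sup>2) \<le>
      (2 * \<sigma>2 * l) * (4 / l * (sqrt (l * t) / l + 2 / l) + 2 / l\<^sup>2)"
      using k_time k_sqrt \<sigma> l by (intro mult_left_mono add_mono divide_right_mono) auto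
    also have "\<dots> = \<sigma>2 / l * (20 + 8 * sqrt (l * t))" using l by (simp add: field_simps power2_eq_square)
    finally have 1: "(2 * \<sigma>2 * l) * (4 / l * (sqrt (real (2 * k)) / l + \<bar>real (2 * k) / l - t\<bar>) + 2 / l\<^sup>2) \<le> \<sigma>2 / l * (20 + 8 * sqrt (l * t))" .
    have "2 * (\<sigma>2 * (sqrt (real k) / (l / 2) + \<bar>real k / (l / 2) - t\<bar>)) \<le> 2 * (\<sigma>2 * (sqrt (l * t) / (l / 2) + 2 / l))"
      using k_time k_sqrt \<sigma> l by (intro mult_left_mono add_mono divide_right_mono) (auto simp: mult.commute)
    also have "\<dots> = \<sigma>2 / l * (4 + 4 * sqrt (l * t))" using l by (simp add: field_simps)
    finally have 2: "2 * (\<sigma>2 * (sqrt (real k) / (l / 2) + \<bar>real k / (l / 2) - t\<bar>)) \<le> \<sigma>2 / l * (4 + 4 * sqrt (l * t))" .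
    show "(2 * \<sigma>2 * l) * (4 / l * (sqrt (real (2 * k)) / l + \<bar>real (2 * k) / l - t\<bar>) + 2 / l\<^sup>2)
     + 2 * (\<sigma>2 * (sqrt (real k) / (l / 2) + \<bar>real k / (l / 2) - t\<bar>)) \<le> \<sigma>2 / l * (24 + 12 * sqrt (l * t))"
    proof -
      have "\<sigma>2 / l * (20 + 8 * sqrt (l * t)) + \<sigma>2 / l * (4 + 4 * sqrt (l * t)) = \<sigma>2 / l * (24 + 12 * sqrt (l * t))"
        unfolding distrib_left[symmetric] by (rule arg_cong) simp
      with add_mono[OF 1 2] show ?thesis by (simp only:)
    qed
  qed
  finally show ?thesis .
qed

section \<open>Moments and transport cost of the paths\<close>

lemma nn_integral_lebesgue_on_exp:
  assumes T: "0 < T"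
  shows "(\<integral>\<^sup>+s. ennreal (exp (K * s)) \<partial>lebesgue_on {0..T}) = ennreal (T * exp_quot (K * T))"
proof -
  have "(\<integral>\<^sup>+s. ennreal (exp (K * s)) \<partial>lebesgue_on {0..T}) = (\<integral>\<^sup>+s. ennreal (exp (K * s)) * indicator {0..T} s \<partial>lborel)"
    by (subst nn_integral_restrict_space) (auto simp: nn_integral_completion)
  also have "\<dots> = ennreal (T * exp_quot (K * T))"
  proof (cases "K = 0")
    case True
    then show ?thesis using T by (simp add: exp_quot_def)
  next
    case False
    have "(\<integral>\<^sup>+s. ennreal (exp (K * s)) * indicator {0..T} s \<partial>lborel) = ennreal (exp (K * T) / K - exp (K * 0) / K)"
    proof (rule nn_integral_FTC_Icc)
      fix s show "((\<lambda>s. exp (K * s) / K) has_real_derivative exp (K * s)) (at s)"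
        using False by (auto intro!: derivative_eq_intros)
    qed (use T in auto)
    then show ?thesis using False T by (simp add: exp_quot_def flip: diff_divide_distrib)
  qed
  finally show ?thesis .
qed

lemma measurable_path_swap:
  assumes "case_prod X \<in> borel_measurable (K \<Otimes>\<^sub>M M)"
  shows "(\<lambda>p. X (snd p) (fst p)) \<in> borel_measurable (M \<Otimes>\<^sub>M K)"
  using measurable_compose[OF measurable_pair_swap' assms] by (simp add: split_beta')

lemma measurable_W_fun:
  assumes X: "case_prod X \<in> borel_measurable (lebesgue_on {0..T} \<Otimes>\<^sub>M M)"
  shows "(\<lambda>\<omega>. (W_fun T a c (\<lambda>s. X s \<omega>))\<^sup>2) \<in> borel_measurable M"
proof -
  interpret finite_measure "lebesgue_on {0..T}" by (rule finite_measure_lebesgue_on_Icc)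
  note [measurable] = measurable_path_swap[OF X]
  have [measurable]: "(\<lambda>s. 2 * c * s) \<in> borel_measurable (lebesgue_on {0..T})" by (rule borel_measurable_lebesgue_on) simp
  show ?thesis unfolding W_fun_def by measurable
qed

lemma nn_integral_W_fun_square:
  assumes T: "0 < T" and M: "sigma_finite_measure M"
    and X: "case_prod X \<in> borel_measurable (lebesgue_on {0..T} \<Otimes>\<^sub>M M)"
    and cont: "\<And>\<omega>. \<omega> \<in> space M \<Longrightarrow> continuous_on {0..T} (\<lambda>t. X t \<omega>)"
  shows "(\<integral>\<^sup>+\<omega>. ennreal ((W_fun T a c (\<lambda>s. X s \<omega>))\<^sup>2) \<partial>M) =
    ennreal (1 / T) * (\<integral>\<^sup>+s. ennreal (exp (2 * c * s)) * (\<integral>\<^sup>+\<omega>. ennreal (exp (2 * a * X s \<omega>)) \<partial>M) \<partial>lebesgue_on {0..T})"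
proof -
  let ?L = "lebesgue_on {0..T}"
  interpret L: finite_measure ?L by (rule finite_measure_lebesgue_on_Icc)
  interpret M: sigma_finite_measure M by fact
  interpret P: pair_sigma_finite M ?L ..
  note [measurable] = measurable_path_swap[OF X] X
  have [measurable]: "(\<lambda>s. 2 * c * s) \<in> borel_measurable ?L" by (rule borel_measurable_lebesgue_on) simp
  have "(\<integral>\<^sup>+\<omega>. ennreal ((W_fun T a c (\<lambda>s. X s \<omega>))\<^sup>2) \<partial>M) = (\<integral>\<^sup>+\<omega>. ennreal (1 / T) * (\<integral>\<^sup>+s. ennreal (exp (2 * c * s)) * ennreal (exp (2 * a * X s \<omega>)) \<partial>?L) \<partial>M)"
  proof (rule nn_integral_cong)
    fix \<omega> assume \<omega>: "\<omega> \<in> space M"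
    have "continuous_on {0..T} (\<lambda>s. exp (2 * a * X s \<omega> + 2 * c * s))"
      using cont[OF \<omega>] by (intro continuous_intros)
    then have "bounded ((\<lambda>s. exp (2 * a * X s \<omega> + 2 * c * s)) ` {0..T})"
      by (intro compact_imp_bounded compact_continuous_image compact_Icc)
    then obtain K where K: "\<And>s. s \<in> {0..T} \<Longrightarrow> norm (exp (2 * a * X s \<omega> + 2 * c * s)) \<le> K"
      unfolding bounded_iff by blast
    have "integrable ?L (\<lambda>s. exp (2 * a * X s \<omega> + 2 * c * s))"
      by (rule integrable_lebesgue_on_bounded[OF _ K]) (use \<omega> in measurable)
    then have "ennreal (\<integral>s. exp (2 * a * X s \<omega> + 2 * c * s) \<partial>?L) = (\<integral>\<^sup>+s. ennreal (exp (2 * a * X s \<omega> + 2 * c * s)) \<partial>?L)"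
      by (intro nn_integral_eq_integral[symmetric]) auto
    also have "\<dots> = (\<integral>\<^sup>+s. ennreal (exp (2 * c * s)) * ennreal (exp (2 * a * X s \<omega>)) \<partial>?L)"
      by (intro nn_integral_cong) (simp add: mult_exp_exp add.commute flip: ennreal_mult)
    finally show "ennreal ((W_fun T a c (\<lambda>s. X s \<omega>))\<^sup>2) = ennreal (1 / T) * (\<integral>\<^sup>+s. ennreal (exp (2 * c * s)) * ennreal (exp (2 * a * X s \<omega>)) \<partial>?L)"
      unfolding W_fun_square[OF T] using T by (subst ennreal_mult) auto
  qed
  also have "\<dots> = ennreal (1 / T) * (\<integral>\<^sup>+\<omega>. \<integral>\<^sup>+s. ennreal (exp (2 * c * s)) * ennreal (exp (2 * a * X s \<omega>)) \<partial>?L \<partial>M)"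
    by (rule nn_integral_cmult) measurable
  also have "(\<integral>\<^sup>+\<omega>. \<integral>\<^sup>+s. ennreal (exp (2 * c * s)) * ennreal (exp (2 * a * X s \<omega>)) \<partial>?L \<partial>M) =
    (\<integral>\<^sup>+s. \<integral>\<^sup>+\<omega>. ennreal (exp (2 * c * s)) * ennreal (exp (2 * a * X s \<omega>)) \<partial>M \<partial>?L)"
    by (rule P.Fubini'[symmetric]) (simp add: split_beta')
  also have "\<dots> = (\<integral>\<^sup>+s. ennreal (exp (2 * c * s)) * (\<integral>\<^sup>+\<omega>. ennreal (exp (2 * a * X s \<omega>)) \<partial>M) \<partial>?L)"
    by (intro nn_integral_cong nn_integral_cmult) measurable
  finally show ?thesis .
qed

text \<open>The last conclusion expresses the expectation through the exponential moments at single
  times alone. Processes on different sample spaces can therefore be compared by comparing these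
  moments.\<close>

lemma integral_W_fun_square:
  assumes T: "0 < T" and M: "sigma_finite_measure M"
    and X: "case_prod X \<in> borel_measurable (lebesgue_on {0..T} \<Otimes>\<^sub>M M)"
    and cont: "\<And>\<omega>. \<omega> \<in> space M \<Longrightarrow> continuous_on {0..T} (\<lambda>t. X t \<omega>)"
    and e: "\<And>s. s \<in> {0..T} \<Longrightarrow> (\<integral>\<^sup>+\<omega>. ennreal (exp (2 * a * X s \<omega>)) \<partial>M) \<le> ennreal (exp (K * s))"
  shows "integrable M (\<lambda>\<omega>. (W_fun T a c (\<lambda>s. X s \<omega>))\<^sup>2)"
    "(\<integral>\<omega>. (W_fun T a c (\<lambda>s. X s \<omega>))\<^sup>2 \<partial>M) \<le> exp_quot ((2 * c + K) * T)"
    "(\<integral>\<omega>. (W_fun T a c (\<lambda>s. X s \<omega>))\<^sup>2 \<partial>M) = enn2real (ennreal (1 / T) * (\<integral>\<^sup>+s. ennreal (exp (2 * c * s)) * (\<integral>\<^sup>+\<omega>. ennreal (exp (2 * a * X s \<omega>)) \<partial>M) \<partial>lebesgue_on {0..T}))"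
proof -
  have eq: "(\<integral>\<^sup>+\<omega>. ennreal ((W_fun T a c (\<lambda>s. X s \<omega>))\<^sup>2) \<partial>M) =
    ennreal (1 / T) * (\<integral>\<^sup>+s. ennreal (exp (2 * c * s)) * (\<integral>\<^sup>+\<omega>. ennreal (exp (2 * a * X s \<omega>)) \<partial>M) \<partial>lebesgue_on {0..T})"
    by (rule nn_integral_W_fun_square[OF T M X cont])
  have eq0: "0 \<le> exp_quot z" for z
    by (auto simp: exp_quot_def zero_le_divide_iff)
  have "(\<integral>\<^sup>+s. ennreal (exp (2 * c * s)) * (\<integral>\<^sup>+\<omega>. ennreal (exp (2 * a * X s \<omega>)) \<partial>M) \<partial>lebesgue_on {0..T}) \<le> (\<integral>\<^sup>+s. ennreal (exp ((2 * c + K) * s)) \<partial>lebesgue_on {0..T})"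
  proof (rule nn_integral_mono)
    fix s assume "s \<in> space (lebesgue_on {0..T})"
    then have "ennreal (exp (2 * c * s)) * (\<integral>\<^sup>+\<omega>. ennreal (exp (2 * a * X s \<omega>)) \<partial>M) \<le> ennreal (exp (2 * c * s)) * ennreal (exp (K * s))"
      by (intro mult_left_mono e) auto
    also have "\<dots> = ennreal (exp ((2 * c + K) * s))" by (simp add: mult_exp_exp distrib_right flip: ennreal_mult)
    finally show "ennreal (exp (2 * c * s)) * (\<integral>\<^sup>+\<omega>. ennreal (exp (2 * a * X s \<omega>)) \<partial>M) \<le> ennreal (exp ((2 * c + K) * s))" .
  qed
  also have "\<dots> = ennreal (T * exp_quot ((2 * c + K) * T))" by (rule nn_integral_lebesgue_on_exp[OF T])
  finally have "(\<integral>\<^sup>+\<omega>. ennreal ((W_fun T a c (\<lambda>s. X s \<omega>))\<^sup>2) \<partial>M) \<le> ennreal (1 / T) * ennreal (T * exp_quot ((2 * c + K) * T))"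
    unfolding eq by (intro mult_left_mono) auto
  also have "\<dots> = ennreal (exp_quot ((2 * c + K) * T))" using T eq0 by (simp flip: ennreal_mult)
  finally have le: "(\<integral>\<^sup>+\<omega>. ennreal ((W_fun T a c (\<lambda>s. X s \<omega>))\<^sup>2) \<partial>M) \<le> ennreal (exp_quot ((2 * c + K) * T))" .
  note m = measurable_W_fun[OF X, of a c]
  show i: "integrable M (\<lambda>\<omega>. (W_fun T a c (\<lambda>s. X s \<omega>))\<^sup>2)"
    using le by (intro integrableI_nonneg m) (auto intro: le_less_trans)
  have "ennreal (\<integral>\<omega>. (W_fun T a c (\<lambda>s. X s \<omega>))\<^sup>2 \<partial>M) \<le> ennreal (exp_quot ((2 * c + K) * T))"
    using le by (subst (asm) nn_integral_eq_integral[OF i]) auto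
  then show "(\<integral>\<omega>. (W_fun T a c (\<lambda>s. X s \<omega>))\<^sup>2 \<partial>M) \<le> exp_quot ((2 * c + K) * T)" using eq0 by simp
  show "(\<integral>\<omega>. (W_fun T a c (\<lambda>s. X s \<omega>))\<^sup>2 \<partial>M) = enn2real (ennreal (1 / T) * (\<integral>\<^sup>+s. ennreal (exp (2 * c * s)) * (\<integral>\<^sup>+\<omega>. ennreal (exp (2 * a * X s \<omega>)) \<partial>M) \<partial>lebesgue_on {0..T}))"
    unfolding eq[symmetric] using m by (intro integral_eq_nn_integral) auto
qed

lemma measurable_pair_lebesgue_on:
  assumes "f \<in> borel_measurable (borel \<Otimes>\<^sub>M M)"
  shows "f \<in> borel_measurable (lebesgue_on {0..T::real} \<Otimes>\<^sub>M M)"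
proof -
  have "(\<lambda>p. (fst p, snd p)) \<in> lebesgue_on {0..T::real} \<Otimes>\<^sub>M M \<rightarrow>\<^sub>M borel \<Otimes>\<^sub>M M"
    by (intro measurable_Pair measurable_compose[OF measurable_fst borel_measurable_lebesgue_on] measurable_snd) simp
  from measurable_compose[OF this assms] show ?thesis by simp
qed

lemma drifted_brownian_path:
  assumes bm: "drifted_brownian_motion N d \<sigma>2 Y"
  shows "case_prod Y \<in> borel_measurable (lebesgue_on {0..T} \<Otimes>\<^sub>M N)"
    "\<omega> \<in> space N \<Longrightarrow> continuous_on {0..T} (\<lambda>t. Y t \<omega>)"
proof -
  note bm' = bm[unfolded drifted_brownian_motion_def]
  let ?B = "\<lambda>t \<omega>. Y t \<omega> - d * t"
  have "(\<lambda>p. ?B (max 0 (fst p)) (snd p) + d * fst p) \<in> borel_measurable (lebesgue_on {0..T} \<Otimes>\<^sub>M N)"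
    using brownian_motion_jointly_measurable[OF bm'] by (intro measurable_pair_lebesgue_on borel_measurable_add) auto
  then show "case_prod Y \<in> borel_measurable (lebesgue_on {0..T} \<Otimes>\<^sub>M N)"
    by (rule measurable_cong[THEN iffD1, rotated]) (auto simp: space_pair_measure)
  assume "\<omega> \<in> space N"
  then have "continuous_on {0..T} (\<lambda>t. ?B t \<omega> + d * t)"
    by (intro continuous_intros continuous_on_subset[OF brownian_motionD(3)[OF bm']]) auto
  then show "continuous_on {0..T} (\<lambda>t. Y t \<omega>)" by simp
qed

lemma W_fun_drift: "W_fun T a c (\<lambda>s. x s + d * s) = W_fun T a (c + a * d) x"
  unfolding W_fun_def by (intro arg_cong[where f=sqrt] arg_cong2[where f="(*)"] Bochner_Integration.integral_cong refl) (simp add: algebra_simps)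

lemma brownian_W_fun:
  assumes T: "0 < T" and \<sigma>: "0 < \<sigma>2" and bm: "brownian_motion N \<sigma>2 B"
  shows "integrable N (\<lambda>\<omega>. (W_fun T a c (\<lambda>s. B s \<omega>))\<^sup>2)"
    "(\<integral>\<omega>. (W_fun T a c (\<lambda>s. B s \<omega>))\<^sup>2 \<partial>N) = exp_quot (2 * a\<^sup>2 * \<sigma>2 * T + 2 * c * T)"
proof -
  interpret N: prob_space N by (rule brownian_motionD(1)[OF bm])
  have dbm: "drifted_brownian_motion N 0 \<sigma>2 B" using bm by (simp add: drifted_brownian_motion_def)
  note path = drifted_brownian_path[OF dbm, where T=T]
  have e: "(\<integral>\<^sup>+\<omega>. ennreal (exp (2 * a * B s \<omega>)) \<partial>N) = ennreal (exp (2 * a\<^sup>2 * \<sigma>2 * s))" if "s \<in> {0..T}" for s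
    using brownian_motion_mgf[OF bm \<sigma>, of s "2 * a"] that by (simp add: power_mult_distrib mult.assoc)
  have W: "integrable N (\<lambda>\<omega>. (W_fun T a c (\<lambda>s. B s \<omega>))\<^sup>2)"
    "(\<integral>\<omega>. (W_fun T a c (\<lambda>s. B s \<omega>))\<^sup>2 \<partial>N) = enn2real (ennreal (1 / T) * (\<integral>\<^sup>+s. ennreal (exp (2 * c * s)) * (\<integral>\<^sup>+\<omega>. ennreal (exp (2 * a * B s \<omega>)) \<partial>N) \<partial>lebesgue_on {0..T}))"
    by (rule integral_W_fun_square(1,3)[OF T N.sigma_finite_measure_axioms path eq_refl[OF e]], assumption+)+
  show "integrable N (\<lambda>\<omega>. (W_fun T a c (\<lambda>s. B s \<omega>))\<^sup>2)" by (rule W(1))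
  have "(\<integral>\<^sup>+s. ennreal (exp (2 * c * s)) * (\<integral>\<^sup>+\<omega>. ennreal (exp (2 * a * B s \<omega>)) \<partial>N) \<partial>lebesgue_on {0..T}) =
    (\<integral>\<^sup>+s. ennreal (exp ((2 * c + 2 * a\<^sup>2 * \<sigma>2) * s)) \<partial>lebesgue_on {0..T})"
    by (intro nn_integral_cong) (simp add: e mult_exp_exp distrib_right flip: ennreal_mult)
  also have "\<dots> = ennreal (T * exp_quot ((2 * c + 2 * a\<^sup>2 * \<sigma>2) * T))" by (rule nn_integral_lebesgue_on_exp[OF T])
  finally have "(\<integral>\<omega>. (W_fun T a c (\<lambda>s. B s \<omega>))\<^sup>2 \<partial>N) = enn2real (ennreal (1 / T) * ennreal (T * exp_quot ((2 * c + 2 * a\<^sup>2 * \<sigma>2) * T)))"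
    by (subst W(2)) simp
  also have "\<dots> = exp_quot ((2 * c + 2 * a\<^sup>2 * \<sigma>2) * T)"
  proof -
    have "0 \<le> exp_quot z" for z by (auto simp: exp_quot_def zero_le_divide_iff)
    then show ?thesis using T by (simp flip: ennreal_mult)
  qed
  finally show "(\<integral>\<omega>. (W_fun T a c (\<lambda>s. B s \<omega>))\<^sup>2 \<partial>N) = exp_quot (2 * a\<^sup>2 * \<sigma>2 * T + 2 * c * T)"
    by (simp add: distrib_right add.commute)
qed

lemma telegraph_path:
  assumes X: "telegraph_process M v0 w0 lam X" and v: "v0 + w0 \<noteq> 0" and lam: "0 < lam"
  shows "case_prod X \<in> borel_measurable (lebesgue_on {0..T} \<Otimes>\<^sub>M M)"
    "\<omega> \<in> space M \<Longrightarrow> continuous_on {0..T} (\<lambda>t. X t \<omega>)"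
proof -
  obtain U \<tau> where [measurable]: "U \<in> borel_measurable M" "\<tau> \<in> M \<rightarrow>\<^sub>M seq_borel"
    and adm: "\<And>\<omega>. \<omega> \<in> space M \<Longrightarrow> admissible (\<tau> \<omega>)" "\<And>\<omega>. \<omega> \<in> space M \<Longrightarrow> U \<omega> \<in> {v0, - w0}"
    and eq: "\<And>\<omega> t. \<omega> \<in> space M \<Longrightarrow> 0 \<le> t \<Longrightarrow> X t \<omega> = (v0 - w0) / 2 * t + (U \<omega> - (v0 - w0) / 2) * tele (\<tau> \<omega>) t"
    and law: "distr M (borel \<Otimes>\<^sub>M seq_borel) (\<lambda>\<omega>. (U \<omega>, \<tau> \<omega>)) = two_point v0 (- w0) \<Otimes>\<^sub>M PiM UNIV (\<lambda>_. expo lam)"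
    using that by (rule telegraph_process_law[OF X v lam])
  have "(\<lambda>p. (v0 - w0) / 2 * fst p + (U (snd p) - (v0 - w0) / 2) * tele (\<tau> (snd p)) (fst p)) \<in> borel_measurable (lebesgue_on {0..T} \<Otimes>\<^sub>M M)"
    by (rule measurable_pair_lebesgue_on) measurable
  then show "case_prod X \<in> borel_measurable (lebesgue_on {0..T} \<Otimes>\<^sub>M M)"
    by (rule measurable_cong[THEN iffD1, rotated]) (auto simp: space_pair_measure eq)
  assume w: "\<omega> \<in> space M"
  have "continuous_on {0..T} (\<lambda>t. (v0 - w0) / 2 * t + (U \<omega> - (v0 - w0) / 2) * tele (\<tau> \<omega>) t)"
    by (intro continuous_intros continuous_on_tele)
  then show "continuous_on {0..T} (\<lambda>t. X t \<omega>)"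
    by (rule continuous_on_cong[THEN iffD1, rotated -1]) (auto simp: eq[OF w])
qed

text \<open>An identity rather than a bound, with the transforms of the unit-speed path left
  unevaluated. The velocities enter only through the drift factor and the half gap, which is what
  gives exact equality with the symmetric process even though the transforms themselves are only
  bounded from above.\<close>

lemma telegraph_exp_moment:
  assumes X: "telegraph_process M v0 w0 lam X" and v: "v0 + w0 \<noteq> 0" and lam: "0 < lam" and t: "0 \<le> t"
  shows "(\<integral>\<^sup>+\<omega>. ennreal (exp (\<theta> * X t \<omega>)) \<partial>M) = ennreal (exp (\<theta> * ((v0 - w0) / 2) * t)) *
    (((\<integral>\<^sup>+\<tau>. ennreal (exp (\<theta> * ((v0 + w0) / 2) * tele \<tau> t)) \<partial>expo_seq lam) + (\<integral>\<^sup>+\<tau>. ennreal (exp (- (\<theta> * ((v0 + w0) / 2)) * tele \<tau> t)) \<partial>expo_seq lam)) / 2)"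
proof -
  interpret S: prob_space "expo_seq lam" using lam by (rule prob_space_expo_seq)
  let ?d = "(v0 - w0) / 2"
  obtain U \<tau> where [measurable]: "U \<in> borel_measurable M" "\<tau> \<in> M \<rightarrow>\<^sub>M seq_borel"
    and adm: "\<And>\<omega>. \<omega> \<in> space M \<Longrightarrow> admissible (\<tau> \<omega>)" "\<And>\<omega>. \<omega> \<in> space M \<Longrightarrow> U \<omega> \<in> {v0, - w0}"
    and eq: "\<And>\<omega> t. \<omega> \<in> space M \<Longrightarrow> 0 \<le> t \<Longrightarrow> X t \<omega> = (v0 - w0) / 2 * t + (U \<omega> - (v0 - w0) / 2) * tele (\<tau> \<omega>) t"
    and law: "distr M (borel \<Otimes>\<^sub>M seq_borel) (\<lambda>\<omega>. (U \<omega>, \<tau> \<omega>)) = two_point v0 (- w0) \<Otimes>\<^sub>M PiM UNIV (\<lambda>_. expo lam)"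
    using that by (rule telegraph_process_law[OF X v lam])
  have ne: "v0 \<noteq> - w0" using v by auto
  have "(\<integral>\<^sup>+\<omega>. ennreal (exp (\<theta> * X t \<omega>)) \<partial>M) = (\<integral>\<^sup>+\<omega>. ennreal (exp (\<theta> * ?d * t)) * ennreal (exp (\<theta> * (U \<omega> - ?d) * tele (\<tau> \<omega>) t)) \<partial>M)"
    using t by (intro nn_integral_cong) (simp add: eq mult_exp_exp algebra_simps flip: ennreal_mult)
  also have "\<dots> = ennreal (exp (\<theta> * ?d * t)) * (\<integral>\<^sup>+\<omega>. ennreal (exp (\<theta> * (U \<omega> - ?d) * tele (\<tau> \<omega>) t)) \<partial>M)"
    by (rule nn_integral_cmult) measurable
  also have "(\<integral>\<^sup>+\<omega>. ennreal (exp (\<theta> * (U \<omega> - ?d) * tele (\<tau> \<omega>) t)) \<partial>M) =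
      (\<integral>\<^sup>+z. ennreal (exp (\<theta> * (fst z - ?d) * tele (snd z) t)) \<partial>(two_point v0 (- w0) \<Otimes>\<^sub>M expo_seq lam))"
    unfolding law[symmetric] by (subst nn_integral_distr) auto
  also have "\<dots> = (\<integral>\<^sup>+u. \<integral>\<^sup>+\<tau>. ennreal (exp (\<theta> * (u - ?d) * tele \<tau> t)) \<partial>expo_seq lam \<partial>two_point v0 (- w0))"
    by (subst S.nn_integral_fst[symmetric]) auto
  also have "\<dots> = ((\<integral>\<^sup>+\<tau>. ennreal (exp (\<theta> * (v0 - ?d) * tele \<tau> t)) \<partial>expo_seq lam) + (\<integral>\<^sup>+\<tau>. ennreal (exp (\<theta> * (- w0 - ?d) * tele \<tau> t)) \<partial>expo_seq lam)) / 2"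
    by (rule nn_integral_two_point[OF ne]) measurable
  also have "v0 - ?d = (v0 + w0) / 2" by (simp add: field_simps)
  also have "- w0 - ?d = - ((v0 + w0) / 2)" by (simp add: field_simps)
  finally show ?thesis by simp
qed

lemma telegraph_exp_moment_le:
  assumes X: "telegraph_process M v0 w0 lam X" and v: "v0 + w0 \<noteq> 0" and lam: "0 < lam" and t: "0 \<le> t"
  shows "(\<integral>\<^sup>+\<omega>. ennreal (exp (\<theta> * X t \<omega>)) \<partial>M) \<le>
    ennreal (exp ((\<theta> * ((v0 - w0) / 2) + (sqrt (lam\<^sup>2 + (\<theta> * ((v0 + w0) / 2))\<^sup>2) - lam)) * t))"
proof -
  let ?w = "\<theta> * ((v0 + w0) / 2)"
  have "((\<integral>\<^sup>+\<tau>. ennreal (exp (?w * tele \<tau> t)) \<partial>expo_seq lam) + (\<integral>\<^sup>+\<tau>. ennreal (exp (- ?w * tele \<tau> t)) \<partial>expo_seq lam)) / 2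
    \<le> (ennreal (tele_mgf lam ?w t) + ennreal (tele_mgf lam (- ?w) t)) / 2"
    by (intro divide_right_mono_ennreal add_mono nn_integral_exp_tele_le lam t)
  also have "\<dots> = ennreal ((tele_mgf lam ?w t + tele_mgf lam (- ?w) t) / 2)"
    using tele_mgf_nonneg[OF lam t] by (simp flip: ennreal_plus add: ennreal_divide_numeral)
  also have "\<dots> \<le> ennreal (exp ((sqrt (lam\<^sup>2 + ?w\<^sup>2) - lam) * t))"
    by (intro ennreal_leI tele_mgf_symmetrized_le lam t)
  finally have "(\<integral>\<^sup>+\<omega>. ennreal (exp (\<theta> * X t \<omega>)) \<partial>M) \<le> ennreal (exp (\<theta> * ((v0 - w0) / 2) * t)) * ennreal (exp ((sqrt (lam\<^sup>2 + ?w\<^sup>2) - lam) * t))"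
    unfolding telegraph_exp_moment[OF X v lam t] by (intro mult_left_mono) auto
  also have "\<dots> = ennreal (exp ((\<theta> * ((v0 - w0) / 2) + (sqrt (lam\<^sup>2 + ?w\<^sup>2) - lam)) * t))"
    by (simp add: mult_exp_exp distrib_right flip: ennreal_mult)
  finally show ?thesis .
qed

text \<open>Holds for arbitrary \<open>f\<close>: a simple function below \<open>f\<close> on the
  image space pulls back to one below the composition. This lets a cost estimate on the construction
  space be transported to the coupling although the distance need not be measurable there.\<close>

lemma nn_integral_distr_le:
  assumes T: "T \<in> M \<rightarrow>\<^sub>M N"
  shows "(\<integral>\<^sup>+x. f x \<partial>distr M N T) \<le> (\<integral>\<^sup>+x. f (T x) \<partial>M)"
  unfolding nn_integral_def[of "distr M N T"]
proof (rule SUP_least, clarsimp)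
  fix g assume g: "simple_function (distr M N T) g" "g \<le> f"
  have m: "g \<in> borel_measurable (distr M N T)" by (rule borel_measurable_simple_function[OF g(1)])
  have "integral\<^sup>S (distr M N T) g = (\<integral>\<^sup>+x. g x \<partial>distr M N T)"
    by (rule nn_integral_eq_simple_integral[symmetric, OF g(1)])
  also have "\<dots> = (\<integral>\<^sup>+x. g (T x) \<partial>M)" by (rule nn_integral_distr[OF T m])
  also have "\<dots> \<le> (\<integral>\<^sup>+x. f (T x) \<partial>M)" using g(2) by (intro nn_integral_mono) (auto simp: le_fun_def)
  finally show "integral\<^sup>S (distr M N T) g \<le> (\<integral>\<^sup>+x. f (T x) \<partial>M)" .
qed

lemma wasserstein2_le_coupling:
  assumes P: "prob_space P" and x [measurable]: "x \<in> P \<rightarrow>\<^sub>M L2_ave T" and y [measurable]: "y \<in> P \<rightarrow>\<^sub>M L2_ave T"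
    and law: "\<mu> = distr P (L2_ave T) x" "\<nu> = distr P (L2_ave T) y"
    and cost: "(\<integral>\<^sup>+p. ennreal ((ave_norm T (\<lambda>s. x p s - y p s))\<^sup>2) \<partial>P) \<le> ennreal c" and c: "0 \<le> c"
  shows "wasserstein2 T \<mu> \<nu> \<le> ennreal (sqrt c)"
proof -
  interpret prob_space P by fact
  define \<gamma> where "\<gamma> = distr P (L2_ave T \<Otimes>\<^sub>M L2_ave T) (\<lambda>p. (x p, y p))"
  have "\<gamma> \<in> couplings \<mu> \<nu>"
    unfolding couplings_def
  proof safe
    show "prob_space \<gamma>" unfolding \<gamma>_def by (rule prob_space_distr) measurable
    show "A \<in> sets (\<mu> \<Otimes>\<^sub>M \<nu>)" if "A \<in> sets \<gamma>" for A using that by (simp add: \<gamma>_def law cong: sets_pair_measure_cong)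
    show "A \<in> sets \<gamma>" if "A \<in> sets (\<mu> \<Otimes>\<^sub>M \<nu>)" for A using that by (simp add: \<gamma>_def law cong: sets_pair_measure_cong)
    have "distr \<gamma> \<mu> fst = distr \<gamma> (L2_ave T) fst" by (rule distr_cong) (auto simp: law)
    also have "\<dots> = \<mu>" unfolding \<gamma>_def law by (subst distr_distr) (auto simp: comp_def)
    finally show "distr \<gamma> \<mu> fst = \<mu>" .
    have "distr \<gamma> \<nu> snd = distr \<gamma> (L2_ave T) snd" by (rule distr_cong) (auto simp: law)
    also have "\<dots> = \<nu>" unfolding \<gamma>_def law by (subst distr_distr) (auto simp: comp_def)
    finally show "distr \<gamma> \<nu> snd = \<nu>" .
  qed
  moreover have "(\<integral>\<^sup>+ p. ennreal ((ave_norm T (\<lambda>s. fst p s - snd p s))\<^sup>2) \<partial>\<gamma>) \<le> ennreal c"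
    unfolding \<gamma>_def by (rule order_trans[OF nn_integral_distr_le]) (use cost in auto)
  then have "ennreal_sqrt (\<integral>\<^sup>+ p. ennreal ((ave_norm T (\<lambda>s. fst p s - snd p s))\<^sup>2) \<partial>\<gamma>) \<le> ennreal (sqrt c)"
  proof (cases "\<integral>\<^sup>+ p. ennreal ((ave_norm T (\<lambda>s. fst p s - snd p s))\<^sup>2) \<partial>\<gamma>")
    case (real r)
    then show ?thesis using \<open>(\<integral>\<^sup>+ p. ennreal ((ave_norm T (\<lambda>s. fst p s - snd p s))\<^sup>2) \<partial>\<gamma>) \<le> ennreal c\<close> c
      by (simp add: ennreal_sqrt_def)
  qed (use c in \<open>auto simp: top_unique\<close>)
  ultimately show ?thesis unfolding wasserstein2_def by (rule INF_lower2)
qed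

text \<open>The Brownian path is left untouched and merely viewed on the larger space; only the
  telegraph path is exchanged for a rebuilt one with the same law. The common drift cancels in the
  difference of the two paths.\<close>

lemma telegraph_brownian_wasserstein:
  assumes X: "telegraph_process M v0 w0 lam X" and v: "v0 + w0 \<noteq> 0" and lam: "0 < lam"
    and Y: "drifted_brownian_motion N d \<sigma>2 Y" and T: "0 < T" and L: "0 < L"
    and d: "d = (v0 - w0) / (2 * L)" and \<sigma>: "\<sigma>2 = ((v0 + w0) / 2)\<^sup>2 / lam / L\<^sup>2"
  shows "wasserstein2 T (path_law T M (\<lambda>s \<omega>. X s \<omega> / L)) (path_law T N Y) \<le> ennreal (sqrt (\<sigma>2 / lam * (24 + 12 * sqrt (lam * T))))"
proof -
  define B where "B t \<omega> = Y t \<omega> - d * t" for t \<omega>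
  have bm: "brownian_motion N \<sigma>2 B" using Y by (simp add: drifted_brownian_motion_def B_def[abs_def])
  have \<sigma>0: "0 < \<sigma>2" using v lam L by (simp add: \<sigma>)
  define d' where "d' = (v0 - w0) / 2"
  \<comment> \<open>The reciprocal of the rescaled velocity relative to the mean velocity. Its sign
    depends on the initial state, so that the rebuilt path follows the Brownian motion whichever
    velocity it starts with.\<close>
  define \<kappa> where "\<kappa> u = L / (u - d')" for u
  have ne: "v0 \<noteq> - w0" using v by auto
  have \<kappa>_eq: "(\<kappa> u)\<^sup>2 * \<sigma>2 = 1 / lam" if "u \<in> {v0, - w0}" for u
  proof -
    have "(u - d')\<^sup>2 = ((v0 + w0) / 2)\<^sup>2"
      using that by (auto simp: d'_def field_simps power2_eq_square)
    moreover have "((v0 + w0) / 2)\<^sup>2 \<noteq> 0" using v by simp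
    moreover have "(\<kappa> u)\<^sup>2 * \<sigma>2 = L\<^sup>2 / (u - d')\<^sup>2 * (((v0 + w0) / 2)\<^sup>2 / lam / L\<^sup>2)"
      by (simp only: \<kappa>_def \<sigma> power_divide)
    ultimately have "(\<kappa> u)\<^sup>2 * \<sigma>2 = L\<^sup>2 / ((v0 + w0) / 2)\<^sup>2 * (((v0 + w0) / 2)\<^sup>2 / lam / L\<^sup>2)" by (simp only:)
    then show ?thesis using L \<open>((v0 + w0) / 2)\<^sup>2 \<noteq> 0\<close> by (simp del: power_divide)
  qed
  have \<kappa>m [measurable]: "\<kappa> \<in> borel_measurable borel" unfolding \<kappa>_def[abs_def] by measurable
  let ?K = "coupling_noise v0 (- w0) lam"
  interpret N: prob_space N by (rule brownian_motionD(1)[OF bm])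
  interpret D: prob_space "two_point v0 (- w0)" by (rule prob_space_two_point)
  interpret S1: prob_space "expo_seq (lam / 2)" using lam by (intro prob_space_expo_seq) simp
  interpret S2: prob_space "expo_seq (2 * lam)" using lam by (intro prob_space_expo_seq) simp
  interpret S: pair_prob_space "expo_seq (lam / 2)" "expo_seq (2 * lam)" ..
  interpret K: pair_prob_space "two_point v0 (- w0)" "expo_seq (lam / 2) \<Otimes>\<^sub>M expo_seq (2 * lam)" ..
  interpret P: pair_prob_space N ?K ..
  interpret Lb: finite_measure "lebesgue_on {0..T}" by (rule finite_measure_lebesgue_on_Icc)
  interpret PL: pair_sigma_finite "N \<Otimes>\<^sub>M ?K" "lebesgue_on {0..T}" ..
  let ?P = "N \<Otimes>\<^sub>M ?K"
  define \<rho> where "\<rho> p = rebuilt (\<kappa> (fst (snd p))) (\<lambda>t. B (max 0 t) (fst p)) (fst (snd (snd p))) (snd (snd (snd p)))" for p :: "'b \<times> real \<times> (nat \<Rightarrow> real) \<times> (nat \<Rightarrow> real)"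
  have m\<rho>: "(\<lambda>p. (fst (snd p), \<rho> p)) \<in> ?P \<rightarrow>\<^sub>M borel \<Otimes>\<^sub>M seq_borel"
    using measurable_rebuilt[OF bm \<kappa>m] unfolding split_beta' \<rho>_def by (simp cong: measurable_cong_sets)
  have law\<rho>: "distr ?P (borel \<Otimes>\<^sub>M seq_borel) (\<lambda>p. (fst (snd p), \<rho> p)) = two_point v0 (- w0) \<Otimes>\<^sub>M expo_seq lam"
    using rebuilt_law[OF bm \<sigma>0 lam ne \<kappa>m \<kappa>_eq] unfolding split_beta' \<rho>_def by simp
  \<comment> \<open>Writing the path as a function of initial velocity and holding times transfers
    the equality of their joint laws to the path laws.\<close>
  define Z where "Z s z = (d' * s + (fst z - d') * tele (snd z) s) / L" for s and z :: "real \<times> (nat \<Rightarrow> real)"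
  have Zm: "(\<lambda>p. Z (fst p) (snd p)) \<in> borel_measurable (borel \<Otimes>\<^sub>M (borel \<Otimes>\<^sub>M seq_borel))"
    unfolding Z_def by measurable
  have Zpath: "(\<lambda>z s. complex_of_real (Z s z)) \<in> borel \<Otimes>\<^sub>M seq_borel \<rightarrow>\<^sub>M L2_ave T"
  proof (rule measurable_path[OF T])
    show "case_prod Z \<in> borel_measurable (lebesgue_on {0..T} \<Otimes>\<^sub>M (borel \<Otimes>\<^sub>M seq_borel))"
      using measurable_pair_lebesgue_on[OF Zm] by (simp add: split_beta')
    show "continuous_on {0..T} (\<lambda>s. Z s z)" for z
      unfolding Z_def using L by (intro continuous_intros continuous_on_tele) auto
  qed
  obtain U \<tau> where U [measurable]: "U \<in> borel_measurable M" and \<tau> [measurable]: "\<tau> \<in> M \<rightarrow>\<^sub>M seq_borel"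
    and adm: "\<And>\<omega>. \<omega> \<in> space M \<Longrightarrow> admissible (\<tau> \<omega>)" "\<And>\<omega>. \<omega> \<in> space M \<Longrightarrow> U \<omega> \<in> {v0, - w0}"
    and eq: "\<And>\<omega> t. \<omega> \<in> space M \<Longrightarrow> 0 \<le> t \<Longrightarrow> X t \<omega> = (v0 - w0) / 2 * t + (U \<omega> - (v0 - w0) / 2) * tele (\<tau> \<omega>) t"
    and law: "distr M (borel \<Otimes>\<^sub>M seq_borel) (\<lambda>\<omega>. (U \<omega>, \<tau> \<omega>)) = two_point v0 (- w0) \<Otimes>\<^sub>M PiM UNIV (\<lambda>_. expo lam)"
    using that by (rule telegraph_process_law[OF X v lam])
  note eq = eq[folded d'_def]
  have mU: "(\<lambda>\<omega>. (U \<omega>, \<tau> \<omega>)) \<in> M \<rightarrow>\<^sub>M borel \<Otimes>\<^sub>M seq_borel" by measurable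
  have XL: "case_prod (\<lambda>s \<omega>. X s \<omega> / L) \<in> borel_measurable (lebesgue_on {0..T} \<Otimes>\<^sub>M M)"
    using telegraph_path(1)[OF X v lam, of T] by (simp add: split_beta')
  have "path_law T M (\<lambda>s \<omega>. X s \<omega> / L) = path_law T M (\<lambda>s \<omega>. Z s (U \<omega>, \<tau> \<omega>))"
  proof (rule path_law_cong)
    show "(\<lambda>\<omega> s. complex_of_real (X s \<omega> / L)) \<in> M \<rightarrow>\<^sub>M L2_ave T"
      using telegraph_path(2)[OF X v lam] L by (intro measurable_path[OF T XL]) (auto intro!: continuous_intros)
    show "(\<lambda>\<omega> s. complex_of_real (Z s (U \<omega>, \<tau> \<omega>))) \<in> M \<rightarrow>\<^sub>M L2_ave T"
      by (rule measurable_compose[OF mU Zpath])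
  qed (simp add: eq Z_def)
  also have "\<dots> = distr (two_point v0 (- w0) \<Otimes>\<^sub>M expo_seq lam) (L2_ave T) (\<lambda>z s. complex_of_real (Z s z))"
    unfolding path_law_def law[symmetric] by (subst distr_distr[OF Zpath mU]) (simp add: comp_def)
  also have "\<dots> = distr ?P (L2_ave T) (\<lambda>p s. complex_of_real (Z s (fst (snd p), \<rho> p)))"
    unfolding law\<rho>[symmetric] by (subst distr_distr[OF Zpath m\<rho>]) (simp add: comp_def)
  finally have \<mu>: "path_law T M (\<lambda>s \<omega>. X s \<omega> / L) = distr ?P (L2_ave T) (\<lambda>p s. complex_of_real (Z s (fst (snd p), \<rho> p)))" .
  have Ypath: "(\<lambda>\<omega> s. complex_of_real (Y s \<omega>)) \<in> N \<rightarrow>\<^sub>M L2_ave T"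
    by (rule measurable_path[OF T drifted_brownian_path[OF Y]])
  have "distr ?P N fst = N"
    by (rule prob_space.distr_pair_fst[OF K.prob_space_axioms])
  then have "path_law T N Y = distr (distr ?P N fst) (L2_ave T) (\<lambda>\<omega> s. complex_of_real (Y s \<omega>))"
    by (simp add: path_law_def)
  also have "\<dots> = distr ?P (L2_ave T) (\<lambda>p s. complex_of_real (Y s (fst p)))"
    by (subst distr_distr[OF Ypath measurable_fst]) (simp add: comp_def)
  finally have \<nu>: "path_law T N Y = distr ?P (L2_ave T) (\<lambda>p s. complex_of_real (Y s (fst p)))" .
  let ?c = "\<sigma>2 / lam * (24 + 12 * sqrt (lam * T))"
  have cancel: "ennreal (1 / T) * (ennreal z * ennreal T) = ennreal z" if "0 \<le> z" for z
    using T that by (simp flip: ennreal_mult)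
  have c0: "0 \<le> ?c" using \<sigma>0 lam T by simp
  have diff: "Z s (fst (snd p), \<rho> p) - Y s (fst p) = tele (\<rho> p) s / \<kappa> (fst (snd p)) - B s (fst p)" for s p
    using L by (simp add: Z_def B_def \<kappa>_def d d'_def add_divide_distrib)
  have int_m: "(\<lambda>q. ennreal ((Z (snd q) (fst (snd (fst q)), \<rho> (fst q)) - Y (snd q) (fst (fst q)))\<^sup>2)) \<in> borel_measurable (?P \<Otimes>\<^sub>M lebesgue_on {0..T})"
  proof -
    have fs: "(\<lambda>q. snd q) \<in> borel_measurable (?P \<Otimes>\<^sub>M lebesgue_on {0..T})"
      by (rule measurable_compose[OF measurable_snd borel_measurable_lebesgue_on]) simp
    have "(\<lambda>q. Z (snd q) (fst (snd (fst q)), \<rho> (fst q))) \<in> borel_measurable (?P \<Otimes>\<^sub>M lebesgue_on {0..T})"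
      using measurable_compose[OF measurable_Pair[OF fs measurable_compose[OF measurable_fst m\<rho>]] Zm] by simp
    moreover have "(\<lambda>q. Y (snd q) (fst (fst q))) \<in> borel_measurable (?P \<Otimes>\<^sub>M lebesgue_on {0..T})"
      using measurable_compose[OF measurable_Pair[OF measurable_snd measurable_compose[OF measurable_fst measurable_fst]] drifted_brownian_path(1)[OF Y]]
      by simp
    ultimately show ?thesis by measurable
  qed
  show ?thesis
  proof (rule wasserstein2_le_coupling[OF P.prob_space_axioms _ _ \<mu> \<nu> _ c0])
    show xm: "(\<lambda>p s. complex_of_real (Z s (fst (snd p), \<rho> p))) \<in> ?P \<rightarrow>\<^sub>M L2_ave T"
      by (rule measurable_compose[OF m\<rho> Zpath])
    show ym: "(\<lambda>p s. complex_of_real (Y s (fst p))) \<in> ?P \<rightarrow>\<^sub>M L2_ave T"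
      by (rule measurable_compose[OF measurable_fst Ypath])
    have "(\<integral>\<^sup>+p. ennreal ((ave_norm T (\<lambda>s. complex_of_real (Z s (fst (snd p), \<rho> p)) - complex_of_real (Y s (fst p))))\<^sup>2) \<partial>?P) =
      (\<integral>\<^sup>+p. ennreal (1 / T) * (\<integral>\<^sup>+s. ennreal ((Z s (fst (snd p), \<rho> p) - Y s (fst p))\<^sup>2) \<partial>lebesgue_on {0..T}) \<partial>?P)"
    proof (rule nn_integral_cong)
      fix p assume p: "p \<in> space ?P"
      have "(\<lambda>s. complex_of_real (Z s (fst (snd p), \<rho> p)) - complex_of_real (Y s (fst p))) \<in> L2_ave_carrier T"
        using measurable_space[OF xm p] measurable_space[OF ym p] by (intro L2_ave_carrier_diff) (simp_all add: space_L2_ave)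
      from L2_ave_carrierD(2)[OF this]
      have i: "integrable (lebesgue_on {0..T}) (\<lambda>s. (Z s (fst (snd p), \<rho> p) - Y s (fst p))\<^sup>2)"
        by (simp flip: of_real_diff)
      have e: "(\<integral>\<^sup>+s. ennreal ((Z s (fst (snd p), \<rho> p) - Y s (fst p))\<^sup>2) \<partial>lebesgue_on {0..T}) =
        ennreal (\<integral>s. (Z s (fst (snd p), \<rho> p) - Y s (fst p))\<^sup>2 \<partial>lebesgue_on {0..T})"
        by (rule nn_integral_eq_integral[OF i]) simp
      have sq: "(cmod (complex_of_real (Z s (fst (snd p), \<rho> p)) - complex_of_real (Y s (fst p))))\<^sup>2 = (Z s (fst (snd p), \<rho> p) - Y s (fst p))\<^sup>2" for s
        by (simp flip: of_real_diff)
      show "ennreal ((ave_norm T (\<lambda>s. complex_of_real (Z s (fst (snd p), \<rho> p)) - complex_of_real (Y s (fst p))))\<^sup>2) =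
        ennreal (1 / T) * (\<integral>\<^sup>+s. ennreal ((Z s (fst (snd p), \<rho> p) - Y s (fst p))\<^sup>2) \<partial>lebesgue_on {0..T})"
        unfolding ave_norm_square[OF T] sq e using T by (subst ennreal_mult[symmetric]) auto
    qed
    also have "\<dots> = ennreal (1 / T) * (\<integral>\<^sup>+p. \<integral>\<^sup>+s. ennreal ((Z s (fst (snd p), \<rho> p) - Y s (fst p))\<^sup>2) \<partial>lebesgue_on {0..T} \<partial>?P)"
      by (rule nn_integral_cmult) (use Lb.borel_measurable_nn_integral_fst[OF int_m] in simp)
    \<comment> \<open>Exchanging the integrals reduces the averaged distance to second moments at
      fixed times, each at most the bound at time \<open>T\<close>.\<close>
    also have "\<dots> \<le> ennreal (1 / T) * (ennreal ?c * ennreal T)"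
    proof (rule mult_left_mono)
      have "(\<integral>\<^sup>+p. \<integral>\<^sup>+s. ennreal ((Z s (fst (snd p), \<rho> p) - Y s (fst p))\<^sup>2) \<partial>lebesgue_on {0..T} \<partial>?P) =
        (\<integral>\<^sup>+s. \<integral>\<^sup>+p. ennreal ((Z s (fst (snd p), \<rho> p) - Y s (fst p))\<^sup>2) \<partial>?P \<partial>lebesgue_on {0..T})"
        by (rule PL.Fubini'[symmetric]) (use int_m in \<open>simp add: split_beta'\<close>)
      also have "\<dots> \<le> (\<integral>\<^sup>+s. ennreal ?c \<partial>lebesgue_on {0..T})"
      proof (rule nn_integral_mono)
        fix s assume "s \<in> space (lebesgue_on {0..T})"
        then have s: "0 \<le> s" "s \<le> T" by auto
        have "(\<integral>\<^sup>+p. ennreal ((Z s (fst (snd p), \<rho> p) - Y s (fst p))\<^sup>2) \<partial>?P) \<le> ennreal (\<sigma>2 / lam * (24 + 12 * sqrt (lam * s)))"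
          unfolding diff using rebuilt_cost[OF bm \<sigma>0 lam ne \<kappa>m \<kappa>_eq s(1)] unfolding split_beta' \<rho>_def by simp
        also have "\<dots> \<le> ennreal ?c"
          using \<sigma>0 lam s by (intro ennreal_leI mult_left_mono add_left_mono) auto
        finally show "(\<integral>\<^sup>+p. ennreal ((Z s (fst (snd p), \<rho> p) - Y s (fst p))\<^sup>2) \<partial>?P) \<le> ennreal ?c" .
      qed
      also have "(\<integral>\<^sup>+s. ennreal ?c \<partial>lebesgue_on {0..T}) = ennreal ?c * ennreal T"
        using T by (simp add: emeasure_restrict_space)
      finally show "(\<integral>\<^sup>+p. \<integral>\<^sup>+s. ennreal ((Z s (fst (snd p), \<rho> p) - Y s (fst p))\<^sup>2) \<partial>lebesgue_on {0..T} \<partial>?P) \<le> ennreal ?c * ennreal T" .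
    qed simp
    also have "\<dots> = ennreal ?c" by (rule cancel[OF c0])
    finally show "(\<integral>\<^sup>+p. ennreal ((ave_norm T (\<lambda>s. complex_of_real (Z s (fst (snd p), \<rho> p)) - complex_of_real (Y s (fst p))))\<^sup>2) \<partial>?P) \<le> ennreal ?c" .
  qed
qed

section \<open>Explicit bounds and final assembly\<close>

lemma exp_quot_le: "exp_quot z \<le> max 1 (exp z)"
proof (cases "z = 0")
  case False
  have "1 - z \<le> exp (- z)" using exp_ge_add_one_self[of "- z"] by simp
  then have "(1 - z) * exp z \<le> exp (- z) * exp z" by (intro mult_right_mono) auto
  then have "exp z - 1 \<le> z * exp z" by (simp add: mult_exp_exp algebra_simps)
  then have "exp_quot z \<le> exp z" if "0 < z" using that by (simp add: exp_quot_def pos_divide_le_eq mult.commute)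
  moreover have "exp_quot z \<le> 1" if "z < 0"
  proof -
    have "z \<le> exp z - 1" using exp_ge_add_one_self[of z] by linarith
    then show ?thesis using that by (simp add: exp_quot_def neg_divide_le_eq)
  qed
  ultimately show ?thesis using False by (cases "0 < z") auto
qed (simp add: exp_quot_def)

lemma telegraph_W_fun:
  assumes X: "telegraph_process M v0 w0 lam X" and v0: "v0 + w0 \<noteq> 0" and lam: "0 < lam" and L: "0 < L" and T: "0 < T"
  shows "integrable M (\<lambda>\<omega>. (W_fun T a c (\<lambda>s. X s \<omega> / L))\<^sup>2)"
    "(\<integral>\<omega>. (W_fun T a c (\<lambda>s. X s \<omega> / L))\<^sup>2 \<partial>M) \<le>
      exp_quot ((2 * c + (2 * a / L * ((v0 - w0) / 2) + (sqrt (lam\<^sup>2 + (2 * a / L * ((v0 + w0) / 2))\<^sup>2) - lam))) * T)"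
    "(\<integral>\<omega>. (W_fun T a c (\<lambda>s. X s \<omega> / L))\<^sup>2 \<partial>M) = enn2real (ennreal (1 / T) *
       (\<integral>\<^sup>+s. ennreal (exp (2 * c * s)) * (ennreal (exp (2 * a / L * ((v0 - w0) / 2) * s)) *
         (((\<integral>\<^sup>+\<tau>. ennreal (exp (2 * a / L * ((v0 + w0) / 2) * tele \<tau> s)) \<partial>expo_seq lam) +
           (\<integral>\<^sup>+\<tau>. ennreal (exp (- (2 * a / L * ((v0 + w0) / 2)) * tele \<tau> s)) \<partial>expo_seq lam)) / 2)) \<partial>lebesgue_on {0..T}))"
proof -
  interpret M: prob_space M using X by (simp add: telegraph_process_def)
  have XL: "case_prod (\<lambda>s \<omega>. X s \<omega> / L) \<in> borel_measurable (lebesgue_on {0..T} \<Otimes>\<^sub>M M)"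
    using telegraph_path(1)[OF X v0 lam, of T] by (simp add: split_beta')
  have cont: "continuous_on {0..T} (\<lambda>s. X s \<omega> / L)" if "\<omega> \<in> space M" for \<omega>
    using telegraph_path(2)[OF X v0 lam that] L by (auto intro!: continuous_intros)
  have m: "(\<integral>\<^sup>+\<omega>. ennreal (exp (2 * a * (X s \<omega> / L))) \<partial>M) = (\<integral>\<^sup>+\<omega>. ennreal (exp (2 * a / L * X s \<omega>)) \<partial>M)" for s
    by simp
  have le: "(\<integral>\<^sup>+\<omega>. ennreal (exp (2 * a * (X s \<omega> / L))) \<partial>M) \<le>
      ennreal (exp ((2 * a / L * ((v0 - w0) / 2) + (sqrt (lam\<^sup>2 + (2 * a / L * ((v0 + w0) / 2))\<^sup>2) - lam)) * s))" if "s \<in> {0..T}" for s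
    unfolding m using that by (intro telegraph_exp_moment_le[OF X v0 lam]) auto
  show "integrable M (\<lambda>\<omega>. (W_fun T a c (\<lambda>s. X s \<omega> / L))\<^sup>2)"
    by (rule integral_W_fun_square(1)[OF T M.sigma_finite_measure_axioms XL cont le])
  show "(\<integral>\<omega>. (W_fun T a c (\<lambda>s. X s \<omega> / L))\<^sup>2 \<partial>M) \<le>
      exp_quot ((2 * c + (2 * a / L * ((v0 - w0) / 2) + (sqrt (lam\<^sup>2 + (2 * a / L * ((v0 + w0) / 2))\<^sup>2) - lam))) * T)"
    by (rule integral_W_fun_square(2)[OF T M.sigma_finite_measure_axioms XL cont le])
  have "(\<integral>\<omega>. (W_fun T a c (\<lambda>s. X s \<omega> / L))\<^sup>2 \<partial>M) = enn2real (ennreal (1 / T) *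
      (\<integral>\<^sup>+s. ennreal (exp (2 * c * s)) * (\<integral>\<^sup>+\<omega>. ennreal (exp (2 * a * (X s \<omega> / L))) \<partial>M) \<partial>lebesgue_on {0..T}))"
    by (rule integral_W_fun_square(3)[OF T M.sigma_finite_measure_axioms XL cont le])
  also have "(\<integral>\<^sup>+s. ennreal (exp (2 * c * s)) * (\<integral>\<^sup>+\<omega>. ennreal (exp (2 * a * (X s \<omega> / L))) \<partial>M) \<partial>lebesgue_on {0..T}) =
     (\<integral>\<^sup>+s. ennreal (exp (2 * c * s)) * (ennreal (exp (2 * a / L * ((v0 - w0) / 2) * s)) *
         (((\<integral>\<^sup>+\<tau>. ennreal (exp (2 * a / L * ((v0 + w0) / 2) * tele \<tau> s)) \<partial>expo_seq lam) +
           (\<integral>\<^sup>+\<tau>. ennreal (exp (- (2 * a / L * ((v0 + w0) / 2)) * tele \<tau> s)) \<partial>expo_seq lam)) / 2)) \<partial>lebesgue_on {0..T})"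
    unfolding m by (rule nn_integral_cong, subst telegraph_exp_moment[OF X v0 lam]) auto
  finally show "(\<integral>\<omega>. (W_fun T a c (\<lambda>s. X s \<omega> / L))\<^sup>2 \<partial>M) = enn2real (ennreal (1 / T) *
       (\<integral>\<^sup>+s. ennreal (exp (2 * c * s)) * (ennreal (exp (2 * a / L * ((v0 - w0) / 2) * s)) *
         (((\<integral>\<^sup>+\<tau>. ennreal (exp (2 * a / L * ((v0 + w0) / 2) * tele \<tau> s)) \<partial>expo_seq lam) +
           (\<integral>\<^sup>+\<tau>. ennreal (exp (- (2 * a / L * ((v0 + w0) / 2)) * tele \<tau> s)) \<partial>expo_seq lam)) / 2)) \<partial>lebesgue_on {0..T}))" .
qed

text \<open>The drift contributes a deterministic exponential factor that can be moved into the
  parameter of \<open>W_fun\<close>; the remaining factor, built from the half gap of the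
  velocities, is the same for both processes.\<close>

lemma telegraph_W_fun_symmetric:
  assumes X: "telegraph_process M v0 w0 lam X" and v0: "v0 + w0 \<noteq> 0" and lam: "0 < lam" and L: "0 < L" and T: "0 < T"
    and Z: "symmetric_telegraph_process Q ((v0 + w0) / 2) lam Z"
  shows "(\<integral>\<omega>. (W_fun T a b (\<lambda>s. X s \<omega> / L))\<^sup>2 \<partial>M) = (\<integral>\<omega>. (W_fun T a (b + a * ((v0 - w0) / (2 * L))) (\<lambda>s. Z s \<omega> / L))\<^sup>2 \<partial>Q)"
proof -
  let ?v = "(v0 + w0) / 2"
  have Z': "telegraph_process Q ?v ?v lam Z" using Z by (simp add: symmetric_telegraph_process_def)
  have v: "?v + ?v \<noteq> 0" using v0 by simp
  have e: "ennreal (exp (2 * b * s)) * (ennreal (exp (2 * a / L * ((v0 - w0) / 2) * s)) * H) =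
    ennreal (exp (2 * (b + a * ((v0 - w0) / (2 * L))) * s)) * (ennreal (exp (2 * a / L * ((?v - ?v) / 2) * s)) * H)" for s H
  proof -
    have "exp (2 * b * s) * exp (2 * a / L * ((v0 - w0) / 2) * s) = exp (2 * (b + a * ((v0 - w0) / (2 * L))) * s)"
      unfolding mult_exp_exp using L by (intro arg_cong[where f=exp]) (simp add: field_simps)
    then show ?thesis by (simp add: mult.assoc[symmetric] flip: ennreal_mult)
  qed
  have vv: "(?v + ?v) / 2 = ?v" by simp
  show ?thesis
    unfolding telegraph_W_fun(3)[OF X v0 lam L T] telegraph_W_fun(3)[OF Z' v lam L T] vv e ..
qed

lemma symmetric_telegraph_W_fun_le:
  assumes v: "v \<noteq> 0" and lam: "0 < lam" and L: "0 < L" and T: "0 < T"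
    and Z: "symmetric_telegraph_process Q v lam Z" and L': "L' = lam * L / \<bar>v\<bar>"
  shows "(\<integral>\<omega>. (W_fun T a c (\<lambda>s. Z s \<omega> / L))\<^sup>2 \<partial>Q) \<le>
    (1 + 1 / sqrt (1 + 4 * a\<^sup>2 / L'\<^sup>2)) * max 1 (exp (2 * (lam * T) * c / lam + 4 * a\<^sup>2 * (lam * T / L'\<^sup>2) / (1 + sqrt (1 + 4 * a\<^sup>2 / L'\<^sup>2))))"
proof -
  have Z': "telegraph_process Q v v lam Z" using Z by (simp add: symmetric_telegraph_process_def)
  have vv: "v + v \<noteq> 0" using v by simp
  define y where "y = 4 * a\<^sup>2 / L'\<^sup>2"
  define r where "r = sqrt (1 + y)"
  have y: "0 \<le> y" by (simp add: y_def)
  have r: "1 \<le> r" "r\<^sup>2 = 1 + y" using y by (auto simp: r_def)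
  have "(2 * a / L * ((v + v) / 2))\<^sup>2 = lam\<^sup>2 * y"
    using v L lam by (simp add: y_def L' power_divide power_mult_distrib)
  then have "sqrt (lam\<^sup>2 + (2 * a / L * ((v + v) / 2))\<^sup>2) = sqrt (lam\<^sup>2 * (1 + y))" by (simp only: distrib_left mult_1_right)
  also have "\<dots> = lam * r" using lam by (simp add: real_sqrt_mult r_def)
  finally have s: "sqrt (lam\<^sup>2 + (2 * a / L * ((v + v) / 2))\<^sup>2) = lam * r" .
  \<comment> \<open>Rationalising: r - 1 equals y / (1 + r), which produces the denominator in the
    stated exponent.\<close>
  have "(r - 1) * (1 + r) = y" using r(2) by (simp add: algebra_simps power2_eq_square)
  then have r1: "r - 1 = y / (1 + r)" using r(1) by (simp add: nonzero_eq_divide_eq)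
  have e: "(2 * c + (2 * a / L * ((v - v) / 2) + (lam * r - lam))) * T = 2 * (lam * T) * c / lam + 4 * a\<^sup>2 * (lam * T / L'\<^sup>2) / (1 + r)"
  proof -
    have "lam * r - lam = lam * (y / (1 + r))" by (simp flip: r1 add: right_diff_distrib)
    then have "(2 * c + (2 * a / L * ((v - v) / 2) + (lam * r - lam))) * T = 2 * c * T + lam * (y / (1 + r)) * T" by (simp add: distrib_right)
    then show ?thesis using lam by (simp add: y_def)
  qed
  have "(\<integral>\<omega>. (W_fun T a c (\<lambda>s. Z s \<omega> / L))\<^sup>2 \<partial>Q) \<le> exp_quot (2 * (lam * T) * c / lam + 4 * a\<^sup>2 * (lam * T / L'\<^sup>2) / (1 + r))"
    using telegraph_W_fun(2)[OF Z' vv lam L T, of a c] unfolding s e .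
  also have "\<dots> \<le> max 1 (exp (2 * (lam * T) * c / lam + 4 * a\<^sup>2 * (lam * T / L'\<^sup>2) / (1 + r)))" by (rule exp_quot_le)
  \<comment> \<open>The prefactor is at least 1; the previous bound is merely enlarged to the stated
    form.\<close>
  also have "\<dots> \<le> (1 + 1 / r) * max 1 (exp (2 * (lam * T) * c / lam + 4 * a\<^sup>2 * (lam * T / L'\<^sup>2) / (1 + r)))"
    using r(1) mult_right_mono[of 1 "1 + 1 / r" "max 1 (exp (2 * (lam * T) * c / lam + 4 * a\<^sup>2 * (lam * T / L'\<^sup>2) / (1 + r)))"] by simp
  finally show ?thesis unfolding r_def y_def .
qed

text \<open>With q the fourth root of \<open>T'\<close>, the cost is the square root of 24 + 12 q^2
  over \<open>L'\<close>, at most 5 q + 5 over \<open>L'\<close> because 24 and 12 do not exceed 25.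
  This is the origin of the constant 5. The logarithm enters through \<open>ln (T' + 3)\<close>
  being at least 1, as \<open>exp 1\<close> is at most 3.\<close>

lemma wasserstein_rate_le:
  assumes T': "0 < T'" and L': "0 < L'"
  shows "sqrt (1 / L'\<^sup>2 * (24 + 12 * sqrt T')) \<le>
    5 * sqrt (T' / L'\<^sup>2) * T' powr (- (1/4)) * (sqrt (ln (T' + 3)) + T' powr (- (3/4))) + 5 / L'"
proof -
  define q where "q = T' powr (1/4)"
  have q0: "0 \<le> q" by (simp add: q_def)
  have q2: "q\<^sup>2 = sqrt T'" using T' by (simp add: q_def powr_half_sqrt[symmetric] powr_power)
  have q1: "sqrt T' * T' powr (- (1/4)) = q" using T' by (simp add: q_def powr_half_sqrt[symmetric] flip: powr_add)
  have "exp 1 \<le> T' + 3" using exp_le T' by linarith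
  then have "1 \<le> ln (T' + 3)" using T' by (subst ln_ge_iff) auto
  then have ln1: "1 \<le> sqrt (ln (T' + 3))" by simp
  have "24 + 12 * sqrt T' \<le> (5 * q + 5)\<^sup>2"
    unfolding q2[symmetric] using q0 by (simp add: power2_eq_square algebra_simps)
  then have "sqrt (24 + 12 * sqrt T') \<le> 5 * q + 5" using q0 by (intro real_le_lsqrt) auto
  then have "sqrt (24 + 12 * sqrt T') / L' \<le> (5 * q + 5) / L'" using L' by (intro divide_right_mono) auto
  also have "\<dots> = 5 / L' * q * 1 + 5 / L'" by (simp add: add_divide_distrib)
  also have "\<dots> \<le> 5 / L' * q * (sqrt (ln (T' + 3)) + T' powr (- (3/4))) + 5 / L'"
    using ln1 q0 L' by (intro add_right_mono mult_left_mono) (auto intro: order_trans[OF ln1])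
  also have "5 / L' * q = 5 * sqrt (T' / L'\<^sup>2) * T' powr (- (1/4))"
    unfolding q1[symmetric] using L' by (simp add: real_sqrt_divide)
  finally show ?thesis using L' by (simp add: real_sqrt_mult real_sqrt_divide)
qed

text \<open>The diffusivity is formed with half the velocity gap \<open>v\<close>, matching the
  long-time variance of the centred telegraph process, and the drift appears as \<open>a * d\<close>
  because the functional multiplies the path by \<open>a\<close>. The comparison processes may live
  on sample spaces of their own, and the constant is chosen before all parameters.\<close>

theorem corollary1p8:
  shows "\<exists>C>0.
    \<forall>(a::real) (b::real) (f::real \<Rightarrow> real) (g::real \<Rightarrow> real) (\<kappa>f::real) (\<kappa>g::real)
      (v0::real) (w0::real) (L::real) (T::real) (lam::real)
      (v::real) (d::real) (\<sigma>2::real) (T'::real) (L'::real)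
      (M::'a measure) (X::real \<Rightarrow> 'a \<Rightarrow> real) (N::'b measure) (Y::real \<Rightarrow> 'b \<Rightarrow> real).
      \<kappa>f-lipschitz_on UNIV f \<longrightarrow> \<kappa>g-lipschitz_on UNIV g \<longrightarrow>
      v0 + w0 \<noteq> 0 \<longrightarrow> 0 < L \<longrightarrow> 0 < T \<longrightarrow> 0 < lam \<longrightarrow>
      v = (v0 + w0) / 2 \<longrightarrow>
      d = (v0 - w0) / (2 * L) \<longrightarrow>
      \<sigma>2 = v\<^sup>2 / lam / L\<^sup>2 \<longrightarrow>
      T' = lam * T \<longrightarrow>
      L' = lam * L / \<bar>v\<bar> \<longrightarrow>
      telegraph_process M v0 w0 lam X \<longrightarrow>
      drifted_brownian_motion N d \<sigma>2 Y \<longrightarrow>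
        integrable M (\<lambda>\<omega>. F_fun T f g a b (\<lambda>s. X s \<omega> / L)) \<and>
        integrable N (\<lambda>\<omega>. F_fun T f g a b (\<lambda>s. Y s \<omega>)) \<and>
        integrable M (\<lambda>\<omega>. (W_fun T a b (\<lambda>s. X s \<omega> / L))\<^sup>2) \<and>
        integrable N (\<lambda>\<omega>. (W_fun T a b (\<lambda>s. Y s \<omega>))\<^sup>2) \<and>
        ennreal \<bar>(\<integral>\<omega>. F_fun T f g a b (\<lambda>s. X s \<omega> / L) \<partial>M)
                 - (\<integral>\<omega>. F_fun T f g a b (\<lambda>s. Y s \<omega>) \<partial>N)\<bar>
          \<le> ennreal (sqrt 2 * \<bar>a\<bar> * \<kappa>f * \<kappa>g)
             * wasserstein2 T (path_law T M (\<lambda>s \<omega>. X s \<omega> / L)) (path_law T N Y)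
             * ennreal (sqrt (\<integral>\<omega>. (W_fun T a b (\<lambda>s. X s \<omega> / L))\<^sup>2 \<partial>M)
                        + sqrt (\<integral>\<omega>. (W_fun T a b (\<lambda>s. Y s \<omega>))\<^sup>2 \<partial>N)) \<and>
        wasserstein2 T (path_law T M (\<lambda>s \<omega>. X s \<omega> / L)) (path_law T N Y)
          \<le> ennreal (C * sqrt (T' / L'\<^sup>2) * T' powr (- (1/4))
                         * (sqrt (ln (T' + 3)) + T' powr (- (3/4))) + C / L') \<and>
        (\<forall>(P::'c measure) (B::real \<Rightarrow> 'c \<Rightarrow> real). brownian_motion P \<sigma>2 B \<longrightarrow>
          (\<integral>\<omega>. (W_fun T a b (\<lambda>s. Y s \<omega>))\<^sup>2 \<partial>N)
            = (\<integral>\<omega>. (W_fun T a (b + a * d) (\<lambda>s. B s \<omega>))\<^sup>2 \<partial>P) \<and>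
          (\<integral>\<omega>. (W_fun T a (b + a * d) (\<lambda>s. B s \<omega>))\<^sup>2 \<partial>P)
            = exp_quot (2 * a\<^sup>2 * \<sigma>2 * T + 2 * (b + a * d) * T)) \<and>
        (\<forall>(Q::'d measure) (Z::real \<Rightarrow> 'd \<Rightarrow> real). symmetric_telegraph_process Q v lam Z \<longrightarrow>
          (\<integral>\<omega>. (W_fun T a b (\<lambda>s. X s \<omega> / L))\<^sup>2 \<partial>M)
            = (\<integral>\<omega>. (W_fun T a (b + a * d) (\<lambda>s. Z s \<omega> / L))\<^sup>2 \<partial>Q) \<and>
          (\<integral>\<omega>. (W_fun T a (b + a * d) (\<lambda>s. Z s \<omega> / L))\<^sup>2 \<partial>Q)
            \<le> (1 + 1 / sqrt (1 + 4 * a\<^sup>2 / L'\<^sup>2))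
               * max 1 (exp (2 * T' * (b + a * d) / lam
                             + 4 * a\<^sup>2 * (T' / L'\<^sup>2) / (1 + sqrt (1 + 4 * a\<^sup>2 / L'\<^sup>2)))))"
proof (intro exI[of _ "5::real"] conjI allI impI)
  fix a b :: real and f g :: "real \<Rightarrow> real" and \<kappa>f \<kappa>g v0 w0 L T lam v d \<sigma>2 T' L' :: real
    and M :: "'a measure" and X :: "real \<Rightarrow> 'a \<Rightarrow> real" and N :: "'b measure" and Y :: "real \<Rightarrow> 'b \<Rightarrow> real"
  assume f: "\<kappa>f-lipschitz_on UNIV f" and g: "\<kappa>g-lipschitz_on UNIV g" and v0: "v0 + w0 \<noteq> 0"
    and L: "0 < L" and T: "0 < T" and lam: "0 < lam" and v: "v = (v0 + w0) / 2" and d: "d = (v0 - w0) / (2 * L)"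
    and \<sigma>: "\<sigma>2 = v\<^sup>2 / lam / L\<^sup>2" and T': "T' = lam * T" and L': "L' = lam * L / \<bar>v\<bar>"
    and X: "telegraph_process M v0 w0 lam X" and Y: "drifted_brownian_motion N d \<sigma>2 Y"
  let ?\<mu> = "path_law T M (\<lambda>s \<omega>. X s \<omega> / L)" and ?\<nu> = "path_law T N Y"
  have vnz: "v \<noteq> 0" using v0 v by simp
  have \<sigma>0: "0 < \<sigma>2" using vnz lam L by (simp add: \<sigma>)
  have T'0: "0 < T'" and L'0: "0 < L'" using T lam L vnz by (auto simp: T' L')
  have M: "prob_space M" using X by (simp add: telegraph_process_def)
  define B where "B t \<omega> = Y t \<omega> - d * t" for t \<omega>
  have bm: "brownian_motion N \<sigma>2 B" using Y by (simp add: drifted_brownian_motion_def B_def[abs_def])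
  have N: "prob_space N" by (rule brownian_motionD(1)[OF bm])
  have YB: "W_fun T a b (\<lambda>s. Y s \<omega>) = W_fun T a (b + a * d) (\<lambda>s. B s \<omega>)" for \<omega>
    using W_fun_drift[of T a b "\<lambda>s. B s \<omega>" d] by (simp add: B_def)
  have XL: "case_prod (\<lambda>s \<omega>. X s \<omega> / L) \<in> borel_measurable (lebesgue_on {0..T} \<Otimes>\<^sub>M M)"
    using telegraph_path(1)[OF X v0 lam, of T] by (simp add: split_beta')
  have cX: "\<forall>\<omega>\<in>space M. continuous_on {0..T} (\<lambda>s. X s \<omega> / L)"
    using telegraph_path(2)[OF X v0 lam] L by (auto intro!: continuous_intros)
  have cY: "\<forall>\<omega>\<in>space N. continuous_on {0..T} (\<lambda>s. Y s \<omega>)"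
    using drifted_brownian_path(2)[OF Y] by blast
  have pX: "(\<lambda>\<omega> s. complex_of_real (X s \<omega> / L)) \<in> M \<rightarrow>\<^sub>M L2_ave T"
    using cX by (intro measurable_path[OF T XL]) auto
  have pY: "(\<lambda>\<omega> s. complex_of_real (Y s \<omega>)) \<in> N \<rightarrow>\<^sub>M L2_ave T"
    by (rule measurable_path[OF T drifted_brownian_path[OF Y]])
  show iX: "integrable M (\<lambda>\<omega>. (W_fun T a b (\<lambda>s. X s \<omega> / L))\<^sup>2)" by (rule telegraph_W_fun(1)[OF X v0 lam L T])
  show iY: "integrable N (\<lambda>\<omega>. (W_fun T a b (\<lambda>s. Y s \<omega>))\<^sup>2)"
    unfolding YB by (rule brownian_W_fun(1)[OF T \<sigma>0 bm])
  show "integrable M (\<lambda>\<omega>. F_fun T f g a b (\<lambda>s. X s \<omega> / L))" by (rule F_fun_integrable_limit(1)[OF T f g M pX cX iX])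
  show "integrable N (\<lambda>\<omega>. F_fun T f g a b (\<lambda>s. Y s \<omega>))" by (rule F_fun_integrable_limit(1)[OF T f g N pY cY iY])
  have "wasserstein2 T ?\<mu> ?\<nu> \<le> ennreal (sqrt (\<sigma>2 / lam * (24 + 12 * sqrt (lam * T))))"
    by (rule telegraph_brownian_wasserstein[OF X v0 lam Y T L d \<sigma>[unfolded v]])
  also have "\<sigma>2 / lam = 1 / L'\<^sup>2" using vnz lam L by (simp add: \<sigma> L' power_divide power_mult_distrib power2_eq_square)
  also have "ennreal (sqrt (1 / L'\<^sup>2 * (24 + 12 * sqrt (lam * T)))) \<le>
    ennreal (5 * sqrt (T' / L'\<^sup>2) * T' powr (- (1/4)) * (sqrt (ln (T' + 3)) + T' powr (- (3/4))) + 5 / L')"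
    unfolding T'[symmetric] by (intro ennreal_leI wasserstein_rate_le T'0 L'0)
  finally show W2: "wasserstein2 T ?\<mu> ?\<nu> \<le>
    ennreal (5 * sqrt (T' / L'\<^sup>2) * T' powr (- (1/4)) * (sqrt (ln (T' + 3)) + T' powr (- (3/4))) + 5 / L')" .
  show "ennreal \<bar>(\<integral>\<omega>. F_fun T f g a b (\<lambda>s. X s \<omega> / L) \<partial>M) - (\<integral>\<omega>. F_fun T f g a b (\<lambda>s. Y s \<omega>) \<partial>N)\<bar>
      \<le> ennreal (sqrt 2 * \<bar>a\<bar> * \<kappa>f * \<kappa>g) * wasserstein2 T ?\<mu> ?\<nu>
        * ennreal (sqrt (\<integral>\<omega>. (W_fun T a b (\<lambda>s. X s \<omega> / L))\<^sup>2 \<partial>M) + sqrt (\<integral>\<omega>. (W_fun T a b (\<lambda>s. Y s \<omega>))\<^sup>2 \<partial>N))"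
    using le_less_trans[OF W2 ennreal_less_top] by (rule F_fun_wasserstein_bound[OF T f g M pX cX iX N pY cY iY])
  {
    fix P :: "'c measure" and B' :: "real \<Rightarrow> 'c \<Rightarrow> real" assume B': "brownian_motion P \<sigma>2 B'"
    show B'_eq: "(\<integral>\<omega>. (W_fun T a (b + a * d) (\<lambda>s. B' s \<omega>))\<^sup>2 \<partial>P) = exp_quot (2 * a\<^sup>2 * \<sigma>2 * T + 2 * (b + a * d) * T)"
      by (rule brownian_W_fun(2)[OF T \<sigma>0 B'])
    show "(\<integral>\<omega>. (W_fun T a b (\<lambda>s. Y s \<omega>))\<^sup>2 \<partial>N) = (\<integral>\<omega>. (W_fun T a (b + a * d) (\<lambda>s. B' s \<omega>))\<^sup>2 \<partial>P)"
      \<comment> \<open>Both sides equal the same closed form, computed separately on each sample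
        space; no relation between the two Brownian motions is involved.\<close>
      unfolding YB B'_eq by (rule brownian_W_fun(2)[OF T \<sigma>0 bm])
  }
  {
    fix Q :: "'d measure" and Z :: "real \<Rightarrow> 'd \<Rightarrow> real" assume Z: "symmetric_telegraph_process Q v lam Z"
    show "(\<integral>\<omega>. (W_fun T a b (\<lambda>s. X s \<omega> / L))\<^sup>2 \<partial>M) = (\<integral>\<omega>. (W_fun T a (b + a * d) (\<lambda>s. Z s \<omega> / L))\<^sup>2 \<partial>Q)"
      unfolding d by (rule telegraph_W_fun_symmetric[OF X v0 lam L T Z[unfolded v]])
    show "(\<integral>\<omega>. (W_fun T a (b + a * d) (\<lambda>s. Z s \<omega> / L))\<^sup>2 \<partial>Q)
            \<le> (1 + 1 / sqrt (1 + 4 * a\<^sup>2 / L'\<^sup>2))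
               * max 1 (exp (2 * T' * (b + a * d) / lam
                             + 4 * a\<^sup>2 * (T' / L'\<^sup>2) / (1 + sqrt (1 + 4 * a\<^sup>2 / L'\<^sup>2))))"
      unfolding T' by (rule symmetric_telegraph_W_fun_le[OF vnz lam L T Z L'])
  }
qed simp

end
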